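(* Over $\mathbf{ACA}_0$ the following three statements are equivalent: (i) Every coded normal dilator has a well-founded fixed point. (ii) If $T$ is a coded normal dilator, then $\operatorname{Fix}(T)$ (with the order $<_{\operatorname{Fix}(T)}$) is well-founded. (iii) The principle of $\Pi^1_1$-induction along the natural numbers holds (every instance, with parameters).
   Context: All notions are formalized in second-order arithmetic. The category of natural numbers has as objects the finite orders $n=\{0,\dots,n-1\}$ and as morphisms the strictly increasing maps. For a finite linear order $a$ let $|a|$ be its cardinality and $\operatorname{en}_a:|a|\to a$ its increasing enumeration; for an embedding $f:a\to b$ of finite orders let $|f|:|a|\to|b|$ be the unique map with $f\circ\operatorname{en}_a=\operatorname{en}_b\circ|f|$. $[X]^{<\omega}$ is the set of finite subsets of $X$, and $[f]^{<\omega}(a)=\{f(x)\mid x\in a\}$. A coded prae-dilator consists of (1) a functor $T$ from the category of natural numbers to linear orders, each $T(n)$ having field a subset of $\mathbb N$, and (2) a natural transformation $\operatorname{supp}^T:T\Rightarrow[\cdot]^{<\omega}$ such that each $\sigma\in T(n)$ lies in the range of $T(\iota_\sigma\circ\operatorname{en}_\sigma)$, where $\iota_\sigma\circ\operatorname{en}_\sigma:|\operatorname{supp}^T_n(\sigma)|\to n$ is the unique embedding with range $\operatorname{supp}^T_n(\sigma)$. For a linear order $X$, $D^T(X)$ is the set of pairs $\langle a,\sigma\rangle$ with $a\in[X]^{<\omega}$, $\sigma\in T(|a|)$ and $\operatorname{supp}^T_{|a|}(\sigma)=|a|$, ordered by $\langle a,\sigma\rangle<\langle b,\tau\rangle$ iff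 $T(|\iota_a^{a\cup b}|)(\sigma)<_{T(|a\cup b|)}T(|\iota_b^{a\cup b}|)(\tau)$, where $\iota_a^{a\cup b},\iota_b^{a\cup b}$ are the inclusions into $a\cup b$. A coded dilator is a coded prae-dilator $T$ such that $D^T(X)$ is well-founded for every well-order $X$ with field contained in $\mathbb N$. A (coded) normal prae-dilator is a coded prae-dilator $T$ together with a natural family of embeddings $\mu^T_n:n\to T(n)$ such that for all $m<n$ and $\sigma\in T(n)$: $\sigma<_{T(n)}\mu^T_n(m)$ iff $\operatorname{supp}^T_n(\sigma)\subseteq\{0,\dots,m-1\}$; it is a normal dilator if moreover $T$ is a coded dilator. A fixed point of a normal prae-dilator $T$ is a linear order $X$ together with an order embedding $\xi:D^T(X)\to X$; it is well-founded if $X$ is. $\operatorname{Fix}(T)$: the set of (Gödel-numbered) terms generated by the clause: whenever $a$ is a finite set of terms in $\operatorname{Fix}(T)$ and $\sigma\in T(|a|)$ with $\operatorname{supp}^T_{|a|}(\sigma)=|a|$, there is a term $\xi\langle a,\sigma\rangle\in\operatorname{Fix}(T)$. Set $L_T(\xi\langle a,\sigma\rangle)=\max\{\ulcorner\xi\langle a,\sigma\rangle\urcorner,1+\sum_{s\in a}2\cdot L_T(s)\}$. The relation $<_{\operatorname{Fix}(T)}$ is defined by recursion on $L_T(s)+L_T(t)$: $\xi\langle a,\sigma\rangle<_{\operatorname{Fix}(T)}\xi\langle b,\tau\rangle$ iff the restriction of $<_{\operatorname{Fix}(T)}$ to $a\cup b$ is a linear order and $T(|\iota_a^{a\cup b}|)(\sigma)<_{T(|a\cup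 b|)}T(|\iota_b^{a\cup b}|)(\tau)$, with enumerations taken with respect to $<_{\operatorname{Fix}(T)}$. *)

theory Defs
  imports Main
begin

section \<open>The language of second-order arithmetic and its models\<close>

text \<open>
  A structure interprets the number sort by all of the type \<open>'a\<close> (which may well be a nonstandard
  model of arithmetic) and the set sort by an arbitrary family of subsets of \<open>'a\<close>.
\<close>

record 'a l2_structure =
  zero_of :: 'a
  one_of :: 'a
  add_of :: "'a \<Rightarrow> 'a \<Rightarrow> 'a"
  mul_of :: "'a \<Rightarrow> 'a \<Rightarrow> 'a"
  less_of :: "'a \<Rightarrow> 'a \<Rightarrow> bool"
  sets_of :: "'a set set"

datatype l2_term = NumVar nat | Zero | One | Add l2_term l2_term | Mul l2_term l2_term

datatype l2_formula =
    Eq l2_term l2_term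
  | Less l2_term l2_term
  | Mem l2_term nat
  | Neg l2_formula
  | Conj l2_formula l2_formula
  | AllNum nat l2_formula
  | AllSet nat l2_formula

primrec arithmetical :: "l2_formula \<Rightarrow> bool" where
  "arithmetical (Eq s t) \<longleftrightarrow> True"
| "arithmetical (Less s t) \<longleftrightarrow> True"
| "arithmetical (Mem t i) \<longleftrightarrow> True"
| "arithmetical (Neg p) \<longleftrightarrow> arithmetical p"
| "arithmetical (Conj p q) \<longleftrightarrow> arithmetical p \<and> arithmetical q"
| "arithmetical (AllNum x p) \<longleftrightarrow> arithmetical p"
| "arithmetical (AllSet i p) \<longleftrightarrow> False"

definition Pi11_formula :: "l2_formula \<Rightarrow> bool" where
  "Pi11_formula p \<longleftrightarrow> (\<exists>i q. arithmetical q \<and> p = AllSet i q)"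

primrec term_value :: "'a l2_structure \<Rightarrow> (nat \<Rightarrow> 'a) \<Rightarrow> l2_term \<Rightarrow> 'a" where
  "term_value M e (NumVar x) = e x"
| "term_value M e Zero = zero_of M"
| "term_value M e One = one_of M"
| "term_value M e (Add s t) = add_of M (term_value M e s) (term_value M e t)"
| "term_value M e (Mul s t) = mul_of M (term_value M e s) (term_value M e t)"

primrec satisfies :: "'a l2_structure \<Rightarrow> (nat \<Rightarrow> 'a) \<Rightarrow> (nat \<Rightarrow> 'a set) \<Rightarrow> l2_formula \<Rightarrow> bool" where
  "satisfies M e E (Eq s t) \<longleftrightarrow> term_value M e s = term_value M e t"
| "satisfies M e E (Less s t) \<longleftrightarrow> less_of M (term_value M e s) (term_value M e t)"
| "satisfies M e E (Mem t i) \<longleftrightarrow> term_value M e t \<in> E i"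
| "satisfies M e E (Neg p) \<longleftrightarrow> \<not> satisfies M e E p"
| "satisfies M e E (Conj p q) \<longleftrightarrow> satisfies M e E p \<and> satisfies M e E q"
| "satisfies M e E (AllNum x p) \<longleftrightarrow> (\<forall>a. satisfies M (e(x := a)) E p)"
| "satisfies M e E (AllSet i p) \<longleftrightarrow> (\<forall>X\<in>sets_of M. satisfies M e (E(i := X)) p)"

text \<open>
  All definitions below are relative to a structure \<open>M\<close> and are \<open>M\<close>-interpretations of formulas of
  second-order arithmetic: quantifiers over \<open>'a\<close> are number quantifiers, and set quantifiers range
  over \<open>sets_of M\<close> only.  In particular, finite sets, finite functions, cardinalities, terms and
  well-foundedness are those in the sense of \<open>M\<close>, not those of HOL.
\<close>

context
  fixes M :: "'a l2_structure"
begin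

abbreviation zero_M ("\<zero>") where "\<zero> \<equiv> zero_of M"
abbreviation one_M ("\<one>") where "\<one> \<equiv> one_of M"
abbreviation add_M (infixl "\<oplus>" 65) where "x \<oplus> y \<equiv> add_of M x y"
abbreviation mul_M (infixl "\<otimes>" 70) where "x \<otimes> y \<equiv> mul_of M x y"
abbreviation less_M (infix "\<prec>" 50) where "x \<prec> y \<equiv> less_of M x y"
abbreviation sets_M ("\<S>") where "\<S> \<equiv> sets_of M"

definition basic_axioms :: bool where
  "basic_axioms \<longleftrightarrow>
     (\<forall>m. m \<oplus> \<one> \<noteq> \<zero>) \<and>
     (\<forall>m n. m \<oplus> \<one> = n \<oplus> \<one> \<longrightarrow> m = n) \<and>
     (\<forall>m. m \<oplus> \<zero> = m) \<and>
     (\<forall>m n. m \<oplus> (n \<oplus> \<one>) = (m \<oplus> n) \<oplus> \<one>) \<and>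
     (\<forall>m. m \<otimes> \<zero> = \<zero>) \<and>
     (\<forall>m n. m \<otimes> (n \<oplus> \<one>) = (m \<otimes> n) \<oplus> m) \<and>
     (\<forall>m. \<not> m \<prec> \<zero>) \<and>
     (\<forall>m n. m \<prec> n \<oplus> \<one> \<longleftrightarrow> m \<prec> n \<or> m = n)"

definition set_induction :: bool where
  "set_induction \<longleftrightarrow>
     (\<forall>X\<in>\<S>. \<zero> \<in> X \<and> (\<forall>n. n \<in> X \<longrightarrow> n \<oplus> \<one> \<in> X) \<longrightarrow> (\<forall>n. n \<in> X))"

text \<open>The assignments \<open>e\<close> and \<open>E\<close> supply the number and set parameters of an instance.\<close>

definition arithmetical_comprehension :: bool where
  "arithmetical_comprehension \<longleftrightarrow>
     (\<forall>p x e E. arithmetical p \<longrightarrow> range E \<subseteq> \<S> \<longrightarrow> {n. satisfies M (e(x := n)) E p} \<in> \<S>)"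

definition ACA0 :: bool where
  "ACA0 \<longleftrightarrow> \<S> \<noteq> {} \<and> basic_axioms \<and> set_induction \<and> arithmetical_comprehension"

definition Pi11_induction :: bool where
  "Pi11_induction \<longleftrightarrow>
     (\<forall>p x e E. Pi11_formula p \<longrightarrow> range E \<subseteq> \<S> \<longrightarrow>
        satisfies M (e(x := \<zero>)) E p \<longrightarrow>
        (\<forall>n. satisfies M (e(x := n)) E p \<longrightarrow> satisfies M (e(x := n \<oplus> \<one>)) E p) \<longrightarrow>
        (\<forall>n. satisfies M (e(x := n)) E p))"


section \<open>Coding of pairs and finite sets\<close>

definition pair :: "'a \<Rightarrow> 'a \<Rightarrow> 'a" where
  "pair i j = (i \<oplus> j) \<otimes> (i \<oplus> j) \<oplus> i"

definition divides :: "'a \<Rightarrow> 'a \<Rightarrow> bool" where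
  "divides x y \<longleftrightarrow> (\<exists>q. y = x \<otimes> q)"

text \<open>
  Finite sets are coded as usual via Goedel's beta function: the code of a set is the
  least triple \<open>(k, (m, n))\<close> such that its elements are those \<open>i < k\<close> for which \<open>m(i + 1) + 1\<close>
  divides \<open>n\<close>.  Hence codes are unique and every element of a set is smaller than the code of
  that set.
\<close>

definition fmem :: "'a \<Rightarrow> 'a \<Rightarrow> bool" where
  "fmem i c \<longleftrightarrow> (\<exists>k m n. c = pair k (pair m n) \<and> i \<prec> k \<and> divides (m \<otimes> (i \<oplus> \<one>) \<oplus> \<one>) n)"

definition fin_code :: "'a \<Rightarrow> bool" where
  "fin_code c \<longleftrightarrow>
     (\<exists>k m n. c = pair k (pair m n)) \<and>
     (\<forall>c'. c' \<prec> c \<longrightarrow> (\<exists>k m n. c' = pair k (pair m n)) \<longrightarrow> (\<exists>i. fmem i c' \<noteq> fmem i c))"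

definition initial_segment :: "'a \<Rightarrow> 'a \<Rightarrow> bool" where
  "initial_segment n a \<longleftrightarrow> fin_code a \<and> (\<forall>i. fmem i a \<longleftrightarrow> i \<prec> n)"

definition fin_union :: "'a \<Rightarrow> 'a \<Rightarrow> 'a \<Rightarrow> bool" where
  "fin_union a b c \<longleftrightarrow> fin_code c \<and> (\<forall>x. fmem x c \<longleftrightarrow> fmem x a \<or> fmem x b)"

text \<open>A finite function is coded by its graph, a finite set of pairs.\<close>

definition fapp :: "'a \<Rightarrow> 'a \<Rightarrow> 'a \<Rightarrow> bool" where
  "fapp f i j \<longleftrightarrow> fmem (pair i j) f"

definition fin_bij :: "'a \<Rightarrow> 'a \<Rightarrow> 'a \<Rightarrow> bool" where
  "fin_bij e k a \<longleftrightarrow>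
     fin_code e \<and>
     (\<forall>p. fmem p e \<longrightarrow> (\<exists>i x. p = pair i x \<and> i \<prec> k \<and> fmem x a)) \<and>
     (\<forall>i. i \<prec> k \<longrightarrow> (\<exists>!x. fapp e i x)) \<and>
     (\<forall>x. fmem x a \<longrightarrow> (\<exists>!i. fapp e i x))"

definition fin_card :: "'a \<Rightarrow> 'a \<Rightarrow> bool" where
  "fin_card a k \<longleftrightarrow> fin_code a \<and> (\<exists>e. fin_bij e k a)"


section \<open>Orders\<close>

text \<open>Linear orders are strict; only the restriction of the relation to the field matters.\<close>

definition linear_order_on_class :: "('a \<Rightarrow> bool) \<Rightarrow> ('a \<Rightarrow> 'a \<Rightarrow> bool) \<Rightarrow> bool" where
  "linear_order_on_class U lt \<longleftrightarrow>
     (\<forall>x. U x \<longrightarrow> \<not> lt x x) \<and>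
     (\<forall>x y z. U x \<and> U y \<and> U z \<and> lt x y \<and> lt y z \<longrightarrow> lt x z) \<and>
     (\<forall>x y. U x \<and> U y \<longrightarrow> lt x y \<or> x = y \<or> lt y x)"

definition well_founded_on_class :: "('a \<Rightarrow> bool) \<Rightarrow> ('a \<Rightarrow> 'a \<Rightarrow> bool) \<Rightarrow> bool" where
  "well_founded_on_class U lt \<longleftrightarrow>
     \<not> (\<exists>F\<in>\<S>. (\<forall>n. \<exists>!x. pair n x \<in> F) \<and>
               (\<forall>n x. pair n x \<in> F \<longrightarrow> U x) \<and>
               (\<forall>n x y. pair n x \<in> F \<and> pair (n \<oplus> \<one>) y \<in> F \<longrightarrow> lt y x))"

definition rel :: "'a set \<Rightarrow> 'a \<Rightarrow> 'a \<Rightarrow> bool" where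
  "rel R x y \<longleftrightarrow> pair x y \<in> R"

definition linear_order_set :: "'a set \<Rightarrow> 'a set \<Rightarrow> bool" where
  "linear_order_set X R \<longleftrightarrow> X \<in> \<S> \<and> R \<in> \<S> \<and> linear_order_on_class (\<lambda>x. x \<in> X) (rel R)"

definition well_founded_set :: "'a set \<Rightarrow> 'a set \<Rightarrow> bool" where
  "well_founded_set X R \<longleftrightarrow> well_founded_on_class (\<lambda>x. x \<in> X) (rel R)"

definition well_order_set :: "'a set \<Rightarrow> 'a set \<Rightarrow> bool" where
  "well_order_set X R \<longleftrightarrow> linear_order_set X R \<and> well_founded_set X R"

text \<open>\<open>e\<close> is the increasing enumeration of the finite set \<open>a\<close> of cardinality \<open>k\<close>.\<close>

definition enumerates :: "('a \<Rightarrow> 'a \<Rightarrow> bool) \<Rightarrow> 'a \<Rightarrow> 'a \<Rightarrow> 'a \<Rightarrow> bool" where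
  "enumerates lt a k e \<longleftrightarrow>
     fin_bij e k a \<and>
     (\<forall>i j x y. fapp e i x \<and> fapp e j y \<and> i \<prec> j \<longrightarrow> lt x y)"


section \<open>Coded prae-dilators\<close>

definition nat_morphism :: "'a \<Rightarrow> 'a \<Rightarrow> 'a \<Rightarrow> bool" where
  "nat_morphism m n f \<longleftrightarrow>
     fin_code f \<and>
     (\<forall>p. fmem p f \<longrightarrow> (\<exists>i j. p = pair i j \<and> i \<prec> m \<and> j \<prec> n)) \<and>
     (\<forall>i. i \<prec> m \<longrightarrow> (\<exists>!j. fapp f i j)) \<and>
     (\<forall>i i' j j'. fapp f i j \<and> fapp f i' j' \<and> i \<prec> i' \<longrightarrow> j \<prec> j')"

definition is_identity :: "'a \<Rightarrow> 'a \<Rightarrow> bool" where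
  "is_identity n f \<longleftrightarrow> nat_morphism n n f \<and> (\<forall>i. i \<prec> n \<longrightarrow> fapp f i i)"

definition is_composition :: "'a \<Rightarrow> 'a \<Rightarrow> 'a \<Rightarrow> 'a \<Rightarrow> 'a \<Rightarrow> 'a \<Rightarrow> bool" where
  "is_composition l m n f g h \<longleftrightarrow>
     nat_morphism l m f \<and> nat_morphism m n g \<and> nat_morphism l n h \<and>
     (\<forall>i j k. fapp f i j \<and> fapp g j k \<longrightarrow> fapp h i k)"

text \<open>\<open>f\<close> is the morphism \<open>|\<iota>\<^sub>a\<^sub>c| : |a| \<rightarrow> |c|\<close> for the inclusion \<open>\<iota>\<^sub>a\<^sub>c\<close> of \<open>a\<close> into \<open>c\<close>,
  where \<open>|a| = k\<close> and \<open>|c| = n\<close>.\<close>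

definition inclusion_morphism :: "('a \<Rightarrow> 'a \<Rightarrow> bool) \<Rightarrow> 'a \<Rightarrow> 'a \<Rightarrow> 'a \<Rightarrow> 'a \<Rightarrow> 'a \<Rightarrow> bool" where
  "inclusion_morphism lt a c k n f \<longleftrightarrow>
     nat_morphism k n f \<and>
     (\<exists>e e'. enumerates lt a k e \<and> enumerates lt c n e' \<and>
        (\<forall>i j x y. fapp e i x \<and> fapp f i j \<and> fapp e' j y \<longrightarrow> x = y))"

end

text \<open>
  A coded prae-dilator \<open>T\<close> is given by four sets, which code the fields and the orders of the
  \<open>T(n)\<close>, the action of \<open>T\<close> on morphisms, and the support functions.
\<close>

record 'a coded_functor =
  field_of :: "'a set"
  order_of :: "'a set"
  action_of :: "'a set"
  supp_of :: "'a set"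

context
  fixes M :: "'a l2_structure"
begin

abbreviation zero_M' ("\<zero>") where "\<zero> \<equiv> zero_of M"
abbreviation one_M' ("\<one>") where "\<one> \<equiv> one_of M"
abbreviation less_M' (infix "\<prec>" 50) where "x \<prec> y \<equiv> less_of M x y"
abbreviation sets_M' ("\<S>") where "\<S> \<equiv> sets_of M"

text \<open>\<open>\<sigma> \<in> T(n)\<close>\<close>
definition T_mem :: "'a coded_functor \<Rightarrow> 'a \<Rightarrow> 'a \<Rightarrow> bool" where
  "T_mem T n \<sigma> \<longleftrightarrow> pair M n \<sigma> \<in> field_of T"

text \<open>\<open>\<sigma> < \<tau>\<close> in \<open>T(n)\<close>\<close>
definition T_less :: "'a coded_functor \<Rightarrow> 'a \<Rightarrow> 'a \<Rightarrow> 'a \<Rightarrow> bool" where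
  "T_less T n \<sigma> \<tau> \<longleftrightarrow> pair M n (pair M \<sigma> \<tau>) \<in> order_of T"

text \<open>\<open>T(f)(\<sigma>) = \<tau>\<close> for \<open>f : m \<rightarrow> n\<close>\<close>
definition T_map :: "'a coded_functor \<Rightarrow> 'a \<Rightarrow> 'a \<Rightarrow> 'a \<Rightarrow> 'a \<Rightarrow> 'a \<Rightarrow> bool" where
  "T_map T m n f \<sigma> \<tau> \<longleftrightarrow> pair M m (pair M n (pair M f (pair M \<sigma> \<tau>))) \<in> action_of T"

text \<open>\<open>a\<close> codes the support of \<open>\<sigma> \<in> T(n)\<close>\<close>
definition T_supp :: "'a coded_functor \<Rightarrow> 'a \<Rightarrow> 'a \<Rightarrow> 'a \<Rightarrow> bool" where
  "T_supp T n \<sigma> a \<longleftrightarrow> pair M n (pair M \<sigma> a) \<in> supp_of T"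

definition is_functor :: "'a coded_functor \<Rightarrow> bool" where
  "is_functor T \<longleftrightarrow>
     (\<forall>n. linear_order_on_class (T_mem T n) (T_less T n)) \<and>
     (\<forall>m n f. nat_morphism M m n f \<longrightarrow>
        (\<forall>\<sigma>. T_mem T m \<sigma> \<longrightarrow> (\<exists>!\<tau>. T_map T m n f \<sigma> \<tau>)) \<and>
        (\<forall>\<sigma> \<tau>. T_mem T m \<sigma> \<and> T_map T m n f \<sigma> \<tau> \<longrightarrow> T_mem T n \<tau>) \<and>
        (\<forall>\<sigma> \<sigma>' \<tau> \<tau>'. T_mem T m \<sigma> \<and> T_mem T m \<sigma>' \<and> T_map T m n f \<sigma> \<tau> \<and> T_map T m n f \<sigma>' \<tau>' \<and>
           T_less T m \<sigma> \<sigma>' \<longrightarrow> T_less T n \<tau> \<tau>')) \<and>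
     (\<forall>n f \<sigma>. is_identity M n f \<and> T_mem T n \<sigma> \<longrightarrow> T_map T n n f \<sigma> \<sigma>) \<and>
     (\<forall>l m n f g h \<rho> \<sigma> \<tau>. is_composition M l m n f g h \<and> T_mem T l \<rho> \<and>
        T_map T l m f \<rho> \<sigma> \<and> T_map T m n g \<sigma> \<tau> \<longrightarrow> T_map T l n h \<rho> \<tau>)"

definition natural_supports :: "'a coded_functor \<Rightarrow> bool" where
  "natural_supports T \<longleftrightarrow>
     (\<forall>n \<sigma>. T_mem T n \<sigma> \<longrightarrow> (\<exists>!a. T_supp T n \<sigma> a)) \<and>
     (\<forall>n \<sigma> a. T_mem T n \<sigma> \<and> T_supp T n \<sigma> a \<longrightarrow> fin_code M a \<and> (\<forall>i. fmem M i a \<longrightarrow> i \<prec> n)) \<and>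
     (\<forall>m n f \<sigma> \<tau> a b. nat_morphism M m n f \<and> T_mem T m \<sigma> \<and> T_map T m n f \<sigma> \<tau> \<and>
        T_supp T m \<sigma> a \<and> T_supp T n \<tau> b \<longrightarrow>
        (\<forall>j. fmem M j b \<longleftrightarrow> (\<exists>i. fmem M i a \<and> fapp M f i j)))"

definition support_condition :: "'a coded_functor \<Rightarrow> bool" where
  "support_condition T \<longleftrightarrow>
     (\<forall>n \<sigma> a k f. T_mem T n \<sigma> \<and> T_supp T n \<sigma> a \<and> fin_card M a k \<and> nat_morphism M k n f \<and>
        (\<forall>j. fmem M j a \<longleftrightarrow> (\<exists>i. fapp M f i j)) \<longrightarrow>
        (\<exists>\<sigma>'. T_mem T k \<sigma>' \<and> T_map T k n f \<sigma>' \<sigma>))"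

definition coded_prae_dilator :: "'a coded_functor \<Rightarrow> bool" where
  "coded_prae_dilator T \<longleftrightarrow>
     field_of T \<in> \<S> \<and> order_of T \<in> \<S> \<and> action_of T \<in> \<S> \<and> supp_of T \<in> \<S> \<and>
     is_functor T \<and> natural_supports T \<and> support_condition T"


section \<open>The orders \<open>D\<^sup>T(X)\<close> and coded dilators\<close>

definition full_support :: "'a coded_functor \<Rightarrow> 'a \<Rightarrow> 'a \<Rightarrow> bool" where
  "full_support T k \<sigma> \<longleftrightarrow> T_mem T k \<sigma> \<and> (\<exists>b. T_supp T k \<sigma> b \<and> initial_segment M k b)"

definition D_pair :: "'a coded_functor \<Rightarrow> ('a \<Rightarrow> bool) \<Rightarrow> 'a \<Rightarrow> 'a \<Rightarrow> bool" where
  "D_pair T U a \<sigma> \<longleftrightarrow>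
     fin_code M a \<and> (\<forall>x. fmem M x a \<longrightarrow> U x) \<and> (\<exists>k. fin_card M a k \<and> full_support T k \<sigma>)"

text \<open>\<open>T(|\<iota>\<^sub>a\<^sub>c|)(\<sigma>) < T(|\<iota>\<^sub>b\<^sub>c|)(\<tau>)\<close> in \<open>T(|c|)\<close> for \<open>c = a \<union> b\<close>, with enumerations
  according to \<open>lt\<close>\<close>
definition D_compare ::
  "'a coded_functor \<Rightarrow> ('a \<Rightarrow> 'a \<Rightarrow> bool) \<Rightarrow> 'a \<Rightarrow> 'a \<Rightarrow> 'a \<Rightarrow> 'a \<Rightarrow> bool" where
  "D_compare T lt a \<sigma> b \<tau> \<longleftrightarrow>
     (\<exists>c k l n f g \<sigma>' \<tau>'. fin_union M a b c \<and>
        inclusion_morphism M lt a c k n f \<and> inclusion_morphism M lt b c l n g \<and>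
        T_map T k n f \<sigma> \<sigma>' \<and> T_map T l n g \<tau> \<tau>' \<and> T_less T n \<sigma>' \<tau>')"

definition D_mem :: "'a coded_functor \<Rightarrow> 'a set \<Rightarrow> 'a \<Rightarrow> bool" where
  "D_mem T X d \<longleftrightarrow> (\<exists>a \<sigma>. d = pair M a \<sigma> \<and> D_pair T (\<lambda>x. x \<in> X) a \<sigma>)"

definition D_less :: "'a coded_functor \<Rightarrow> 'a set \<Rightarrow> 'a \<Rightarrow> 'a \<Rightarrow> bool" where
  "D_less T R d d' \<longleftrightarrow>
     (\<exists>a \<sigma> b \<tau>. d = pair M a \<sigma> \<and> d' = pair M b \<tau> \<and> D_compare T (rel M R) a \<sigma> b \<tau>)"

definition coded_dilator :: "'a coded_functor \<Rightarrow> bool" where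
  "coded_dilator T \<longleftrightarrow>
     coded_prae_dilator T \<and>
     (\<forall>X\<in>\<S>. \<forall>R\<in>\<S>. well_order_set M X R \<longrightarrow> well_founded_on_class M (D_mem T X) (D_less T R))"


section \<open>Normal dilators and their fixed points\<close>

text \<open>\<open>\<mu>\<^sub>n(m) = \<sigma>\<close>\<close>
definition mu_val :: "'a set \<Rightarrow> 'a \<Rightarrow> 'a \<Rightarrow> 'a \<Rightarrow> bool" where
  "mu_val \<mu> n m \<sigma> \<longleftrightarrow> pair M n (pair M m \<sigma>) \<in> \<mu>"

definition normal_prae_dilator :: "'a coded_functor \<Rightarrow> 'a set \<Rightarrow> bool" where
  "normal_prae_dilator T \<mu> \<longleftrightarrow>
     coded_prae_dilator T \<and> \<mu> \<in> \<S> \<and>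
     (\<forall>n m. m \<prec> n \<longrightarrow> (\<exists>!\<sigma>. mu_val \<mu> n m \<sigma>)) \<and>
     (\<forall>n m \<sigma>. m \<prec> n \<and> mu_val \<mu> n m \<sigma> \<longrightarrow> T_mem T n \<sigma>) \<and>
     (\<forall>n m m' \<sigma> \<sigma>'. m \<prec> m' \<and> m' \<prec> n \<and> mu_val \<mu> n m \<sigma> \<and> mu_val \<mu> n m' \<sigma>' \<longrightarrow> T_less T n \<sigma> \<sigma>') \<and>
     (\<forall>m n f i j \<sigma> \<tau>. nat_morphism M m n f \<and> fapp M f i j \<and> mu_val \<mu> m i \<sigma> \<and> mu_val \<mu> n j \<tau> \<longrightarrow>
        T_map T m n f \<sigma> \<tau>) \<and>
     (\<forall>n m \<sigma> \<rho> a. m \<prec> n \<and> T_mem T n \<sigma> \<and> mu_val \<mu> n m \<rho> \<and> T_supp T n \<sigma> a \<longrightarrow>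
        (T_less T n \<sigma> \<rho> \<longleftrightarrow> (\<forall>i. fmem M i a \<longrightarrow> i \<prec> m)))"

definition normal_dilator :: "'a coded_functor \<Rightarrow> 'a set \<Rightarrow> bool" where
  "normal_dilator T \<mu> \<longleftrightarrow> normal_prae_dilator T \<mu> \<and> coded_dilator T"

text \<open>The linear order \<open>(X, R)\<close> together with (the graph of) \<open>\<xi> : D\<^sup>T(X) \<rightarrow> X\<close> is a fixed point
  of \<open>T\<close>.\<close>
definition fixed_point :: "'a coded_functor \<Rightarrow> 'a set \<Rightarrow> 'a set \<Rightarrow> 'a set \<Rightarrow> bool" where
  "fixed_point T X R \<xi> \<longleftrightarrow>
     linear_order_set M X R \<and> \<xi> \<in> \<S> \<and>
     (\<forall>d. D_mem T X d \<longrightarrow> (\<exists>!x. rel M \<xi> d x)) \<and>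
     (\<forall>d x. D_mem T X d \<and> rel M \<xi> d x \<longrightarrow> x \<in> X) \<and>
     (\<forall>d d' x x'. D_mem T X d \<and> D_mem T X d' \<and> rel M \<xi> d x \<and> rel M \<xi> d' x' \<and>
        D_less T R d d' \<longrightarrow> rel M R x x')"

definition every_normal_dilator_has_wf_fixed_point :: bool where
  "every_normal_dilator_has_wf_fixed_point \<longleftrightarrow>
     (\<forall>T \<mu>. normal_dilator T \<mu> \<longrightarrow> (\<exists>X R \<xi>. fixed_point T X R \<xi> \<and> well_founded_set M X R))"


section \<open>The term system \<open>Fix(T)\<close>\<close>

definition xi_term :: "'a \<Rightarrow> 'a \<Rightarrow> 'a" where
  "xi_term a \<sigma> = pair M a \<sigma>"

definition Fix_closed :: "'a coded_functor \<Rightarrow> 'a set \<Rightarrow> bool" where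
  "Fix_closed T X \<longleftrightarrow> (\<forall>a \<sigma>. D_pair T (\<lambda>x. x \<in> X) a \<sigma> \<longrightarrow> xi_term a \<sigma> \<in> X)"

text \<open>The least set closed under term formation, where leastness is understood in \<open>M\<close>. (The
  HOL-inductive closure would contain terms of standard height only.)\<close>
definition is_Fix :: "'a coded_functor \<Rightarrow> 'a set \<Rightarrow> bool" where
  "is_Fix T X \<longleftrightarrow> X \<in> \<S> \<and> Fix_closed T X \<and> (\<forall>Y\<in>\<S>. Fix_closed T Y \<longrightarrow> X \<subseteq> Y)"

text \<open>The recursive clause for the order on \<open>Fix(T)\<close>. Deciding it for \<open>s\<close> and \<open>t\<close> requires
  comparing only pairs with a smaller value of \<open>L\<^sub>T(s) + L\<^sub>T(t)\<close>, so that this recursion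
  determines \<open>R\<close> uniquely; \<open>L\<^sub>T\<close> has no other role.\<close>
definition is_Fix_order :: "'a coded_functor \<Rightarrow> 'a set \<Rightarrow> 'a set \<Rightarrow> bool" where
  "is_Fix_order T X R \<longleftrightarrow>
     R \<in> \<S> \<and>
     (\<forall>p\<in>R. \<exists>s\<in>X. \<exists>t\<in>X. p = pair M s t) \<and>
     (\<forall>a \<sigma> b \<tau>. xi_term a \<sigma> \<in> X \<and> xi_term b \<tau> \<in> X \<longrightarrow>
        (rel M R (xi_term a \<sigma>) (xi_term b \<tau>) \<longleftrightarrow>
           linear_order_on_class (\<lambda>s. fmem M s a \<or> fmem M s b) (rel M R) \<and>
           D_compare T (rel M R) a \<sigma> b \<tau>))"

definition Fix_well_founded :: "'a coded_functor \<Rightarrow> bool" where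
  "Fix_well_founded T \<longleftrightarrow> (\<exists>X R. is_Fix T X \<and> is_Fix_order T X R \<and> well_founded_set M X R)"

definition Fix_of_every_normal_dilator_well_founded :: bool where
  "Fix_of_every_normal_dilator_well_founded \<longleftrightarrow>
     (\<forall>T \<mu>. normal_dilator T \<mu> \<longrightarrow> Fix_well_founded T)"

end

end

theory Submission
  imports Defs
begin

text \<open>
  (ii) implies (i) because \<open>Fix(T)\<close> is itself a fixed point, with \<open>\<xi>\<close> the identity on codes. For (iii) implies (ii)
  let \<open>U\<^sub>n\<close> be the initial segment of \<open>Fix(T)\<close> generated by the terms with code below \<open>n\<close>. Since a term
  has larger code than its subterms and \<open>D\<^sup>T\<close> preserves initial segments by normality, \<open>U\<^sub>n\<^sub>+\<^sub>1\<close> embeds into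
  \<open>D\<^sup>T(U\<^sub>n)\<close>, so that \<open>\<Pi>\<^sup>1\<^sub>1\<close>-induction shows that all \<open>U\<^sub>n\<close> are well-founded.

  For (i) implies (iii) write the \<open>\<Pi>\<^sup>1\<^sub>1\<close>-formula at \<open>n\<close> as the statement that a tree \<open>Tr (n + 1)\<close> has no path,
  where \<open>Tr 0\<close> is trivial. Attempts to build both a ranking of \<open>Tr n\<close> in a linear order \<open>\<alpha>\<close> and a path through
  \<open>Tr (n + 1)\<close> form a tree; the Kleene-Brouwer orders of these trees, for all \<open>n\<close> and all initial segments of
  \<open>\<alpha>\<close>, are combined into a normal prae-dilator, which is a dilator because the formula is progressive. In a
  well-founded fixed point one can then recursively rank all trees \<open>Tr n\<close>, so none of them has a path.
\<close>

text \<open>The model may be nonstandard, so neither induction nor recursion of HOL applies to its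
  numbers. All constructions therefore use predicates, functions and sets that are arithmetically
  definable with parameters (\<open>ar\<close>, \<open>df\<close>, \<open>ds\<close>); the rules in
  \<open>ari\<close> discharge these side conditions. What makes fixed points yield induction is
  that the trees of all levels are ranked in one order \<open>X\<close> given in advance. With
  \<open>X\<close> and \<open>\<xi>\<close> as parameters, the ranks arise from a single
  arithmetical recursion, and that \<open>f n\<close> ranks \<open>Tr n\<close> is an arithmetical
  statement, open to induction in \<open>ACA0\<close>. The mere existence of some ranking would not
  be arithmetical. Normality demands that the words with support below \<open>m\<close> form an
  initial segment with a prescribed supremum. This is why a word starts with a header: its entry
  bounds all other entries and is compared first. In a fixed point, images of header words then
  supply the bounds below which the ranks of each level lie.\<close>

named_theorems ari


section \<open>Arithmetical definability\<close>

primrec tren :: "(nat \<Rightarrow> nat) \<Rightarrow> l2_term \<Rightarrow> l2_term" where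
  "tren r (NumVar x) = NumVar (r x)"
| "tren r Zero = Zero"
| "tren r One = One"
| "tren r (Add s t) = Add (tren r s) (tren r t)"
| "tren r (Mul s t) = Mul (tren r s) (tren r t)"

text \<open>To avoid capture, a bound variable is renamed to one outside the range of
  \<open>r\<close>. Set quantifiers are left untouched because only arithmetical formulas are
  renamed.\<close>

primrec fren :: "l2_formula \<Rightarrow> (nat \<Rightarrow> nat) \<Rightarrow> (nat \<Rightarrow> nat) \<Rightarrow> l2_formula" where
  "fren (Eq t u) r s = Eq (tren r t) (tren r u)"
| "fren (Less t u) r s = Less (tren r t) (tren r u)"
| "fren (Mem t i) r s = Mem (tren r t) (s i)"
| "fren (Neg p) r s = Neg (fren p r s)"
| "fren (Conj p q) r s = Conj (fren p r s) (fren q r s)"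
| "fren (AllNum x p) r s = (let z = (SOME z. z \<notin> range r) in AllNum z (fren p (r(x := z)) s))"
| "fren (AllSet i p) r s = AllSet i p"

lemma term_value_tren: "term_value M e (tren r t) = term_value M (e \<circ> r) t"
  by (induction t) auto

lemma arithmetical_fren: "arithmetical p \<Longrightarrow> arithmetical (fren p r s)"
  by (induction p arbitrary: r) (auto simp: Let_def)

lemma satisfies_fren:
  "arithmetical p \<Longrightarrow> infinite (- range r) \<Longrightarrow>
    satisfies M e E (fren p r s) = satisfies M (e \<circ> r) (E \<circ> s) p"
proof (induction p arbitrary: r e)
  case (AllNum x p)
  define z where "z = (SOME z. z \<notin> range r)"
  have "\<exists>z. z \<notin> range r"
    using AllNum.prems(2) by (metis Compl_iff ex_in_conv finite.emptyI)
  then have z: "z \<notin> range r" unfolding z_def by (rule someI_ex)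
  have "range (r(x := z)) \<subseteq> insert z (range r)" by auto
  then have "- range r - {z} \<subseteq> - range (r(x := z))" by auto
  then have inf: "infinite (- range (r(x := z)))"
    using AllNum.prems(2) by (meson finite_Diff2 finite.emptyI finite_insert infinite_super)
  have eq: "e(z := a) \<circ> r(x := z) = (e \<circ> r)(x := a)" for a
    using z by (auto simp: fun_eq_iff)
  have "satisfies M (e(z := a)) E (fren p (r(x := z)) s) = satisfies M ((e \<circ> r)(x := a)) (E \<circ> s) p" for a
    using AllNum.IH[OF _ inf, of "e(z := a)"] AllNum.prems(1) by (simp only: eq arithmetical.simps)
  then show ?case
    by (simp only: fren.simps Let_def z_def[symmetric] satisfies.simps)
qed (auto simp: term_value_tren)

locale aca =
  fixes M :: "'a l2_structure"
  assumes ACA0: "ACA0 M"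
begin

abbreviation zr (\<open>\<zero>\<close>) where "\<zero> \<equiv> zero_of M"
abbreviation on (\<open>\<one>\<close>) where "\<one> \<equiv> one_of M"
abbreviation pl (infixl \<open>\<oplus>\<close> 65) where "x \<oplus> y \<equiv> add_of M x y"
abbreviation ti (infixl \<open>\<otimes>\<close> 70) where "x \<otimes> y \<equiv> mul_of M x y"
abbreviation ls (infix \<open>\<prec>\<close> 50) where "x \<prec> y \<equiv> less_of M x y"
abbreviation lq (infix \<open>\<preceq>\<close> 50) where "x \<preceq> y \<equiv> less_of M x y \<or> x = y"
abbreviation S where "S \<equiv> sets_of M"

lemma S_nonempty: "S \<noteq> {}"
  and basic: "basic_axioms M"
  and set_ind: "set_induction M"
  and comprehension: "arithmetical_comprehension M"
  using ACA0 by (auto simp: ACA0_def)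

text \<open>Variables \<open>3 * v\<close> of the defining formula carry the environment, variables \<open>3 * v + 1\<close>
  the number parameters, and the remaining ones are kept free for renaming bound variables.\<close>

definition ar :: "((nat \<Rightarrow> 'a) \<Rightarrow> bool) \<Rightarrow> bool" where
  "ar P \<longleftrightarrow> (\<exists>p E d. arithmetical p \<and> range E \<subseteq> S \<and>
     (\<forall>e e'. (\<forall>v. e' (3 * v) = e v) \<and> (\<forall>v. e' (3 * v + 1) = d v) \<longrightarrow>
        (P e \<longleftrightarrow> satisfies M e' E p)))"

lemma arI:
  assumes "arithmetical p" "range E \<subseteq> S"
    "\<And>e e'. (\<forall>v. e' (3 * v) = e v) \<Longrightarrow> (\<forall>v. e' (3 * v + 1) = d v) \<Longrightarrow> P e = satisfies M e' E p"
  shows "ar P"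
  unfolding ar_def
  by (rule exI[of _ p], rule exI[of _ E], rule exI[of _ d], intro conjI allI impI)
    (fact assms(1), fact assms(2), elim conjE, rule assms(3))

lemma arE:
  assumes "ar P"
  obtains p E d where "arithmetical p" "range E \<subseteq> S"
    "\<And>e e'. (\<forall>v. e' (3 * v) = e v) \<Longrightarrow> (\<forall>v. e' (3 * v + 1) = d v) \<Longrightarrow> P e = satisfies M e' E p"
proof -
  obtain p E d where *: "arithmetical p \<and> range E \<subseteq> S \<and> (\<forall>e e'. (\<forall>v. e' (3 * v) = e v) \<and>
      (\<forall>v. e' (3 * v + 1) = d v) \<longrightarrow> P e = satisfies M e' E p)"
    using assms unfolding ar_def by (elim exE) (rule that)
  show thesis by (rule that[of p E d]) (use * in blast)+
qed

lemma infinite_class2: "infinite {v::nat. v mod 3 = 2 \<and> v \<noteq> 2}"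
proof -
  have "range (\<lambda>k::nat. 3 * k + 5) \<subseteq> {v. v mod 3 = 2 \<and> v \<noteq> 2}" by (auto simp: mod_Suc)
  moreover have "inj (\<lambda>k::nat. 3 * k + 5)" by (auto simp: inj_def)
  ultimately show ?thesis using infinite_super finite_imageD infinite_UNIV_nat by blast
qed

text \<open>The renamings below never take values of the form \<open>3 * k + 5\<close>, so
  infinitely many variables stay free. The exception \<open>2\<close> is the variable that
  \<open>ar_all\<close> binds.\<close>

lemma infinite_compl_range:
  assumes "\<And>v. r v mod 3 \<noteq> 2 \<or> r v = (2::nat)" shows "infinite (- range r)"
proof -
  have "{v. v mod 3 = 2 \<and> v \<noteq> 2} \<subseteq> - range r" using assms by fastforce
  then show ?thesis using infinite_class2 infinite_super by blast
qed

lemma ar_ren: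
  assumes "ar P" shows "ar (\<lambda>e. P (\<lambda>v. e (r v)))"
proof -
  obtain p E d where p: "arithmetical p" "range E \<subseteq> S"
    "\<And>e e'. (\<forall>v. e' (3 * v) = e v) \<Longrightarrow> (\<forall>v. e' (3 * v + 1) = d v) \<Longrightarrow> P e = satisfies M e' E p"
    by (rule arE[OF assms], rule that)
  \<comment> \<open>The truth of \<open>p\<close> does not depend on the third class of variables,
    so these may be collapsed to the single value \<open>1\<close>.\<close>
  define \<rho> where "\<rho> n = (if n mod 3 = 0 then 3 * r (n div 3) else if n mod 3 = 1 then n else 1)" for n
  have "infinite (- range \<rho>)" by (rule infinite_compl_range) (auto simp: \<rho>_def)
  then have s: "satisfies M e' E (fren p \<rho> id) = satisfies M (e' \<circ> \<rho>) E p" for e'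
    using satisfies_fren[OF p(1), of \<rho> M e' E id] by simp
  have main: "P (\<lambda>v. e (r v)) = satisfies M e' E (fren p \<rho> id)"
    if "\<forall>v. e' (3 * v) = e v" "\<forall>v. e' (3 * v + 1) = d v" for e e'
  proof -
    have "\<rho> (3 * v + 1) = 3 * v + 1" for v unfolding \<rho>_def by presburger
    then show ?thesis
      unfolding s using that by (intro p(3)) (simp_all add: \<rho>_def)
  qed
  show ?thesis by (rule arI[OF arithmetical_fren[OF p(1)] p(2)]) (rule main)
qed

lemma ar_not: assumes "ar P" shows "ar (\<lambda>e. \<not> P e)"
proof -
  obtain p E d where p: "arithmetical p" "range E \<subseteq> S"
    "\<And>e e'. (\<forall>v. e' (3 * v) = e v) \<Longrightarrow> (\<forall>v. e' (3 * v + 1) = d v) \<Longrightarrow> P e = satisfies M e' E p"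
    by (rule arE[OF assms], rule that)
  have main: "(\<not> P e) = satisfies M e' E (Neg p)"
    if "\<forall>v. e' (3 * v) = e v" "\<forall>v. e' (3 * v + 1) = d v" for e e'
    using p(3)[of e' e] that by simp
  show ?thesis by (rule arI[of "Neg p", OF _ p(2)]) (simp add: p(1), rule main)
qed

lemma mod3_aux: "(if v mod 3 = 0 then v else if v mod 3 = 1 then 3 * x + 1 else 1) mod 3 \<noteq> (2::nat)"
proof -
  have "(3 * x + 1) mod 3 \<noteq> 2" by presburger
  then show ?thesis by simp
qed

lemma ar_conj: assumes "ar P" "ar Q" shows "ar (\<lambda>e. P e \<and> Q e)"
proof -
  obtain p E d where p: "arithmetical p" "range E \<subseteq> S"
    "\<And>e e'. (\<forall>v. e' (3 * v) = e v) \<Longrightarrow> (\<forall>v. e' (3 * v + 1) = d v) \<Longrightarrow> P e = satisfies M e' E p"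
    by (rule arE[OF assms(1)], rule that)
  obtain q F c where q: "arithmetical q" "range F \<subseteq> S"
    "\<And>e e'. (\<forall>v. e' (3 * v) = e v) \<Longrightarrow> (\<forall>v. e' (3 * v + 1) = c v) \<Longrightarrow> Q e = satisfies M e' F q"
    by (rule arE[OF assms(2)], rule that)
  \<comment> \<open>The formulas \<open>p\<close> and \<open>q\<close> come with different
    parameters. Both lists are interleaved, those of \<open>p\<close> at even and those of
    \<open>q\<close> at odd indices: \<open>b\<close> merges the numbers and \<open>G\<close> the
    sets.\<close>
  define \<rho> where "\<rho> n = (if n mod 3 = 0 then n else if n mod 3 = 1 then 3 * (2 * (n div 3)) + 1 else 1)"
    for n :: nat
  define \<kappa> where "\<kappa> n = (if n mod 3 = 0 then n else if n mod 3 = 1 then 3 * (2 * (n div 3) + 1) + 1 else 1)"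
    for n :: nat
  define G where "G v = (if even v then E (v div 2) else F (v div 2))" for v :: nat
  define b where "b v = (if even v then d (v div 2) else c (v div 2))" for v :: nat
  define \<phi> where "\<phi> = Conj (fren p \<rho> (\<lambda>v. 2 * v)) (fren q \<kappa> (\<lambda>v. 2 * v + 1))"
  have "\<rho> v mod 3 \<noteq> 2" "\<kappa> v mod 3 \<noteq> 2" for v
    unfolding \<rho>_def \<kappa>_def by (rule mod3_aux)+
  then have i: "infinite (- range \<rho>)" "infinite (- range \<kappa>)"
    using infinite_compl_range[of \<rho>] infinite_compl_range[of \<kappa>] by simp_all
  have G: "G (2 * v) = E v" "G (2 * v + 1) = F v" "b (2 * v) = d v" "b (2 * v + 1) = c v" for v
    by (simp_all add: G_def b_def)
  then have GE: "G \<circ> (\<lambda>v. 2 * v) = E" "G \<circ> (\<lambda>v. 2 * v + 1) = F"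
    by (simp_all only: fun_eq_iff o_apply simp_thms)
  have main: "(P e \<and> Q e) = satisfies M e' G \<phi>"
    if "\<forall>v. e' (3 * v) = e v" "\<forall>v. e' (3 * v + 1) = b v" for e e'
  proof -
    have ev: "e' (3 * (2 * v) + 1) = d v" "e' (3 * (2 * v + 1) + 1) = c v" for v
      using spec[OF that(2), of "2 * v"] spec[OF that(2), of "2 * v + 1"]
      by (simp_all only: G)
    have "\<rho> (3 * v) = 3 * v" "\<kappa> (3 * v) = 3 * v" for v by (simp_all add: \<rho>_def \<kappa>_def)
    moreover have "\<rho> (3 * v + 1) = 3 * (2 * v) + 1" "\<kappa> (3 * v + 1) = 3 * (2 * v + 1) + 1" for v
    proof -
      have "(3 * v + 1) mod 3 = 1" "(3 * v + 1) div 3 = v" by presburger+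
      then show "\<rho> (3 * v + 1) = 3 * (2 * v) + 1" "\<kappa> (3 * v + 1) = 3 * (2 * v + 1) + 1"
        unfolding \<rho>_def \<kappa>_def by (simp_all only: one_neq_zero if_False if_True refl)
    qed
    ultimately have c: "\<forall>v. (e' \<circ> \<rho>) (3 * v) = e v" "\<forall>v. (e' \<circ> \<rho>) (3 * v + 1) = d v"
      "\<forall>v. (e' \<circ> \<kappa>) (3 * v) = e v" "\<forall>v. (e' \<circ> \<kappa>) (3 * v + 1) = c v"
      using that(1) by (simp_all only: o_apply ev simp_thms)
    have "P e = satisfies M (e' \<circ> \<rho>) E p" "Q e = satisfies M (e' \<circ> \<kappa>) F q"
      by (rule p(3)[OF c(1,2)], rule q(3)[OF c(3,4)])
    moreover have "satisfies M e' G (fren p \<rho> (\<lambda>v. 2 * v)) = satisfies M (e' \<circ> \<rho>) E p"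
      "satisfies M e' G (fren q \<kappa> (\<lambda>v. 2 * v + 1)) = satisfies M (e' \<circ> \<kappa>) F q"
      using satisfies_fren[OF p(1) i(1), of M e' G] satisfies_fren[OF q(1) i(2), of M e' G]
      by (simp_all only: GE)
    ultimately show ?thesis by (simp only: \<phi>_def satisfies.simps)
  qed
  have "arithmetical \<phi>" using p(1) q(1) by (simp add: \<phi>_def arithmetical_fren)
  moreover have "range G \<subseteq> S" using p(2) q(2) by (auto simp: G_def)
  ultimately show ?thesis by (rule arI) (rule main)
qed

lemma ar_all: assumes "ar (\<lambda>e. Q (\<lambda>k. e (Suc k)) (e 0))" shows "ar (\<lambda>e. \<forall>a. Q e a)"
proof -
  obtain p E d where p: "arithmetical p" "range E \<subseteq> S"
    "\<And>e e'. (\<forall>v. e' (3 * v) = e v) \<Longrightarrow> (\<forall>v. e' (3 * v + 1) = d v) \<Longrightarrow>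
      Q (\<lambda>k. e (Suc k)) (e 0) = satisfies M e' E p"
    by (rule arE[OF assms], rule that)
  \<comment> \<open>Variable \<open>0\<close> of \<open>p\<close> stands for the quantified number
    and moves to \<open>2\<close>, where neither the environment nor a parameter is stored; the
    other environment variables move down by one place.\<close>
  define \<rho> where "\<rho> n = (if n = 0 then 2 else if n mod 3 = 0 then 3 * (n div 3 - 1) else if n mod 3 = 1 then n else 1)"
    for n :: nat
  have "\<rho> v mod 3 \<noteq> 2 \<or> \<rho> v = 2" for v
  proof -
    have "3 * (v div 3 - 1) mod 3 \<noteq> 2" "1 mod 3 \<noteq> (2::nat)" by simp_all
    then show ?thesis unfolding \<rho>_def
      by (cases "v = 0"; cases "v mod 3 = 0"; cases "v mod 3 = 1") (simp_all only: if_True if_False simp_thms, simp_all)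
  qed
  then have "infinite (- range \<rho>)" by (rule infinite_compl_range)
  then have s: "satisfies M e' E (fren p \<rho> id) = satisfies M (e' \<circ> \<rho>) E p" for e'
    using satisfies_fren[OF p(1), of \<rho> M e' E id] by simp
  have main: "(\<forall>a. Q e a) = satisfies M e' E (AllNum 2 (fren p \<rho> id))"
    if e': "\<forall>v. e' (3 * v) = e v" "\<forall>v. e' (3 * v + 1) = d v" for e e'
  proof -
    have "Q e a = satisfies M (e'(2 := a) \<circ> \<rho>) E p" for a
    proof -
      let ?f = "\<lambda>k. case k of 0 \<Rightarrow> a | Suc k \<Rightarrow> e k"
      have "Q (\<lambda>k. ?f (Suc k)) (?f 0) = satisfies M (e'(2 := a) \<circ> \<rho>) E p"
      proof (rule p(3); rule allI)
        fix v :: nat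
        have n: "3 * v \<noteq> 2" "3 * v + 1 \<noteq> 2" by presburger+
        have "(3 * v + 1) mod 3 = 1" by presburger
        moreover have "3 * v + 1 \<noteq> 0" by simp
        ultimately have "\<rho> (3 * v + 1) = 3 * v + 1"
          unfolding \<rho>_def by (simp only: if_True if_False refl one_neq_zero)
        then show "(e'(2 := a) \<circ> \<rho>) (3 * v + 1) = d v"
          using e' n by (simp del: One_nat_def)
        show "(e'(2 := a) \<circ> \<rho>) (3 * v) = ?f v"
        proof (cases v)
          case (Suc u)
          have "3 * Suc u \<noteq> 0" "(3 * Suc u) mod 3 = 0" "3 * (3 * Suc u div 3 - 1) = 3 * u" by simp_all
          then have "\<rho> (3 * v) = 3 * u" unfolding \<rho>_def Suc by (simp only: if_True if_False refl)
          moreover have "3 * u \<noteq> 2" by presburger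
          ultimately show ?thesis using e' Suc by simp
        qed (simp add: \<rho>_def)
      qed
      then show ?thesis by simp
    qed
    then show ?thesis by (simp add: s)
  qed
  have "arithmetical (AllNum 2 (fren p \<rho> id))" using p(1) by (simp add: arithmetical_fren)
  then show ?thesis by (rule arI[OF _ p(2)]) (rule main)
qed

text \<open>Bound variables are treated in de Bruijn style: under a quantifier the new value is \<open>e 0\<close> and the old
  environment is \<open>\<lambda>k. e (Suc k)\<close>. A function or a family of sets is definable if its graph is.\<close>

definition df :: "((nat \<Rightarrow> 'a) \<Rightarrow> 'a) \<Rightarrow> bool" where
  "df f \<longleftrightarrow> ar (\<lambda>e. f (\<lambda>k. e (Suc k)) = e 0)"

definition ds :: "((nat \<Rightarrow> 'a) \<Rightarrow> 'a set) \<Rightarrow> bool" where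
  "ds A \<longleftrightarrow> ar (\<lambda>e. e 0 \<in> A (\<lambda>k. e (Suc k)))"

declare ar_not[ari] ar_conj[ari] ar_all[ari]

lemma ar_disj[ari]: "ar P \<Longrightarrow> ar Q \<Longrightarrow> ar (\<lambda>e. P e \<or> Q e)"
  using ar_not[OF ar_conj[OF ar_not ar_not], of P Q] by simp

lemma ar_imp[ari]: "ar P \<Longrightarrow> ar Q \<Longrightarrow> ar (\<lambda>e. P e \<longrightarrow> Q e)"
  using ar_disj[OF ar_not, of P Q] by (simp only: imp_conv_disj)

lemma ar_iff[ari]: "ar P \<Longrightarrow> ar Q \<Longrightarrow> ar (\<lambda>e. P e = Q e)"
  using ar_conj[OF ar_imp ar_imp, of P Q Q P] by (simp only: iff_conv_conj_imp)

lemma ar_ex[ari]: "ar (\<lambda>e. Q (\<lambda>k. e (Suc k)) (e 0)) \<Longrightarrow> ar (\<lambda>e. \<exists>a. Q e a)"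
  using ar_not[OF ar_all[of "\<lambda>e a. \<not> Q e a"]] by (simp add: ar_not)

lemma ar_base:
  "ar (\<lambda>e. e i = e j)" "ar (\<lambda>e. e i = c)" "ar (\<lambda>e. e i \<prec> e j)"
  "ar (\<lambda>e. e i \<oplus> e j = e k)" "ar (\<lambda>e. e i \<otimes> e j = e k)" "X \<in> S \<Longrightarrow> ar (\<lambda>e. e i \<in> X)"
proof -
  obtain Y where Y: "Y \<in> S" using S_nonempty by blast
  let ?v = "\<lambda>i. NumVar (3 * i)"
  show "ar (\<lambda>e. e i = e j)"
    by (rule arI[of "Eq (?v i) (?v j)" "\<lambda>_. Y" "\<lambda>_. c"]) (auto simp: Y)
  show "ar (\<lambda>e. e i \<prec> e j)"
    by (rule arI[of "Less (?v i) (?v j)" "\<lambda>_. Y" "\<lambda>_. c"]) (auto simp: Y)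
  show "ar (\<lambda>e. e i \<oplus> e j = e k)"
    by (rule arI[of "Eq (Add (?v i) (?v j)) (?v k)" "\<lambda>_. Y" "\<lambda>_. c"]) (auto simp: Y)
  show "ar (\<lambda>e. e i \<otimes> e j = e k)"
    by (rule arI[of "Eq (Mul (?v i) (?v j)) (?v k)" "\<lambda>_. Y" "\<lambda>_. c"]) (auto simp: Y)
  show "ar (\<lambda>e. e i = c)"
  proof (rule arI[of "Eq (?v i) (NumVar 1)" "\<lambda>_. Y" "\<lambda>_. c"])
    fix e e' :: "nat \<Rightarrow> 'a"
    assume "\<forall>v. e' (3 * v) = e v" "\<forall>v. e' (3 * v + 1) = c"
    then show "(e i = c) = satisfies M e' (\<lambda>_. Y) (Eq (?v i) (NumVar 1))"
      using spec[of "\<lambda>v. e' (3 * v + 1) = c" 0] by simp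
  qed (auto simp: Y)
  show "ar (\<lambda>e. e i \<in> X)" if "X \<in> S"
    by (rule arI[of "Mem (?v i) 0" "\<lambda>_. X" "\<lambda>_. c"]) (auto simp: that)
qed

lemma ar_const[ari]: "ar (\<lambda>e. P)"
  using ar_conj[OF ar_base(1)[of 0 0] ar_not[OF ar_base(1)[of 0 0]]] ar_base(1)[of 0 0] by (cases P) simp_all

lemma df_ren: assumes "df f" shows "df (\<lambda>e. f (\<lambda>v. e (r v)))"
  using ar_ren[OF assms[unfolded df_def], of "case_nat 0 (\<lambda>v. Suc (r v))"] by (simp add: df_def)

lemma ar_app: "df f \<Longrightarrow> ar (\<lambda>e. P (\<lambda>k. e (Suc k)) (e 0)) \<Longrightarrow> ar (\<lambda>e. P e (f e))"
  using ar_ex[of "\<lambda>e a. f e = a \<and> P e a", OF ar_conj] by (simp add: df_def)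

lemma ar_app2:
  assumes "ar (\<lambda>e. P (e 0) (e (Suc 0)))" "df f" "df g" shows "ar (\<lambda>e. P (f e) (g e))"
proof (rule ar_app[OF assms(2)])
  show "ar (\<lambda>e. P (e 0) (g (\<lambda>k. e (Suc k))))"
    by (rule ar_app[OF df_ren[OF assms(3)]])
      (use ar_ren[OF assms(1), of "\<lambda>v. if v = 0 then Suc 0 else 0"] in simp)
qed

lemma ar_eq[ari]: "df f \<Longrightarrow> df g \<Longrightarrow> ar (\<lambda>e. f e = g e)"
  by (rule ar_app2[where P = "(=)", OF ar_base(1)])

lemma ar_less[ari]: "df f \<Longrightarrow> df g \<Longrightarrow> ar (\<lambda>e. f e \<prec> g e)"
  by (rule ar_app2[where P = "\<lambda>x y. x \<prec> y", OF ar_base(3)])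

lemma df_var[ari]: "df (\<lambda>e. e k)" unfolding df_def by (rule ar_base(1))

lemma df_const[ari]: "df (\<lambda>e. c)"
  unfolding df_def using ar_base(2)[of 0 c] by (simp add: eq_commute)

lemma df_add[ari]: "df f \<Longrightarrow> df g \<Longrightarrow> df (\<lambda>e. f e \<oplus> g e)"
  unfolding df_def
  by (rule ar_app[OF df_ren, where P = "\<lambda>e a. a \<oplus> g (\<lambda>k. e (Suc k)) = e 0"], simp add: df_def,
      rule ar_app[OF df_ren, where P = "\<lambda>e a. e 0 \<oplus> a = e (Suc 0)"], simp add: df_def, rule ar_base(4))

lemma df_mul[ari]: "df f \<Longrightarrow> df g \<Longrightarrow> df (\<lambda>e. f e \<otimes> g e)"
  unfolding df_def
  by (rule ar_app[OF df_ren, where P = "\<lambda>e a. a \<otimes> g (\<lambda>k. e (Suc k)) = e 0"], simp add: df_def,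
      rule ar_app[OF df_ren, where P = "\<lambda>e a. e 0 \<otimes> a = e (Suc 0)"], simp add: df_def, rule ar_base(5))

lemma df_term:
  assumes "\<And>v. df (\<lambda>e. \<sigma> e v)" shows "df (\<lambda>e. term_value M (\<sigma> e) t)"
  by (induction t) (simp_all add: assms ari)

lemma df_upd:
  assumes "\<And>v. df (\<lambda>e. \<sigma> e v)" "df f" shows "df (\<lambda>e. ((\<sigma> e)(x := f e)) v)"
  by (cases "v = x") (simp_all add: assms)

lemma ar_satisfies:
  "arithmetical p \<Longrightarrow> (\<And>v. E v \<in> S) \<Longrightarrow> (\<And>v. df (\<lambda>e. \<sigma> e v)) \<Longrightarrow> ar (\<lambda>e. satisfies M (\<sigma> e) E p)"
proof (induction p arbitrary: \<sigma>)
  case (Mem t i)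
  then show ?case
    using ar_app[OF df_term[of \<sigma> t], of "\<lambda>e a. a \<in> E i"] ar_base(6) by simp
next
  case (AllNum x p)
  have "df (\<lambda>e. ((\<sigma> (\<lambda>k. e (Suc k)))(x := e 0)) v)" for v
    by (rule df_upd[OF df_ren[OF AllNum.prems(3), of Suc] df_var])
  then have "ar (\<lambda>e. satisfies M ((\<sigma> (\<lambda>k. e (Suc k)))(x := e 0)) E p)"
    using AllNum.IH[of "\<lambda>e. (\<sigma> (\<lambda>k. e (Suc k)))(x := e 0)"] AllNum.prems(1,2) by (simp del: fun_upd_apply)
  then show ?case unfolding satisfies.simps by (rule ar_all)
next
  case (Eq s t)
  then show ?case unfolding satisfies.simps by (intro ar_eq df_term)
next
  case (Less s t)
  then show ?case unfolding satisfies.simps by (intro ar_less df_term)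
next
  case (Neg p)
  then show ?case by (simp add: ar_not)
next
  case (Conj p q)
  then show ?case by (simp add: ar_conj)
qed simp

text \<open>Renaming only replaces variables by variables. For definable functions, the defining
  formula of \<open>P\<close> is evaluated by \<open>ar_satisfies\<close> in an environment that
  itself depends definably on \<open>e\<close>.\<close>

lemma ar_subst:
  assumes "ar P" "\<And>v. df (\<lambda>e. \<sigma> e v)" shows "ar (\<lambda>e. P (\<sigma> e))"
proof -
  obtain p E d where p: "arithmetical p" "range E \<subseteq> S"
    "\<And>e e'. (\<forall>v. e' (3 * v) = e v) \<Longrightarrow> (\<forall>v. e' (3 * v + 1) = d v) \<Longrightarrow> P e = satisfies M e' E p"
    by (rule arE[OF assms(1)], rule that)
  define \<tau> where "\<tau> e v = (if v mod 3 = 0 then \<sigma> e (v div 3) else d (v div 3))" for e v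
  have "df (\<lambda>e. \<tau> e v)" for v
    by (cases "v mod 3 = 0") (simp_all add: \<tau>_def assms(2) df_const)
  then have "ar (\<lambda>e. satisfies M (\<tau> e) E p)" by (intro ar_satisfies p) (use p(2) in auto)
  moreover have "P (\<sigma> e) = satisfies M (\<tau> e) E p" for e
  proof (rule p(3))
    show "\<forall>v. \<tau> e (3 * v) = \<sigma> e v" by (simp add: \<tau>_def)
    have "(3 * v + 1) mod 3 = 1" "(3 * v + 1) div 3 = v" for v :: nat by presburger+
    then show "\<forall>v. \<tau> e (3 * v + 1) = d v"
      unfolding \<tau>_def by (simp only: one_neq_zero if_False simp_thms)
  qed
  ultimately show ?thesis by simp
qed

lemma df_subst: assumes "df f" "\<And>v. df (\<lambda>e. \<sigma> e v)" shows "df (\<lambda>e. f (\<sigma> e))"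
proof -
  let ?\<tau> = "\<lambda>e v. case v of 0 \<Rightarrow> e 0 | Suc v \<Rightarrow> \<sigma> (\<lambda>k. e (Suc k)) v"
  have "df (\<lambda>e. ?\<tau> e v)" for v
    by (cases v) (simp_all add: df_var df_ren[OF assms(2)])
  from ar_subst[where \<sigma> = ?\<tau>, OF assms(1)[unfolded df_def] this] show ?thesis by (simp add: df_def)
qed

lemma ds_subst: assumes "ds A" "\<And>v. df (\<lambda>e. \<sigma> e v)" shows "ds (\<lambda>e. A (\<sigma> e))"
proof -
  let ?\<tau> = "\<lambda>e v. case v of 0 \<Rightarrow> e 0 | Suc v \<Rightarrow> \<sigma> (\<lambda>k. e (Suc k)) v"
  have "df (\<lambda>e. ?\<tau> e v)" for v
    by (cases v) (simp_all add: df_var df_ren[OF assms(2)])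
  from ar_subst[where \<sigma> = ?\<tau>, OF assms(1)[unfolded ds_def] this] show ?thesis by (simp add: ds_def)
qed

lemma ar_comp1: "ar (\<lambda>e. P (e 0)) \<Longrightarrow> df f \<Longrightarrow> ar (\<lambda>e. P (f e))"
  using ar_subst[of "\<lambda>e. P (e 0)" "\<lambda>e v. f e"] by simp

lemmas ar_comp2 = ar_app2

lemma ar_comp3:
  assumes "ar (\<lambda>e. P (e 0) (e (Suc 0)) (e (Suc (Suc 0))))" "df f" "df g" "df h"
  shows "ar (\<lambda>e. P (f e) (g e) (h e))"
proof -
  let ?\<sigma> = "\<lambda>e v. if v = 0 then f e else if v = Suc 0 then g e else h e"
  have "df (\<lambda>e. ?\<sigma> e v)" for v :: nat
    using assms by (cases "v = 0"; cases "v = Suc 0") simp_all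
  from ar_subst[where \<sigma> = ?\<sigma>, OF assms(1) this] show ?thesis by simp
qed

lemma df_comp1: assumes "df (\<lambda>e. F (e 0))" "df f" shows "df (\<lambda>e. F (f e))"
  using df_subst[OF assms(1), of "\<lambda>e v. f e"] assms(2) by simp

lemma df_comp2: assumes "df (\<lambda>e. F (e 0) (e (Suc 0)))" "df f" "df g" shows "df (\<lambda>e. F (f e) (g e))"
proof -
  let ?\<sigma> = "\<lambda>e v. if v = 0 then f e else g e"
  have "df (\<lambda>e. ?\<sigma> e v)" for v :: nat using assms by (cases "v = 0") simp_all
  from df_subst[where \<sigma> = ?\<sigma>, OF assms(1) this] show ?thesis by simp
qed

lemma df_comp3:
  assumes "df (\<lambda>e. F (e 0) (e (Suc 0)) (e (Suc (Suc 0))))" "df f" "df g" "df h"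
  shows "df (\<lambda>e. F (f e) (g e) (h e))"
proof -
  let ?\<sigma> = "\<lambda>e v. if v = 0 then f e else if v = Suc 0 then g e else h e"
  have "df (\<lambda>e. ?\<sigma> e v)" for v :: nat
    using assms by (cases "v = 0"; cases "v = Suc 0") simp_all
  from df_subst[where \<sigma> = ?\<sigma>, OF assms(1) this] show ?thesis by simp
qed

lemma ar_mem[ari]: "df f \<Longrightarrow> ds A \<Longrightarrow> ar (\<lambda>e. f e \<in> A e)"
  by (rule ar_app) (simp_all add: ds_def)

lemma ds_set[ari]: "X \<in> S \<Longrightarrow> ds (\<lambda>e. X)"
  unfolding ds_def by (rule ar_base(6))

lemma ds_Collect[ari]: "ar (\<lambda>e. P (\<lambda>k. e (Suc k)) (e 0)) \<Longrightarrow> ds (\<lambda>e. {x. P e x})"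
  by (simp add: ds_def)

lemma ar_ball[ari]:
  "ds A \<Longrightarrow> ar (\<lambda>e. P (\<lambda>k. e (Suc k)) (e 0)) \<Longrightarrow> ar (\<lambda>e. \<forall>x\<in>A e. P e x)"
  unfolding Ball_def by (intro ar_all ar_imp) (auto simp: ds_def)

lemma ar_bex[ari]:
  "ds A \<Longrightarrow> ar (\<lambda>e. P (\<lambda>k. e (Suc k)) (e 0)) \<Longrightarrow> ar (\<lambda>e. \<exists>x\<in>A e. P e x)"
  unfolding Bex_def by (intro ar_ex ar_conj) (auto simp: ds_def)

lemma ds_ops[ari]:
  "ds A \<Longrightarrow> ds B \<Longrightarrow> ds (\<lambda>e. A e \<union> B e)" "ds A \<Longrightarrow> ds B \<Longrightarrow> ds (\<lambda>e. A e \<inter> B e)"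
  "ds A \<Longrightarrow> ds B \<Longrightarrow> ds (\<lambda>e. A e - B e)" "df f \<Longrightarrow> ds A \<Longrightarrow> ds (\<lambda>e. insert (f e) (A e))"
  "ds (\<lambda>e. {})" "ds (\<lambda>e. UNIV)"
  unfolding ds_def using df_ren[of f Suc]
  by (auto intro!: ar_disj ar_conj ar_not ar_const ar_eq df_var)

lemma ar_subset[ari]: "ds A \<Longrightarrow> ds B \<Longrightarrow> ar (\<lambda>e. A e \<subseteq> B e)"
  unfolding subset_eq by (intro ar_ball) (auto simp: ds_def)

lemma ar_seteq[ari]: "ds A \<Longrightarrow> ds B \<Longrightarrow> ar (\<lambda>e. A e = B e)"
  unfolding set_eq_subset by (intro ari)

lemma ar_ex1[ari]:
  assumes "ar (\<lambda>e. Q (\<lambda>k. e (Suc k)) (e 0))" shows "ar (\<lambda>e. \<exists>!a. Q e a)"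
proof -
  have "ar (\<lambda>e. Q (\<lambda>k. e (Suc (Suc k))) (e 0))"
    using ar_ren[OF assms, of "case_nat 0 (\<lambda>k. Suc (Suc k))"] by simp
  then show ?thesis unfolding Ex1_def by (intro ari assms)
qed

lemma ar_if[ari]: "ar P \<Longrightarrow> ar Q \<Longrightarrow> ar R \<Longrightarrow> ar (\<lambda>e. if P e then Q e else R e)"
  using ar_conj[OF ar_imp[of P Q] ar_imp[OF ar_not[of P], of R]] by (simp add: if_bool_eq_conj)

lemma df_if[ari]: "ar P \<Longrightarrow> df f \<Longrightarrow> df g \<Longrightarrow> df (\<lambda>e. if P e then f e else g e)"
  using ar_if[OF ar_ren[of P Suc], of "\<lambda>e. f (\<lambda>k. e (Suc k)) = e 0" "\<lambda>e. g (\<lambda>k. e (Suc k)) = e 0"]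
  unfolding df_def by (simp add: if_distrib[of "\<lambda>x. x = _"])

text \<open>The default value makes the description operator total, so that its definability needs
  no proof of unique existence.\<close>

definition the0 :: "('a \<Rightarrow> bool) \<Rightarrow> 'a" where
  "the0 P = (if \<exists>!x. P x then THE x. P x else \<zero>)"

lemma the0_eq: "P x \<Longrightarrow> (\<And>y. P y \<Longrightarrow> y = x) \<Longrightarrow> the0 P = x"
  unfolding the0_def by (metis (mono_tags, lifting) the_equality)

lemma the0I: "\<exists>!x. P x \<Longrightarrow> P (the0 P)"
  unfolding the0_def by (simp add: theI')

lemma df_the0[ari]:
  assumes "ar (\<lambda>e. P (\<lambda>k. e (Suc k)) (e 0))" shows "df (\<lambda>e. the0 (\<lambda>x. P e x))"
proof -
  have a: "ar (\<lambda>e. P (\<lambda>k. e (Suc (Suc k))) (e 0))"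
    using ar_ren[OF assms, of "case_nat 0 (\<lambda>k. Suc (Suc k))"] by simp
  have "(the0 Q = y) = ((\<exists>!x. Q x) \<and> Q y \<or> \<not> (\<exists>!x. Q x) \<and> \<zero> = y)" for Q y
  proof (cases "\<exists>!x. Q x")
    case True
    then show ?thesis using the0I[OF True] by blast
  qed (auto simp: the0_def)
  then show ?thesis unfolding df_def by (simp only:) (intro ari assms a)
qed

text \<open>Arithmetical comprehension in the form used from here on. The number to be tested
  becomes variable \<open>0\<close>; the rest of the environment is arbitrary, since
  \<open>A\<close> does not depend on it.\<close>

lemma setI: assumes "ds (\<lambda>e. A)" shows "A \<in> S"
proof -
  obtain p E d where p: "arithmetical p" "range E \<subseteq> S"
    "\<And>e e'. (\<forall>v. e' (3 * v) = e v) \<Longrightarrow> (\<forall>v. e' (3 * v + 1) = d v) \<Longrightarrow> (e 0 \<in> A) = satisfies M e' E p"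
    by (rule arE[OF assms[unfolded ds_def]], rule that)
  have "(n \<in> A) = satisfies M ((\<lambda>v. d (v div 3))(0 := n)) E p" for n
  proof -
    let ?e = "(\<lambda>v. d v)(0 := n)"
    have "(3 * v + 1) mod 3 = 1" "(3 * v + 1) div 3 = v" for v :: nat by presburger+
    then show ?thesis
      by (subst p(3)[of _ "?e", symmetric]) (simp_all add: fun_upd_def)
  qed
  then have "A = {n. satisfies M ((\<lambda>v. d (v div 3))(0 := n)) E p}" by blast
  moreover have "{n. satisfies M ((\<lambda>v. d (v div 3))(0 := n)) E p} \<in> S"
    by (rule comprehension[unfolded arithmetical_comprehension_def, rule_format]) (fact p)+
  ultimately show ?thesis by simp
qed

section \<open>Arithmetic in the model\<close>

lemma bas: "m \<oplus> \<one> \<noteq> \<zero>" "m \<oplus> \<one> = n \<oplus> \<one> \<longleftrightarrow> m = n" "m \<oplus> \<zero> = m" "m \<oplus> (n \<oplus> \<one>) = (m \<oplus> n) \<oplus> \<one>"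
  "m \<otimes> \<zero> = \<zero>" "m \<otimes> (n \<oplus> \<one>) = (m \<otimes> n) \<oplus> m" "\<not> m \<prec> \<zero>" "m \<prec> n \<oplus> \<one> \<longleftrightarrow> m \<prec> n \<or> m = n"
proof -
  note b = basic[unfolded basic_axioms_def]
  show "m \<oplus> \<one> \<noteq> \<zero>" by (rule b[THEN conjunct1, THEN spec])
  show "m \<oplus> \<one> = n \<oplus> \<one> \<longleftrightarrow> m = n" using b[THEN conjunct2, THEN conjunct1, THEN spec, THEN spec, of m n] by blast
  show "m \<oplus> \<zero> = m" by (rule b[THEN conjunct2, THEN conjunct2, THEN conjunct1, THEN spec])
  show "m \<oplus> (n \<oplus> \<one>) = (m \<oplus> n) \<oplus> \<one>" by (rule b[THEN conjunct2, THEN conjunct2, THEN conjunct2, THEN conjunct1, THEN spec, THEN spec])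
  show "m \<otimes> \<zero> = \<zero>" by (rule b[THEN conjunct2, THEN conjunct2, THEN conjunct2, THEN conjunct2, THEN conjunct1, THEN spec])
  show "m \<otimes> (n \<oplus> \<one>) = (m \<otimes> n) \<oplus> m" by (rule b[THEN conjunct2, THEN conjunct2, THEN conjunct2, THEN conjunct2, THEN conjunct2, THEN conjunct1, THEN spec, THEN spec])
  show "\<not> m \<prec> \<zero>" by (rule b[THEN conjunct2, THEN conjunct2, THEN conjunct2, THEN conjunct2, THEN conjunct2, THEN conjunct2, THEN conjunct1, THEN spec])
  show "m \<prec> n \<oplus> \<one> \<longleftrightarrow> m \<prec> n \<or> m = n" by (rule b[THEN conjunct2, THEN conjunct2, THEN conjunct2, THEN conjunct2, THEN conjunct2, THEN conjunct2, THEN conjunct2, THEN spec, THEN spec])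
qed

text \<open>By comprehension, set induction covers all definable predicates. Every later induction
  on numbers of the model has to show first that its statement is arithmetical.\<close>

lemma ind:
  assumes "ar (\<lambda>e. P (e 0))" "P \<zero>" "\<And>n. P n \<Longrightarrow> P (n \<oplus> \<one>)" shows "P n"
proof -
  have "{n. P n} \<in> S" by (rule setI) (simp add: ds_def assms(1))
  from set_ind[unfolded set_induction_def, THEN bspec, OF this] show ?thesis using assms(2,3) by simp
qed

lemma zero_add[simp]: "\<zero> \<oplus> n = n"
  by (rule ind[of "\<lambda>n. \<zero> \<oplus> n = n"]) (intro ari, simp_all add: bas)

lemma succ_add: "(m \<oplus> \<one>) \<oplus> n = (m \<oplus> n) \<oplus> \<one>"
  by (rule ind[of "\<lambda>n. (m \<oplus> \<one>) \<oplus> n = (m \<oplus> n) \<oplus> \<one>"]) (intro ari, simp_all add: bas)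

lemma add_comm: "m \<oplus> n = n \<oplus> m"
  by (rule ind[of "\<lambda>n. m \<oplus> n = n \<oplus> m"]) (intro ari, simp_all add: bas succ_add)

lemma add_assoc: "(k \<oplus> m) \<oplus> n = k \<oplus> (m \<oplus> n)"
  by (rule ind[of "\<lambda>n. (k \<oplus> m) \<oplus> n = k \<oplus> (m \<oplus> n)"]) (intro ari, simp_all add: bas)

lemma add_left: "m \<oplus> (k \<oplus> n) = k \<oplus> (m \<oplus> n)"
  by (metis add_comm add_assoc)

lemmas add_ac = add_assoc add_comm add_left

lemma add_cancel[simp]: "m \<oplus> k = n \<oplus> k \<longleftrightarrow> m = n"
proof -
  have "m \<oplus> k = n \<oplus> k \<longrightarrow> m = n"
    by (rule ind[of "\<lambda>k. m \<oplus> k = n \<oplus> k \<longrightarrow> m = n"]) (intro ari, simp_all add: bas)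
  then show ?thesis by blast
qed

lemma add_cancel_left[simp]: "k \<oplus> m = k \<oplus> n \<longleftrightarrow> m = n"
  by (simp add: add_comm[of k])

lemma zero_mul[simp]: "\<zero> \<otimes> n = \<zero>"
  by (rule ind[of "\<lambda>n. \<zero> \<otimes> n = \<zero>"]) (intro ari, simp_all add: bas)

lemma succ_mul: "(m \<oplus> \<one>) \<otimes> n = (m \<otimes> n) \<oplus> n"
  by (rule ind[of "\<lambda>n. (m \<oplus> \<one>) \<otimes> n = (m \<otimes> n) \<oplus> n"]) (intro ari, simp_all add: bas, simp add: add_ac)

lemma mul_comm: "m \<otimes> n = n \<otimes> m"
  by (rule ind[of "\<lambda>n. m \<otimes> n = n \<otimes> m"]) (intro ari, simp_all add: bas succ_mul)

lemma distrib: "m \<otimes> (n \<oplus> k) = (m \<otimes> n) \<oplus> (m \<otimes> k)"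
  by (rule ind[of "\<lambda>k. m \<otimes> (n \<oplus> k) = (m \<otimes> n) \<oplus> (m \<otimes> k)"]) (intro ari, simp_all add: bas, simp add: add_ac)

lemma distrib_r: "(n \<oplus> k) \<otimes> m = (n \<otimes> m) \<oplus> (k \<otimes> m)"
  by (simp add: mul_comm[of _ m] distrib)

lemma mul_one[simp]: "m \<otimes> \<one> = m" "\<one> \<otimes> m = m"
  using bas(6)[of m \<zero>] by (simp_all add: bas mul_comm[of \<one>])

lemma mul_assoc: "(k \<otimes> m) \<otimes> n = k \<otimes> (m \<otimes> n)"
  by (rule ind[of "\<lambda>n. (k \<otimes> m) \<otimes> n = k \<otimes> (m \<otimes> n)"]) (intro ari, simp_all add: bas distrib)

lemma mul_left: "m \<otimes> (k \<otimes> n) = k \<otimes> (m \<otimes> n)"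
  by (metis mul_comm mul_assoc)

lemmas mul_ac = mul_assoc mul_comm mul_left

lemma add_zero[simp]: "m \<oplus> \<zero> = m" by (rule bas)
lemma mul_zero[simp]: "m \<otimes> \<zero> = \<zero>" by (rule bas)

lemma zero_or_succ: "n = \<zero> \<or> (\<exists>m. n = m \<oplus> \<one>)"
  by (rule ind[of "\<lambda>n. n = \<zero> \<or> (\<exists>m. n = m \<oplus> \<one>)"]) (intro ari, auto)

text \<open>The axioms describe \<open>\<prec>\<close> only at zero and at successors; a witness for
  the difference makes it accessible to the laws of addition.\<close>

lemma less_iff: "m \<prec> n \<longleftrightarrow> (\<exists>d. n = m \<oplus> (d \<oplus> \<one>))"
proof (rule ind[of "\<lambda>n. m \<prec> n \<longleftrightarrow> (\<exists>d. n = m \<oplus> (d \<oplus> \<one>))"])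
  show "m \<prec> \<zero> \<longleftrightarrow> (\<exists>d. \<zero> = m \<oplus> (d \<oplus> \<one>))" using bas(1,4,7) by metis
  show "m \<prec> n \<oplus> \<one> \<longleftrightarrow> (\<exists>d. n \<oplus> \<one> = m \<oplus> (d \<oplus> \<one>))" if "m \<prec> n \<longleftrightarrow> (\<exists>d. n = m \<oplus> (d \<oplus> \<one>))" for n
  proof -
    have "(\<exists>d. n \<oplus> \<one> = m \<oplus> (d \<oplus> \<one>)) \<longleftrightarrow> (\<exists>d. n = m \<oplus> d)" by (simp add: add_assoc[symmetric])
    also have "\<dots> \<longleftrightarrow> n = m \<or> (\<exists>d. n = m \<oplus> (d \<oplus> \<one>))" by (metis zero_or_succ add_zero)
    finally show ?thesis using bas(8) that by blast
  qed
qed (intro ari)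

lemma less_irrefl: "\<not> n \<prec> n"
  using add_cancel_left[of n \<zero>] bas(1) unfolding less_iff by (metis add_zero)

lemma less_trans: "k \<prec> m \<Longrightarrow> m \<prec> n \<Longrightarrow> k \<prec> n"
  unfolding less_iff by (metis add_assoc)

lemma zero_less_succ: "\<zero> \<prec> n \<oplus> \<one>" by (auto simp: less_iff)

lemma less_linear: "m \<prec> n \<or> m = n \<or> n \<prec> m"
proof (rule ind[of "\<lambda>n. m \<prec> n \<or> m = n \<or> n \<prec> m"])
  show "m \<prec> \<zero> \<or> m = \<zero> \<or> \<zero> \<prec> m" using zero_or_succ[of m] zero_less_succ by auto
  show "m \<prec> n \<oplus> \<one> \<or> m = n \<oplus> \<one> \<or> n \<oplus> \<one> \<prec> m" if "m \<prec> n \<or> m = n \<or> n \<prec> m" for n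
  proof (cases "n \<prec> m")
    case True
    then obtain d where d: "m = n \<oplus> (d \<oplus> \<one>)" by (auto simp: less_iff)
    show ?thesis using zero_or_succ[of d]
      by (auto simp: d less_iff add_ac)
  qed (use that in \<open>auto simp: bas(8)\<close>)
qed (intro ari)

lemma le_trans: "a \<preceq> b \<Longrightarrow> b \<preceq> c \<Longrightarrow> a \<preceq> c"
  and le_lt_trans: "a \<preceq> b \<Longrightarrow> b \<prec> c \<Longrightarrow> a \<prec> c"
  and lt_le_trans: "a \<prec> b \<Longrightarrow> b \<preceq> c \<Longrightarrow> a \<prec> c"
  using less_trans by blast+

lemma not_less: "\<not> a \<prec> b \<longleftrightarrow> b \<preceq> a"
  using less_linear less_irrefl less_trans by blast

lemma zero_least[simp]: "\<not> n \<prec> \<zero>" by (rule bas)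

lemma less_succ[simp]: "m \<prec> n \<oplus> \<one> \<longleftrightarrow> m \<prec> n \<or> m = n" by (rule bas)

lemma succ_neq[simp]: "m \<oplus> \<one> \<noteq> \<zero>" "\<zero> \<noteq> m \<oplus> \<one>" using bas(1)[of m] by auto

lemma zero_le: "\<zero> \<prec> n \<or> \<zero> = n" using less_linear[of \<zero> n] by simp

lemma one_neq[simp]: "\<one> \<noteq> \<zero>" "\<zero> \<noteq> \<one>" using succ_neq(1)[of \<zero>] by auto

lemma succ_less[simp]: "m \<oplus> \<one> \<prec> n \<oplus> \<one> \<longleftrightarrow> m \<prec> n"
  unfolding less_iff by (metis add_cancel succ_add)

lemma lt_succ_self: "n \<prec> n \<oplus> \<one>" by simp

lemma succ_le: "m \<prec> n \<Longrightarrow> m \<oplus> \<one> \<prec> n \<or> m \<oplus> \<one> = n"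
  using succ_less[of m n] less_succ[of "m \<oplus> \<one>" n] by blast

lemma add_mono: "m \<prec> n \<Longrightarrow> m \<oplus> k \<prec> n \<oplus> k"
  unfolding less_iff by (metis add_assoc add_comm)

lemma le_add: "m \<prec> m \<oplus> k \<or> m = m \<oplus> k"
  using zero_or_succ[of k] by (auto simp: less_iff)

lemma le_add2: "m \<prec> k \<oplus> m \<or> m = k \<oplus> m"
  using le_add[of m k] by (simp add: add_comm)

lemma add_mono2: "m \<prec> n \<or> m = n \<Longrightarrow> k \<prec> l \<or> k = l \<Longrightarrow> m \<oplus> k \<prec> n \<oplus> l \<or> m \<oplus> k = n \<oplus> l"
  using add_mono[of m n k] add_mono[of k l n] by (metis add_comm less_trans)

lemma mul_mono: "m \<prec> n \<or> m = n \<Longrightarrow> m \<otimes> k \<prec> n \<otimes> k \<or> m \<otimes> k = n \<otimes> k"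
proof -
  assume "m \<prec> n \<or> m = n"
  then obtain d where "n = m \<oplus> d" unfolding less_iff by (metis add_zero)
  then show ?thesis using le_add[of "m \<otimes> k" "d \<otimes> k"] by (simp add: distrib_r)
qed

lemma mul_mono2: "m \<prec> n \<or> m = n \<Longrightarrow> k \<prec> l \<or> k = l \<Longrightarrow> m \<otimes> k \<prec> n \<otimes> l \<or> m \<otimes> k = n \<otimes> l"
  using mul_mono[of m n k] mul_mono[of k l n] unfolding mul_comm[of _ n] by (auto intro: less_trans)

lemma sind:
  assumes "ar (\<lambda>e. P (e 0))" "\<And>n. (\<And>m. m \<prec> n \<Longrightarrow> P m) \<Longrightarrow> P n" shows "P n"
proof -
  have a: "ar (\<lambda>e. \<forall>m. m \<prec> e 0 \<longrightarrow> P m)" by (intro ari ar_comp1[OF assms(1)])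
  have "\<forall>m. m \<prec> n \<longrightarrow> P m"
    by (rule ind[of "\<lambda>n. \<forall>m. m \<prec> n \<longrightarrow> P m", OF a]) (use assms(2) in auto)
  then show ?thesis using assms(2) by blast
qed

lemma least:
  assumes "ar (\<lambda>e. P (e 0))" "P n" obtains k where "P k" "\<And>m. m \<prec> k \<Longrightarrow> \<not> P m"
  using sind[of "\<lambda>n. \<not> P n" n] ar_not[OF assms(1)] assms(2) by blast

section \<open>Pairs\<close>

abbreviation pr (\<open>\<langle>_,/ _\<rangle>\<close>) where "\<langle>i, j\<rangle> \<equiv> pair M i j"

lemma df_pair[ari]: "df f \<Longrightarrow> df g \<Longrightarrow> df (\<lambda>e. \<langle>f e, g e\<rangle>)"
  unfolding pair_def by (intro ari)

text \<open>If \<open>s\<close> is the sum of the components, the code lies between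
  \<open>s \<otimes> s\<close> and \<open>s \<otimes> s \<oplus> s\<close>, hence below the square
  of \<open>s \<oplus> \<one>\<close>. So codes are ordered by \<open>s\<close> first, which reduces
  injectivity to pairs of equal sum.\<close>

lemma pair_less: "i \<oplus> j \<prec> k \<oplus> l \<Longrightarrow> \<langle>i, j\<rangle> \<prec> \<langle>k, l\<rangle>"
proof -
  assume a: "i \<oplus> j \<prec> k \<oplus> l"
  let ?s = "i \<oplus> j" and ?t = "k \<oplus> l"
  have "?s \<otimes> ?s \<oplus> i \<prec> ?s \<otimes> ?s \<oplus> ?s \<or> ?s \<otimes> ?s \<oplus> i = ?s \<otimes> ?s \<oplus> ?s"
    using add_mono2[OF _ le_add[of i j], of "?s \<otimes> ?s"] by blast
  moreover have "?s \<otimes> ?s \<oplus> ?s \<prec> (?s \<oplus> \<one>) \<otimes> (?s \<oplus> \<one>)"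
    unfolding less_iff by (rule exI[of _ ?s]) (simp only: bas(6) succ_mul)
  moreover have "(?s \<oplus> \<one>) \<otimes> (?s \<oplus> \<one>) \<prec> ?t \<otimes> ?t \<or> (?s \<oplus> \<one>) \<otimes> (?s \<oplus> \<one>) = ?t \<otimes> ?t"
    using mul_mono2[OF succ_le[OF a] succ_le[OF a]] .
  moreover have "?t \<otimes> ?t \<prec> \<langle>k, l\<rangle> \<or> ?t \<otimes> ?t = \<langle>k, l\<rangle>" unfolding pair_def by (rule le_add)
  ultimately show ?thesis unfolding pair_def[of _ i j] by (rule le_lt_trans[OF _ lt_le_trans[OF _ le_trans]])
qed

lemma pair_inj[simp]: "\<langle>i, j\<rangle> = \<langle>k, l\<rangle> \<longleftrightarrow> i = k \<and> j = l"
proof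
  assume a: "\<langle>i, j\<rangle> = \<langle>k, l\<rangle>"
  then have s: "i \<oplus> j = k \<oplus> l"
    using pair_less[of i j k l] pair_less[of k l i j] less_linear less_irrefl by metis
  then have "i = k" using a by (simp add: pair_def)
  then show "i = k \<and> j = l" using s by simp
qed simp

lemma pair_le1: "i \<prec> \<langle>i, j\<rangle> \<or> i = \<langle>i, j\<rangle>"
  unfolding pair_def by (rule le_add2)

lemma pair_le2: "j \<prec> \<langle>i, j\<rangle> \<or> j = \<langle>i, j\<rangle>"
proof (cases "i \<oplus> j = \<zero>")
  case True
  then have "j = \<zero>" using le_add2[of j i] by auto
  then show ?thesis using zero_le by simp
next
  case False
  then obtain t where t: "i \<oplus> j = t \<oplus> \<one>" using zero_or_succ by blast
  have "j \<prec> i \<oplus> j \<or> j = i \<oplus> j" by (rule le_add2)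
  moreover have "i \<oplus> j \<prec> (i \<oplus> j) \<otimes> (i \<oplus> j) \<or> i \<oplus> j = (i \<oplus> j) \<otimes> (i \<oplus> j)"
    using le_add2[of "i \<oplus> j" "(i \<oplus> j) \<otimes> t"] by (simp add: bas(6) t)
  moreover have "(i \<oplus> j) \<otimes> (i \<oplus> j) \<prec> \<langle>i, j\<rangle> \<or> (i \<oplus> j) \<otimes> (i \<oplus> j) = \<langle>i, j\<rangle>"
    unfolding pair_def by (rule le_add)
  ultimately show ?thesis by (rule le_trans[OF _ le_trans])
qed

lemma pair_mono2: "i \<prec> j \<Longrightarrow> \<langle>n, i\<rangle> \<prec> \<langle>n, j\<rangle>"
  using pair_less[of n i n j] add_mono[of i j n] by (simp add: add_comm)

lemma pair_mono12: "n \<prec> m \<Longrightarrow> i \<prec> j \<Longrightarrow> \<langle>n, i\<rangle> \<prec> \<langle>m, j\<rangle>"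
  using pair_less[of n i m j] add_mono[of i j n] add_mono[of n m j] by (metis add_comm less_trans)

definition pi1 where "pi1 p = the0 (\<lambda>i. \<exists>j. p = \<langle>i, j\<rangle>)"
definition pi2 where "pi2 p = the0 (\<lambda>j. \<exists>i. p = \<langle>i, j\<rangle>)"

lemma pi_pair[simp]: "pi1 \<langle>i, j\<rangle> = i" "pi2 \<langle>i, j\<rangle> = j"
  unfolding pi1_def pi2_def by (auto intro: the0_eq)

lemma df_pi[ari]: "df f \<Longrightarrow> df (\<lambda>e. pi1 (f e))" "df f \<Longrightarrow> df (\<lambda>e. pi2 (f e))"
  using df_ren[of f "\<lambda>k. Suc (Suc k)"] by (simp_all add: pi1_def pi2_def) (intro ari, simp_all)+

section \<open>Divisibility and the beta function\<close>

abbreviation dvs where "dvs \<equiv> divides M"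

lemma dvs_mul: "dvs p a \<Longrightarrow> dvs p (a \<otimes> b)" "dvs p a \<Longrightarrow> dvs p (b \<otimes> a)"
  unfolding divides_def by (metis mul_assoc mul_comm)+

lemma dvs_refl: "dvs p p" unfolding divides_def by (metis mul_one)

text \<open>There is no subtraction, so the two quotients are compared instead; if that of
  \<open>a \<oplus> b\<close> is the smaller one, then \<open>b\<close> is zero.\<close>

lemma dvs_cancel: assumes "dvs p a" "dvs p (a \<oplus> b)" shows "dvs p b"
proof -
  obtain x y where x: "a = p \<otimes> x" "a \<oplus> b = p \<otimes> y" using assms unfolding divides_def by blast
  show ?thesis
  proof (cases "x \<prec> y \<or> x = y")
    case True
    then obtain d where "y = x \<oplus> d" unfolding less_iff by (metis add_zero)
    then have "b = p \<otimes> d" using x by (simp add: distrib)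
    then show ?thesis unfolding divides_def by blast
  next
    case False
    then have "p \<otimes> y \<prec> p \<otimes> x \<or> p \<otimes> y = p \<otimes> x"
      using mul_mono[of y x p] less_linear by (metis mul_comm)
    then have "b = \<zero>" using x le_add[of a b] less_irrefl less_trans
      by (metis add_cancel_left add_zero)
    then show ?thesis unfolding divides_def by (metis mul_zero)
  qed
qed

text \<open>A substitute for the factorial of \<open>k\<close>. That it is nonzero ensures that the
  moduli of the beta function exceed \<open>\<one>\<close>.\<close>

lemma ex_common_multiple: "\<exists>m. m \<noteq> \<zero> \<and> (\<forall>i. i \<prec> k \<longrightarrow> dvs (i \<oplus> \<one>) m)"
proof (rule ind[of "\<lambda>k. \<exists>m. m \<noteq> \<zero> \<and> (\<forall>i. i \<prec> k \<longrightarrow> dvs (i \<oplus> \<one>) m)"])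
  show "ar (\<lambda>e. \<exists>m. m \<noteq> \<zero> \<and> (\<forall>i. i \<prec> e 0 \<longrightarrow> dvs (i \<oplus> \<one>) m))"
    unfolding divides_def by (intro ari)
  show "\<exists>m. m \<noteq> \<zero> \<and> (\<forall>i. i \<prec> \<zero> \<longrightarrow> dvs (i \<oplus> \<one>) m)" by (rule exI[of _ "\<zero> \<oplus> \<one>"]) (use succ_neq in simp)
  fix n assume "\<exists>m. m \<noteq> \<zero> \<and> (\<forall>i. i \<prec> n \<longrightarrow> dvs (i \<oplus> \<one>) m)"
  then obtain m where m: "m \<noteq> \<zero>" "\<forall>i. i \<prec> n \<longrightarrow> dvs (i \<oplus> \<one>) m" by blast
  then obtain m' where "m = m' \<oplus> \<one>" using zero_or_succ by blast
  then have "m \<otimes> (n \<oplus> \<one>) \<noteq> \<zero>" by (simp add: distrib add_assoc[symmetric])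
  moreover have "dvs (i \<oplus> \<one>) (m \<otimes> (n \<oplus> \<one>))" if "i \<prec> n \<oplus> \<one>" for i
    using that m(2) dvs_mul dvs_refl by auto
  ultimately show "\<exists>m. m \<noteq> \<zero> \<and> (\<forall>i. i \<prec> n \<oplus> \<one> \<longrightarrow> dvs (i \<oplus> \<one>) m)" by blast
qed

text \<open>The moduli \<open>m (j + 1) + 1\<close> and \<open>m (l + 1) + 1\<close> are coprime, since a combination of them is
  \<open>|j - l|\<close>, which divides \<open>m\<close>.\<close>

lemma beta_coprime:
  assumes m: "\<And>i. i \<prec> k \<Longrightarrow> dvs (i \<oplus> \<one>) m" and j: "j \<prec> k" "l \<prec> k" "j \<noteq> l"
    and p: "dvs (m \<otimes> (j \<oplus> \<one>) \<oplus> \<one>) (n \<otimes> (m \<otimes> (l \<oplus> \<one>) \<oplus> \<one>))"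
  shows "dvs (m \<otimes> (j \<oplus> \<one>) \<oplus> \<one>) n"
proof -
  let ?p = "m \<otimes> (j \<oplus> \<one>) \<oplus> \<one>" and ?q = "m \<otimes> (l \<oplus> \<one>) \<oplus> \<one>"
  have a: "dvs ?p (n \<otimes> ?q \<otimes> (j \<oplus> \<one>))" "dvs ?p (n \<otimes> ?p \<otimes> (l \<oplus> \<one>))"
    by (rule dvs_mul(1)[OF p], rule dvs_mul(1)[OF dvs_mul(2)[OF dvs_refl]])
  have e: "n \<otimes> ?q \<otimes> (j \<oplus> \<one>) = n \<otimes> m \<otimes> (j \<oplus> \<one>) \<otimes> (l \<oplus> \<one>) \<oplus> n \<otimes> (j \<oplus> \<one>)"
    "n \<otimes> ?p \<otimes> (l \<oplus> \<one>) = n \<otimes> m \<otimes> (j \<oplus> \<one>) \<otimes> (l \<oplus> \<one>) \<oplus> n \<otimes> (l \<oplus> \<one>)"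
    by (simp_all add: distrib distrib_r mul_ac add_ac)
  have "\<exists>d. d \<prec> k \<and> dvs ?p (n \<otimes> (d \<oplus> \<one>))"
  proof (cases "l \<prec> j")
    case True
    then obtain d where d: "j = l \<oplus> (d \<oplus> \<one>)" by (auto simp: less_iff)
    then have "n \<otimes> ?q \<otimes> (j \<oplus> \<one>) = n \<otimes> ?p \<otimes> (l \<oplus> \<one>) \<oplus> n \<otimes> (d \<oplus> \<one>)"
      unfolding e by (simp add: distrib add_ac)
    then have "dvs ?p (n \<otimes> (d \<oplus> \<one>))" using a dvs_cancel by metis
    moreover have "d \<prec> j" unfolding d less_iff by (metis add_comm add_assoc)
    ultimately show ?thesis using j less_trans by blast
  next
    case False
    then obtain d where d: "l = j \<oplus> (d \<oplus> \<one>)" using j(3) less_linear[of l j] False unfolding less_iff by blast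
    then have "n \<otimes> ?p \<otimes> (l \<oplus> \<one>) = n \<otimes> ?q \<otimes> (j \<oplus> \<one>) \<oplus> n \<otimes> (d \<oplus> \<one>)"
      unfolding e by (simp add: distrib add_ac)
    then have "dvs ?p (n \<otimes> (d \<oplus> \<one>))" using a dvs_cancel by metis
    moreover have "d \<prec> l" unfolding d less_iff by (metis add_comm add_assoc)
    ultimately show ?thesis using j less_trans by blast
  qed
  then obtain d y where d: "dvs ?p (n \<otimes> (d \<oplus> \<one>))" "m = (d \<oplus> \<one>) \<otimes> y"
    using m unfolding divides_def by blast
  \<comment> \<open>Multiplication by \<open>y \<otimes> (j \<oplus> \<one>)\<close> turns the
    factor \<open>d \<oplus> \<one>\<close> into \<open>m \<otimes> (j \<oplus> \<one>)\<close>,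
    which is one less than the modulus.\<close>
  have "dvs ?p (n \<otimes> (d \<oplus> \<one>) \<otimes> (y \<otimes> (j \<oplus> \<one>)))" by (rule dvs_mul(1)[OF d(1)])
  moreover have "n \<otimes> (d \<oplus> \<one>) \<otimes> (y \<otimes> (j \<oplus> \<one>)) = n \<otimes> m \<otimes> (j \<oplus> \<one>)" by (simp add: d(2) mul_assoc)
  moreover have "dvs ?p (n \<otimes> m \<otimes> (j \<oplus> \<one>) \<oplus> n)"
    using dvs_mul(2)[OF dvs_refl[of ?p], of n] by (simp add: distrib mul_assoc)
  ultimately show ?thesis using dvs_cancel by metis
qed

text \<open>The number \<open>n\<close> is the product of the moduli that belong to elements of
  \<open>A\<close> below \<open>k\<close>. It is built by induction on \<open>l\<close>: by
  coprimality a new factor does not affect divisibility by the other moduli.\<close>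

lemma beta:
  assumes "A \<in> S" obtains m n where "\<And>i. i \<prec> k \<Longrightarrow> dvs (m \<otimes> (i \<oplus> \<one>) \<oplus> \<one>) n \<longleftrightarrow> i \<in> A"
proof -
  obtain m where m: "m \<noteq> \<zero>" "\<And>i. i \<prec> k \<Longrightarrow> dvs (i \<oplus> \<one>) m" using ex_common_multiple by blast
  let ?P = "\<lambda>l. \<exists>n. \<forall>i. i \<prec> k \<longrightarrow> (dvs (m \<otimes> (i \<oplus> \<one>) \<oplus> \<one>) n \<longleftrightarrow> i \<in> A \<and> i \<prec> l)"
  have "?P k"
  proof (rule ind[of ?P])
    show "ar (\<lambda>e. ?P (e 0))" unfolding divides_def by (intro ari assms)
    have "\<not> dvs (m \<otimes> (i \<oplus> \<one>) \<oplus> \<one>) \<one>" for i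
    proof
      obtain m' where m': "m = m' \<oplus> \<one>" using m(1) zero_or_succ by blast
      assume "dvs (m \<otimes> (i \<oplus> \<one>) \<oplus> \<one>) \<one>"
      then obtain q where q: "\<one> = (m \<otimes> (i \<oplus> \<one>) \<oplus> \<one>) \<otimes> q" unfolding divides_def by blast
      have "q \<noteq> \<zero>" using q succ_neq(1)[of \<zero>] by auto
      then obtain q' where q': "q = q' \<oplus> \<one>" using zero_or_succ by blast
      have "\<zero> \<oplus> \<one> = ((m \<otimes> (i \<oplus> \<one>) \<oplus> \<one>) \<otimes> q' \<oplus> (m \<otimes> (i \<oplus> \<one>))) \<oplus> \<one>"
        using q unfolding q' by (simp add: bas(6) add_assoc)
      then have "\<zero> = (m \<otimes> (i \<oplus> \<one>) \<oplus> \<one>) \<otimes> q' \<oplus> (m \<otimes> (i \<oplus> \<one>))" by (simp only: add_cancel)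
      then have "\<zero> = ((m \<otimes> (i \<oplus> \<one>) \<oplus> \<one>) \<otimes> q' \<oplus> (m \<otimes> i \<oplus> m')) \<oplus> \<one>"
        by (simp add: m' bas(6) add_assoc)
      then show False using succ_neq by metis
    qed
    then show "?P \<zero>" by auto
    fix l assume "?P l"
    then obtain n where n: "\<And>i. i \<prec> k \<Longrightarrow> (dvs (m \<otimes> (i \<oplus> \<one>) \<oplus> \<one>) n \<longleftrightarrow> i \<in> A \<and> i \<prec> l)" by blast
    show "?P (l \<oplus> \<one>)"
    proof (cases "l \<in> A \<and> l \<prec> k")
      case True
      have "dvs (m \<otimes> (i \<oplus> \<one>) \<oplus> \<one>) (n \<otimes> (m \<otimes> (l \<oplus> \<one>) \<oplus> \<one>)) \<longleftrightarrow> i \<in> A \<and> i \<prec> l \<oplus> \<one>" if "i \<prec> k" for i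
      proof (cases "i = l")
        case True
        then show ?thesis using \<open>l \<in> A \<and> l \<prec> k\<close> dvs_mul(2)[OF dvs_refl] by simp
      next
        case False
        have "dvs (m \<otimes> (i \<oplus> \<one>) \<oplus> \<one>) (n \<otimes> (m \<otimes> (l \<oplus> \<one>) \<oplus> \<one>)) \<longleftrightarrow> dvs (m \<otimes> (i \<oplus> \<one>) \<oplus> \<one>) n"
          using beta_coprime[OF m(2) that _ False] True dvs_mul(1) by blast
        then show ?thesis using n[OF that] False by simp
      qed
      then show ?thesis by blast
    next
      case False
      then have "\<forall>i. i \<prec> k \<longrightarrow> (dvs (m \<otimes> (i \<oplus> \<one>) \<oplus> \<one>) n \<longleftrightarrow> i \<in> A \<and> i \<prec> l \<oplus> \<one>)" using n by auto
      then show ?thesis by blast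
    qed
  qed
  then show thesis using that by auto
qed

section \<open>Coded finite sets\<close>

abbreviation fm where "fm \<equiv> fmem M"
abbreviation fcode where "fcode \<equiv> fin_code M"

lemma df_fmem[ari]: "df f \<Longrightarrow> df g \<Longrightarrow> ar (\<lambda>e. fm (f e) (g e))"
proof (rule ar_comp2[where P = fm])
  show "ar (\<lambda>e. fm (e 0) (e (Suc 0)))" unfolding fmem_def divides_def by (intro ari)
qed

lemma ar_fcode[ari]: "df f \<Longrightarrow> ar (\<lambda>e. fcode (f e))"
proof (rule ar_comp1[where P = fcode])
  show "ar (\<lambda>e. fcode (e 0))" unfolding fin_code_def by (intro ari)
qed

definition elts where "elts c = {i. fm i c}"

text \<open>Finiteness in the sense of the model: by the beta function, the bounded sets of the
  model are exactly those that have a code.\<close>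

definition fin :: "'a set \<Rightarrow> bool" where "fin A \<longleftrightarrow> A \<in> S \<and> (\<exists>b. \<forall>i\<in>A. i \<prec> b)"

definition code where "code A = the0 (\<lambda>c. fcode c \<and> (\<forall>i. fm i c \<longleftrightarrow> i \<in> A))"

lemma in_elts: "i \<in> elts c \<longleftrightarrow> fm i c" by (simp add: elts_def)

lemma ds_elts[ari]: "df f \<Longrightarrow> ds (\<lambda>e. elts (f e))"
  unfolding elts_def ds_def mem_Collect_eq by (rule df_fmem[OF df_var df_ren])

lemma df_code[ari]: assumes "ds A" shows "df (\<lambda>e. code (A e))"
proof -
  have "ds (\<lambda>e. A (\<lambda>k. e (Suc k)))" "ds (\<lambda>e. A (\<lambda>k. e (Suc (Suc k))))"
    using ds_subst[OF assms, of "\<lambda>e k. e (Suc k)"] ds_subst[OF assms, of "\<lambda>e k. e (Suc (Suc k))"]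
    by (simp_all add: df_var)
  then show ?thesis unfolding code_def by (intro ari)
qed

lemma fm_less: "fm i c \<Longrightarrow> i \<prec> c"
  unfolding fmem_def using pair_le1 less_trans by metis

lemma fin_elts: "fin (elts c)"
proof -
  have "elts c \<in> S" by (rule setI) (intro ari)
  then show ?thesis unfolding fin_def using fm_less in_elts by blast
qed

lemma fcode_unique: "fcode c \<Longrightarrow> fcode d \<Longrightarrow> (\<And>i. fm i c \<longleftrightarrow> fm i d) \<Longrightarrow> c = d"
  unfolding fin_code_def using less_linear by metis

text \<open>The beta function yields some triple with the right elements; the least such triple is
  the canonical code.\<close>

lemma fin_code_ex: assumes "fin A" shows "\<exists>c. fcode c \<and> (\<forall>i. fm i c \<longleftrightarrow> i \<in> A)"
proof -
  obtain b where A: "A \<in> S" "\<And>i. i \<in> A \<Longrightarrow> i \<prec> b" using assms unfolding fin_def by blast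
  obtain m n where mn: "\<And>i. i \<prec> b \<Longrightarrow> dvs (m \<otimes> (i \<oplus> \<one>) \<oplus> \<one>) n \<longleftrightarrow> i \<in> A"
    using beta[OF A(1), of b] by blast
  let ?P = "\<lambda>c. (\<exists>k m n. c = \<langle>k, \<langle>m, n\<rangle>\<rangle>) \<and> (\<forall>i. fm i c \<longleftrightarrow> i \<in> A)"
  have P: "?P \<langle>b, \<langle>m, n\<rangle>\<rangle>" using mn A(2) by (auto simp: fmem_def)
  have "ar (\<lambda>e. ?P (e 0))" by (intro ari A)
  from least[of ?P, OF this P] obtain c where c: "?P c" "\<And>d. d \<prec> c \<Longrightarrow> \<not> ?P d" by blast
  then have "fcode c" unfolding fin_code_def by blast
  then show ?thesis using c by blast
qed

lemma code_props: assumes "fin A" shows "fcode (code A)" "elts (code A) = A"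
proof -
  have "\<exists>!c. fcode c \<and> (\<forall>i. fm i c \<longleftrightarrow> i \<in> A)" using fin_code_ex[OF assms] fcode_unique by metis
  from the0I[OF this] show "fcode (code A)" "elts (code A) = A"
    unfolding code_def[symmetric] by (auto simp: elts_def)
qed

lemma code_elts: "fcode c \<Longrightarrow> code (elts c) = c"
  using code_props[OF fin_elts, of c] fcode_unique by (auto simp: set_eq_iff in_elts)

lemma elts_eq: "fcode c \<Longrightarrow> fcode d \<Longrightarrow> elts c = elts d \<longleftrightarrow> c = d"
  using code_elts by metis

section \<open>Finite sets, recursion and enumerations\<close>

lemma finI: "A \<in> S \<Longrightarrow> (\<And>i. i \<in> A \<Longrightarrow> i \<prec> b) \<Longrightarrow> fin A"
  unfolding fin_def by blast

lemma fin_S: "fin A \<Longrightarrow> A \<in> S" by (simp add: fin_def)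

lemma fin_subset: "fin A \<Longrightarrow> B \<in> S \<Longrightarrow> B \<subseteq> A \<Longrightarrow> fin B"
  unfolding fin_def by blast

lemma fin_lessThan: "fin {i. i \<prec> n}"
  by (rule finI[of _ n]) (rule setI, intro ari, simp)

lemma fin_empty: "fin {}"
  by (rule finI) (rule setI, intro ari, simp)

lemma fin_Un: assumes "fin A" "fin B" shows "fin (A \<union> B)"
proof -
  obtain a b where ab: "\<forall>i\<in>A. i \<prec> a" "\<forall>i\<in>B. i \<prec> b" using assms unfolding fin_def by blast
  have "i \<prec> a \<oplus> b" if "i \<in> A \<union> B" for i
    using that ab lt_le_trans[OF _ le_add[of a b]] lt_le_trans[OF _ le_add2[of b a]] by blast
  moreover have "A \<union> B \<in> S" by (rule setI, intro ari fin_S assms)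
  ultimately show ?thesis by (rule finI[rotated])
qed

lemma fin_single: "fin {x}"
  by (rule finI[of _ "x \<oplus> \<one>"]) (rule setI, intro ari, simp)

lemma fin_insert: "fin A \<Longrightarrow> fin (insert x A)"
  using fin_Un[OF fin_single, of A x] by simp

lemma ds_image[ari]:
  assumes "ds A" "df (\<lambda>e. F (\<lambda>k. e (Suc k)) (e 0))" shows "ds (\<lambda>e. F e ` A e)"
proof -
  have "df (\<lambda>e. F (\<lambda>k. e (Suc (Suc k))) (e 0))"
    using df_ren[OF assms(2), of "case_nat 0 (\<lambda>k. Suc (Suc k))"] by simp
  moreover have "ds (\<lambda>e. A (\<lambda>k. e (Suc k)))"
    using ds_subst[OF assms(1), of "\<lambda>e k. e (Suc k)"] by (simp add: df_var)
  ultimately have "ds (\<lambda>e. {y. \<exists>x\<in>A e. y = F e x})" by (intro ari)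
  then show ?thesis by (simp add: image_def)
qed

text \<open>Collection for definable functions, proved by adding up bounds.\<close>

lemma bounded_image:
  assumes "df (\<lambda>e. F (e 0))" shows "\<exists>b. \<forall>i. i \<prec> n \<longrightarrow> F i \<prec> b"
proof (rule ind[of "\<lambda>n. \<exists>b. \<forall>i. i \<prec> n \<longrightarrow> F i \<prec> b"])
  fix n assume "\<exists>b. \<forall>i. i \<prec> n \<longrightarrow> F i \<prec> b"
  then obtain b where b: "\<forall>i. i \<prec> n \<longrightarrow> F i \<prec> b" by blast
  have "F i \<prec> b \<oplus> (F n \<oplus> \<one>)" if "i \<prec> n \<oplus> \<one>" for i
  proof (cases "i = n")
    case True
    then show ?thesis using lt_le_trans[OF lt_succ_self le_add2] by blast
  next
    case False
    then show ?thesis using that b lt_le_trans[OF _ le_add] by auto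
  qed
  then show "\<exists>b. \<forall>i. i \<prec> n \<oplus> \<one> \<longrightarrow> F i \<prec> b" by blast
qed (intro ari df_comp1[OF assms], simp)

lemma fin_image: assumes "fin A" "df (\<lambda>e. F (e 0))" shows "fin (F ` A)"
proof -
  obtain a where a: "\<And>i. i \<in> A \<Longrightarrow> i \<prec> a" using assms unfolding fin_def by blast
  obtain b where "\<forall>i. i \<prec> a \<longrightarrow> F i \<prec> b" using bounded_image[OF assms(2)] by blast
  then have b: "\<And>i. i \<in> F ` A \<Longrightarrow> i \<prec> b" using a by blast
  have "F ` A \<in> S" by (rule setI, intro ari fin_S assms)
  then show ?thesis using b by (rule finI)
qed

lemma elts_code[simp]: "fin A \<Longrightarrow> elts (code A) = A"
  by (rule code_props)

section \<open>Finite functions and recursion\<close>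

definition app where "app c i = the0 (\<lambda>y. \<langle>i, y\<rangle> \<in> elts c)"

lemma df_app[ari]: assumes "df f" "df g" shows "df (\<lambda>e. app (f e) (g e))"
proof (rule df_comp2[OF _ assms])
  show "df (\<lambda>e. app (e 0) (e (Suc 0)))" unfolding app_def by (intro ari)
qed

text \<open>The passage from a definable function to a number that codes its restriction;
  \<open>app\<close> leads back. Quantification over finite functions thereby becomes
  arithmetical.\<close>

definition gr where "gr k F = code ((\<lambda>i. \<langle>i, F i\<rangle>) ` {i. i \<prec> k})"

lemma df_gr[ari]:
  assumes "df k" "df (\<lambda>e. F (\<lambda>k. e (Suc k)) (e 0))" shows "df (\<lambda>e. gr (k e) (F e))"
proof -
  have "df (\<lambda>e. k (\<lambda>k. e (Suc k)))" by (rule df_ren[OF assms(1)])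
  then show ?thesis unfolding gr_def by (intro ari assms)
qed

lemma fin_gr: "df (\<lambda>e. F (e 0)) \<Longrightarrow> fin ((\<lambda>i. \<langle>i, F i\<rangle>) ` {i. i \<prec> k})"
  by (intro fin_image fin_lessThan ari) simp

lemma gr_simps:
  assumes "df (\<lambda>e. F (e 0))"
  shows "fcode (gr k F)" "elts (gr k F) = (\<lambda>i. \<langle>i, F i\<rangle>) ` {i. i \<prec> k}"
    "fm p (gr k F) \<longleftrightarrow> (\<exists>i. i \<prec> k \<and> p = \<langle>i, F i\<rangle>)"
    "fapp M (gr k F) i y \<longleftrightarrow> i \<prec> k \<and> y = F i"
    "i \<prec> k \<Longrightarrow> app (gr k F) i = F i"
proof -
  show c: "fcode (gr k F)" "elts (gr k F) = (\<lambda>i. \<langle>i, F i\<rangle>) ` {i. i \<prec> k}"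
    unfolding gr_def using code_props[OF fin_gr[OF assms]] by simp_all
  show m: "fm p (gr k F) \<longleftrightarrow> (\<exists>i. i \<prec> k \<and> p = \<langle>i, F i\<rangle>)" for p
    using c(2) by (auto simp flip: in_elts)
  show "fapp M (gr k F) i y \<longleftrightarrow> i \<prec> k \<and> y = F i" by (auto simp: fapp_def m)
  show "i \<prec> k \<Longrightarrow> app (gr k F) i = F i"
    unfolding app_def by (rule the0_eq) (auto simp: in_elts m)
qed

lemma gr_cong: "(\<And>i. i \<prec> k \<Longrightarrow> F i = G i) \<Longrightarrow> gr k F = gr k G"
  unfolding gr_def by (rule arg_cong[of _ _ code]) (auto simp: image_def)

lemma gr_psubset:
  assumes "df (\<lambda>e. q (e 0))" shows "elts (gr m q) \<subset> elts (gr (m \<oplus> \<one>) q)"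
proof
  show "elts (gr m q) \<subseteq> elts (gr (m \<oplus> \<one>) q)" unfolding gr_simps(2)[OF assms] by auto
  have "\<langle>m, q m\<rangle> \<in> elts (gr (m \<oplus> \<one>) q)" "\<langle>m, q m\<rangle> \<notin> elts (gr m q)"
    unfolding gr_simps(2)[OF assms] using less_irrefl by auto
  then show "elts (gr m q) \<noteq> elts (gr (m \<oplus> \<one>) q)" by blast
qed

text \<open>A value is witnessed by a finite set \<open>s\<close> in which every pair is the initial
  one or arises in one step from another pair of \<open>s\<close>. Such a set need not be a
  function; uniqueness of the values follows by induction on \<open>n\<close>. The argument
  \<open>K\<close> is a parameter.\<close>

lemma primrec_ex:
  assumes z: "df (\<lambda>e. z (e 0))" and G: "df (\<lambda>e. G (e 0) (e (Suc 0)) (e (Suc (Suc 0))))"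
  obtains F where "df (\<lambda>e. F (e 0) (e (Suc 0)))" "\<And>K. F K \<zero> = z K"
    "\<And>K n. F K (n \<oplus> \<one>) = G K n (F K n)"
proof -
  define Q where "Q K n y \<longleftrightarrow> (\<exists>s. (\<forall>p\<in>elts s. p = \<langle>\<zero>, z K\<rangle> \<or>
    (\<exists>i y. \<langle>i, y\<rangle> \<in> elts s \<and> p = \<langle>i \<oplus> \<one>, G K i y\<rangle>)) \<and> \<langle>n, y\<rangle> \<in> elts s)" for K n y
  have arQ: "ar (\<lambda>e. Q (e 0) (e (Suc 0)) (e (Suc (Suc 0))))"
    unfolding Q_def by (intro ari df_comp1[OF z] df_comp3[OF G])
  define F where "F K n = the0 (\<lambda>y. Q K n y)" for K n
  have dF: "df (\<lambda>e. F (e 0) (e (Suc 0)))" unfolding F_def by (intro ari ar_comp3[OF arQ])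
  have Q0: "Q K \<zero> y \<longleftrightarrow> y = z K" for K y
  proof
    assume "y = z K"
    then show "Q K \<zero> y" unfolding Q_def by (intro exI[of _ "code {\<langle>\<zero>, z K\<rangle>}"]) (simp add: fin_single)
  qed (auto simp: Q_def)
  have Q1: "\<exists>y. Q K n y \<and> y' = G K n y" if "Q K (n \<oplus> \<one>) y'" for K n y'
  proof -
    obtain s where s: "\<forall>p\<in>elts s. p = \<langle>\<zero>, z K\<rangle> \<or> (\<exists>i y. \<langle>i, y\<rangle> \<in> elts s \<and> p = \<langle>i \<oplus> \<one>, G K i y\<rangle>)"
      "\<langle>n \<oplus> \<one>, y'\<rangle> \<in> elts s" using \<open>Q K (n \<oplus> \<one>) y'\<close> unfolding Q_def by blast
    from bspec[OF s] obtain y where "\<langle>n, y\<rangle> \<in> elts s" "y' = G K n y" by (auto simp: bas)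
    then show ?thesis unfolding Q_def using s(1) by blast
  qed
  have Q2: "Q K (n \<oplus> \<one>) (G K n y)" if Q: "Q K n y" for K n y
  proof -
    obtain s where s: "\<forall>p\<in>elts s. p = \<langle>\<zero>, z K\<rangle> \<or> (\<exists>i y. \<langle>i, y\<rangle> \<in> elts s \<and> p = \<langle>i \<oplus> \<one>, G K i y\<rangle>)"
      "\<langle>n, y\<rangle> \<in> elts s" using Q unfolding Q_def by blast
    show ?thesis unfolding Q_def
      by (rule exI[of _ "code (insert \<langle>n \<oplus> \<one>, G K n y\<rangle> (elts s))"])
        (use s in \<open>auto simp: fin_insert fin_elts\<close>)
  qed
  have ex: "\<exists>!y. Q K n y" for K n
  proof (rule ind[of "\<lambda>n. \<exists>!y. Q K n y"])
    show "ar (\<lambda>e. \<exists>!y. Q K (e 0) y)" by (intro ari ar_comp3[OF arQ])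
    show "\<exists>!y. Q K \<zero> y" by (simp add: Q0)
    show "\<exists>!y. Q K (n \<oplus> \<one>) y" if "\<exists>!y. Q K n y" for n using that Q1 Q2 by metis
  qed
  show thesis
  proof (rule that[OF dF])
    show "F K \<zero> = z K" for K unfolding F_def Q0 by (rule the0_eq) simp_all
    show "F K (n \<oplus> \<one>) = G K n (F K n)" for K n
    proof -
      have "Q K n (F K n)" unfolding F_def by (rule the0I[OF ex])
      then show ?thesis unfolding F_def[of _ "n \<oplus> \<one>"] using Q2 ex by (intro the0_eq) blast+
    qed
  qed
qed

text \<open>Primitive recursion is applied to the code of the graph constructed so far, from which
  \<open>H\<close> is read off.\<close>

lemma cov_rec_ex:
  assumes G: "df (\<lambda>e. G (e 0) (e (Suc 0)))"
  obtains H where "df (\<lambda>e. H (e 0))" "\<And>m. H m = G m (gr m H)"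
proof -
  have d: "df (\<lambda>e. code (insert \<langle>e (Suc 0), G (e (Suc 0)) (e (Suc (Suc 0)))\<rangle> (elts (e (Suc (Suc 0))))))"
    by (intro ari df_comp2[OF G])
  obtain F where F: "df (\<lambda>e. F (e 0) (e (Suc 0)))" "\<And>K. F K \<zero> = code {}"
    "\<And>K n. F K (n \<oplus> \<one>) = code (insert \<langle>n, G n (F K n)\<rangle> (elts (F K n)))"
    by (rule primrec_ex[of "\<lambda>K. code {}" "\<lambda>K n y. code (insert \<langle>n, G n y\<rangle> (elts y))", OF df_const d]) blast
  define H where "H m = G m (F \<zero> m)" for m
  have dH: "df (\<lambda>e. H (e 0))" unfolding H_def by (intro ari df_comp2[OF G] df_comp2[OF F(1)])
  have "F \<zero> m = gr m H" for m
  proof (rule ind[of "\<lambda>m. F \<zero> m = gr m H"])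
    show "ar (\<lambda>e. F \<zero> (e 0) = gr (e 0) H)" by (intro ari df_comp2[OF F(1)] df_comp1[OF dH])
    show "F \<zero> \<zero> = gr \<zero> H" by (simp add: F(2) gr_def)
    show "F \<zero> (n \<oplus> \<one>) = gr (n \<oplus> \<one>) H" if "F \<zero> n = gr n H" for n
    proof -
      have "elts (F \<zero> n) = (\<lambda>i. \<langle>i, H i\<rangle>) ` {i. i \<prec> n}" using that gr_simps(2)[OF dH] by simp
      then have "insert \<langle>n, G n (F \<zero> n)\<rangle> (elts (F \<zero> n)) = (\<lambda>i. \<langle>i, H i\<rangle>) ` {i. i \<prec> n \<oplus> \<one>}"
        unfolding H_def[of n, symmetric] by auto
      then show ?thesis by (simp add: F(3) gr_def)
    qed
  qed
  then have "H m = G m (gr m H)" for m by (subst H_def) simp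
  then show thesis by (rule that[OF dH])
qed

section \<open>Increasing enumerations and cardinality\<close>

definition incr where
  "incr lt A k F \<longleftrightarrow> (\<forall>i. i \<prec> k \<longrightarrow> F i \<in> A) \<and> (\<forall>x\<in>A. \<exists>i. i \<prec> k \<and> F i = x) \<and>
    (\<forall>i j. i \<prec> j \<longrightarrow> j \<prec> k \<longrightarrow> lt (F i) (F j))"

abbreviation lin where "lin \<equiv> linear_order_on_class"

lemma linD:
  assumes "lin U lt"
  shows "U x \<Longrightarrow> \<not> lt x x" "U x \<Longrightarrow> U y \<Longrightarrow> U z \<Longrightarrow> lt x y \<Longrightarrow> lt y z \<Longrightarrow> lt x z"
    "U x \<Longrightarrow> U y \<Longrightarrow> lt x y \<or> x = y \<or> lt y x"
  using assms unfolding linear_order_on_class_def by blast+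

lemma lin_subset:
  assumes l: "lin U lt" and V: "\<And>x. V x \<Longrightarrow> U x" shows "lin V lt"
  unfolding linear_order_on_class_def
proof (intro conjI allI impI)
  show "\<not> lt x x" if "V x" for x by (rule linD(1)[OF l V[OF that]])
  show "lt x z" if "V x \<and> V y \<and> V z \<and> lt x y \<and> lt y z" for x y z
    using linD(2)[OF l, of x y z] V that by simp
  show "lt x y \<or> x = y \<or> lt y x" if "V x \<and> V y" for x y using linD(3)[OF l, of x y] V that by simp
qed

definition pd where "pd n = the0 (\<lambda>m. n = m \<oplus> \<one>)"

lemma pd_succ[simp]: "pd (n \<oplus> \<one>) = n" unfolding pd_def by (rule the0_eq) simp_all

lemma df_pd[ari]: assumes "df f" shows "df (\<lambda>e. pd (f e))"
proof (rule df_comp1[OF _ assms])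
  show "df (\<lambda>e. pd (e 0))" unfolding pd_def by (intro ari)
qed

lemma incr_cong:
  assumes "\<And>i. i \<prec> k \<Longrightarrow> F i = G i" shows "incr lt A k F \<longleftrightarrow> incr lt A k G"
proof -
  have "(i \<prec> j \<longrightarrow> j \<prec> k \<longrightarrow> lt (F i) (F j)) = (i \<prec> j \<longrightarrow> j \<prec> k \<longrightarrow> lt (G i) (G j))" for i j
    using assms[of i] assms[of j] less_trans[of i j k] by auto
  moreover have "(i \<prec> k \<longrightarrow> F i \<in> A) = (i \<prec> k \<longrightarrow> G i \<in> A)" "(i \<prec> k \<and> F i = x) = (i \<prec> k \<and> G i = x)"
    for i x using assms[of i] by auto
  ultimately show ?thesis unfolding incr_def by simp
qed

text \<open>The new element takes the position \<open>j\<close>, before which exactly the smaller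
  values stand, and all later values move up by one place.\<close>

lemma incr_insert:
  assumes F: "incr lt A k F" and lin: "lin U lt" "\<And>x. x \<in> insert n A \<Longrightarrow> U x" and n: "n \<notin> A"
    and j: "j \<prec> k \<or> j = k" "\<And>i. i \<prec> k \<Longrightarrow> lt (F i) n \<longleftrightarrow> i \<prec> j"
  shows "incr lt (insert n A) (k \<oplus> \<one>) (\<lambda>i. if i \<prec> j then F i else if i = j then n else F (pd i))"
    (is "incr _ _ _ ?F")
proof -
  have FA: "F i \<in> A" if "i \<prec> k" for i using F that unfolding incr_def by blast
  have U: "U n" "\<And>i. i \<prec> k \<Longrightarrow> U (F i)" using lin(2) FA by auto
  have big: "\<exists>m. i = m \<oplus> \<one> \<and> \<not> m \<prec> j" if "\<not> i \<prec> j" "i \<noteq> j" for i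
  proof -
    have "j \<prec> i" using that less_linear by blast
    then obtain m where "i = m \<oplus> \<one>" using zero_or_succ[of i] by auto
    then show ?thesis using \<open>j \<prec> i\<close> less_irrefl less_trans by (metis less_succ)
  qed
  have lo: "lt n (F i)" if "i \<prec> k" "\<not> i \<prec> j" for i
    using linD(3)[OF lin(1), of n "F i"] U that j(2) FA n by auto
  show ?thesis unfolding incr_def
  proof (intro conjI allI impI ballI)
    fix i assume i: "i \<prec> k \<oplus> \<one>"
    show "?F i \<in> insert n A"
    proof (cases "i \<prec> j \<or> i = j")
      case True
      then show ?thesis using lt_le_trans[OF _ j(1)] FA less_irrefl[of j] by auto
    next
      case False
      then obtain m where m: "i = m \<oplus> \<one>" using big by blast
      then have "m \<prec> k" using i by (simp only: succ_less)
      then show ?thesis using m False FA by simp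
    qed
  next
    fix x assume "x \<in> insert n A"
    then consider "x = n" | i where "i \<prec> k" "F i = x" using F unfolding incr_def by auto
    then show "\<exists>i. i \<prec> k \<oplus> \<one> \<and> ?F i = x"
    proof cases
      case 1
      then show ?thesis using j(1) less_irrefl by (intro exI[of _ j]) auto
    next
      case 2
      show ?thesis
      proof (cases "i \<prec> j")
        case True
        then show ?thesis using 2 by (intro exI[of _ i]) auto
      next
        case False
        then have "j \<prec> i \<oplus> \<one>" using less_linear by auto
        then have "\<not> i \<oplus> \<one> \<prec> j \<and> i \<oplus> \<one> \<noteq> j" using less_trans less_irrefl by blast
        then show ?thesis using 2 by (intro exI[of _ "i \<oplus> \<one>"]) (auto simp del: less_succ)
      qed
    qed
  next
    fix i i' assume i: "i \<prec> i'" "i' \<prec> k \<oplus> \<one>"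
    have mono: "lt (F a) (F b)" if "a \<prec> b" "b \<prec> k" for a b using F that unfolding incr_def by blast
    have i'k: "i' \<prec> k \<or> i' = k" using i(2) by simp
    have ik: "i \<prec> k" using lt_le_trans[OF i(1) i'k] .
    consider "i' \<prec> j" | "i' = j" | m where "i' = m \<oplus> \<one>" "\<not> m \<prec> j" "\<not> i' \<prec> j" "i' \<noteq> j" using big by blast
    then show "lt (?F i) (?F i')"
    proof cases
      case 1
      then have "i \<prec> j" using i(1) less_trans by blast
      then show ?thesis using 1 mono[OF i(1)] lt_le_trans[OF 1 j(1)] by simp
    next
      case 2
      then show ?thesis using i(1) j(2)[OF ik] less_irrefl by auto
    next
      case 3
      then have mk: "m \<prec> k" using i(2) by (simp only: succ_less)
      have im: "i \<prec> m \<or> i = m" using i(1) 3 by simp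
      show ?thesis
      proof (cases "i \<prec> j")
        case True
        have "j \<prec> m \<or> j = m" using 3(2) not_less by blast
        then have "i \<prec> m" using True lt_le_trans by blast
        then show ?thesis using True 3 mono mk by simp
      next
        case False
        show ?thesis
        proof (cases "i = j")
          case True
          then show ?thesis using 3 lo[OF mk] less_irrefl by simp
        next
          case nj: False
          obtain l where l: "i = l \<oplus> \<one>" "\<not> l \<prec> j" using big[OF False nj] by blast
          then have "l \<prec> m" using im lt_succ_self less_trans by blast
          then show ?thesis using l nj False 3 mono mk by simp
        qed
      qed
    qed
  qed
qed

text \<open>By induction on \<open>n\<close>, the elements of \<open>A\<close> below
  \<open>n\<close> are listed; \<open>n\<close> is inserted at the first position whose entry is not
  below it. Enumerations are quantified as codes \<open>c\<close>, which keeps the induction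
  statement arithmetical.\<close>

lemma incr_ex:
  assumes A: "fin A" and lt: "ar (\<lambda>e. lt (e 0) (e (Suc 0)))" and lin: "lin U lt" "\<And>x. x \<in> A \<Longrightarrow> U x"
  obtains k F where "df (\<lambda>e. F (e 0))" "incr lt A k F"
proof -
  have AS: "A \<in> S" using A by (rule fin_S)
  let ?P = "\<lambda>n. \<exists>k c. incr lt (A \<inter> {i. i \<prec> n}) k (app c)"
  have "?P n" for n
  proof (rule ind[of ?P])
    show "ar (\<lambda>e. ?P (e 0))" unfolding incr_def by (intro ari AS ar_comp2[OF lt])
    show "?P \<zero>" by (rule exI[of _ \<zero>]) (simp add: incr_def)
    fix n assume "?P n"
    then obtain k c where F: "incr lt (A \<inter> {i. i \<prec> n}) k (app c)" by blast
    show "?P (n \<oplus> \<one>)"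
    proof (cases "n \<in> A")
      case False
      then have "A \<inter> {i. i \<prec> n \<oplus> \<one>} = A \<inter> {i. i \<prec> n}" by auto
      then show ?thesis using F by auto
    next
      case True
      let ?Q = "\<lambda>j. j = k \<or> \<not> lt (app c j) n"
      have "ar (\<lambda>e. ?Q (e 0))" by (intro ari ar_comp2[OF lt])
      from least[of ?Q, OF this, of k] obtain j where j: "?Q j" "\<And>i. i \<prec> j \<Longrightarrow> \<not> ?Q i" by blast
      have jk: "j \<prec> k \<or> j = k" using less_linear[of j k] j(2)[of k] by auto
      have FA: "app c i \<in> A \<inter> {i. i \<prec> n}" if "i \<prec> k" for i using F that unfolding incr_def by blast
      have "lt (app c i) n \<longleftrightarrow> i \<prec> j" if ik: "i \<prec> k" for i
      proof
        assume l: "lt (app c i) n"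
        show "i \<prec> j"
        proof (rule ccontr)
          assume "\<not> i \<prec> j"
          then have ji: "j \<prec> i \<or> j = i" using not_less by blast
          then have nk: "j \<prec> k" using ik less_trans by blast
          then have nl: "\<not> lt (app c j) n" using j(1) less_irrefl by blast
          then have "j \<prec> i" using ji l by blast
          then have "lt (app c j) (app c i)" using F ik unfolding incr_def by blast
          then show False using nl l linD(2)[OF lin(1)] lin(2) FA[OF ik] FA[OF nk] True by blast
        qed
      qed (use j(2) in blast)
      from incr_insert[OF F lin(1) _ _ jk this] have
        *: "incr lt (insert n (A \<inter> {i. i \<prec> n})) (k \<oplus> \<one>)
          (\<lambda>i. if i \<prec> j then app c i else if i = j then n else app c (pd i))" (is "incr _ _ _ ?F")
        using lin(2) True less_irrefl by blast
      have dF: "df (\<lambda>e. ?F (e 0))" by (intro ari)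
      have "insert n (A \<inter> {i. i \<prec> n}) = A \<inter> {i. i \<prec> n \<oplus> \<one>}" using True by auto
      then have "incr lt (A \<inter> {i. i \<prec> n \<oplus> \<one>}) (k \<oplus> \<one>) (app (gr (k \<oplus> \<one>) ?F))"
        using * incr_cong[of "k \<oplus> \<one>" "app (gr (k \<oplus> \<one>) ?F)" ?F] gr_simps(5)[OF dF] by auto
      then show ?thesis by blast
    qed
  qed
  moreover obtain b where "\<And>i. i \<in> A \<Longrightarrow> i \<prec> b" using A unfolding fin_def by blast
  then have "A \<inter> {i. i \<prec> b} = A" by blast
  ultimately obtain k c where "incr lt A k (app c)" by metis
  moreover have "df (\<lambda>e. app c (e 0))" by (intro ari)
  ultimately show thesis using that by blast
qed

text \<open>The place \<open>j\<close> of \<open>F i\<close> in the second listing cannot be below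
  \<open>i\<close>, where the listings agree. It cannot be above \<open>i\<close> either: then
  \<open>G i\<close> would be smaller than \<open>F i\<close> but have no place before
  \<open>i\<close> in the first listing.\<close>

lemma incr_le:
  assumes F: "incr lt A k F" "df (\<lambda>e. F (e 0))" and G: "incr lt A l G" "df (\<lambda>e. G (e 0))"
    and lin: "lin U lt" "\<And>x. x \<in> A \<Longrightarrow> U x"
  shows "i \<prec> k \<longrightarrow> i \<prec> l \<and> F i = G i"
proof (rule sind[of "\<lambda>i. i \<prec> k \<longrightarrow> i \<prec> l \<and> F i = G i"])
  show "ar (\<lambda>e. e 0 \<prec> k \<longrightarrow> e 0 \<prec> l \<and> F (e 0) = G (e 0))" by (intro ari df_comp1[OF F(2)] df_comp1[OF G(2)])
  fix i assume IH: "\<And>m. m \<prec> i \<Longrightarrow> m \<prec> k \<longrightarrow> m \<prec> l \<and> F m = G m"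
  have FA: "F i \<in> A" if "i \<prec> k" for i using F(1) that unfolding incr_def by blast
  have GA: "G i \<in> A" if "i \<prec> l" for i using G(1) that unfolding incr_def by blast
  have Fm: "lt (F i) (F j)" if "i \<prec> j" "j \<prec> k" for i j using F(1) that unfolding incr_def by blast
  have Gm: "lt (G i) (G j)" if "i \<prec> j" "j \<prec> l" for i j using G(1) that unfolding incr_def by blast
  have irr: "\<not> lt x x" if "x \<in> A" for x using linD(1)[OF lin(1)] lin(2) that by blast
  have tr: "lt x z" if "lt x y" "lt y z" "x \<in> A" "y \<in> A" "z \<in> A" for x y z
    using linD(2)[OF lin(1)] lin(2) that by blast
  show "i \<prec> k \<longrightarrow> i \<prec> l \<and> F i = G i"
  proof
    assume ik: "i \<prec> k"
    obtain j where j: "j \<prec> l" "G j = F i" using G(1) FA[OF ik] unfolding incr_def by metis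
    have "\<not> j \<prec> i"
    proof
      assume ji: "j \<prec> i"
      then have "F j = F i" using IH[OF ji] j less_trans[OF ji ik] by simp
      then show False using Fm[OF ji ik] irr[OF FA[OF ik]] by simp
    qed
    then have ij: "i \<prec> j \<or> i = j" using not_less by blast
    then have il: "i \<prec> l" using j(1) less_trans by blast
    have "\<not> i \<prec> j"
    proof
      assume "i \<prec> j"
      then have l1: "lt (G i) (F i)" using Gm[OF _ j(1)] j(2) by auto
      obtain m where m: "m \<prec> k" "F m = G i" using F(1) GA[OF il] unfolding incr_def by metis
      have "\<not> m \<prec> i" using IH[of m] m Gm[of m i] il irr[OF GA[OF il]] by auto
      then have "i \<prec> m \<or> i = m" using not_less by blast
      then show False using l1 m Fm[of i m] tr irr FA ik GA il by metis
    qed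
    then show "i \<prec> l \<and> F i = G i" using ij il j(2) by auto
  qed
qed

lemma incr_unique:
  assumes F: "incr lt A k F" "df (\<lambda>e. F (e 0))" and G: "incr lt A l G" "df (\<lambda>e. G (e 0))"
    and lin: "lin U lt" "\<And>x. x \<in> A \<Longrightarrow> U x"
  shows "k = l" "i \<prec> k \<Longrightarrow> F i = G i"
proof -
  note a = incr_le[OF F G lin] and b = incr_le[OF G F lin]
  show "k = l" using a b less_linear[of k l] less_irrefl by blast
  show "i \<prec> k \<Longrightarrow> F i = G i" using a by blast
qed

lemma incr_imp_enum:
  assumes F: "incr lt (elts a) k F" "df (\<lambda>e. F (e 0))" and lin: "lin U lt" "\<And>x. x \<in> elts a \<Longrightarrow> U x"
  shows "enumerates M lt a k (gr k F)"
proof -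
  have irr: "\<not> lt x x" if "x \<in> elts a" for x using linD(1)[OF lin(1)] lin(2) that by blast
  have FA: "F i \<in> elts a" if "i \<prec> k" for i using F(1) that unfolding incr_def by blast
  have sur: "\<exists>i. i \<prec> k \<and> F i = x" if "x \<in> elts a" for x using F(1) that unfolding incr_def by blast
  have mono: "lt (F i) (F j)" if "i \<prec> j" "j \<prec> k" for i j using F(1) that unfolding incr_def by blast
  have inj: "i = j" if "i \<prec> k" "j \<prec> k" "F i = F j" for i j
    using less_linear[of i j] mono[of i j] mono[of j i] irr[OF FA] that by metis
  show ?thesis unfolding enumerates_def fin_bij_def gr_simps[OF F(2)]
    using FA sur inj mono gr_simps(1)[OF F(2), of k] by (auto simp flip: in_elts)
qed

lemma enum_imp_incr:
  assumes "enumerates M lt a k e"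
  shows "incr lt (elts a) k (app e)" "e = gr k (app e)"
proof -
  have e: "fcode e" "\<And>p. fm p e \<Longrightarrow> \<exists>i x. p = \<langle>i, x\<rangle> \<and> i \<prec> k \<and> fm x a" "\<And>i. i \<prec> k \<Longrightarrow> \<exists>!x. fm \<langle>i, x\<rangle> e"
    "\<And>x. fm x a \<Longrightarrow> \<exists>!i. fm \<langle>i, x\<rangle> e"
    "\<And>i j x y. fm \<langle>i, x\<rangle> e \<Longrightarrow> fm \<langle>j, y\<rangle> e \<Longrightarrow> i \<prec> j \<Longrightarrow> lt x y"
    using assms unfolding enumerates_def fin_bij_def fapp_def by blast+
  have ap: "fm \<langle>i, app e i\<rangle> e" if "i \<prec> k" for i
    unfolding app_def in_elts by (rule the0I[OF e(3)[OF that]])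
  have ap2: "app e i = x" if "fm \<langle>i, x\<rangle> e" for i x
    using ap[of i] e(2)[OF that] e(3)[of i] that by auto
  show "incr lt (elts a) k (app e)" unfolding incr_def in_elts
  proof (intro conjI allI impI ballI)
    show "fm (app e i) a" if "i \<prec> k" for i using e(2)[OF ap[OF that]] by auto
    show "\<exists>i. i \<prec> k \<and> app e i = x" if "x \<in> elts a" for x
      using e(4)[of x] e(2) ap2 that unfolding in_elts by fastforce
    show "lt (app e i) (app e j)" if "i \<prec> j" "j \<prec> k" for i j
      using e(5)[OF ap ap, of i j] that less_trans by blast
  qed
  have d: "df (\<lambda>v. app e (v 0))" by (intro ari)
  show "e = gr k (app e)"
  proof (rule fcode_unique[OF e(1) gr_simps(1)[OF d]])
    show "fm p e \<longleftrightarrow> fm p (gr k (app e))" for p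
      unfolding gr_simps(3)[OF d] using e(2)[of p] ap ap2 by auto
  qed
qed

text \<open>Induction on \<open>l\<close>: an argument with the largest value \<open>l\<close> is
  redirected to the value of the last argument \<open>k'\<close>, which is then dropped. Functions
  are quantified as codes, so that the statement is arithmetical.\<close>

lemma pigeonhole:
  assumes "df (\<lambda>e. F (e 0))" "\<And>i. i \<prec> k \<Longrightarrow> F i \<prec> l" "\<And>i j. i \<prec> j \<Longrightarrow> j \<prec> k \<Longrightarrow> F i \<noteq> F j"
  shows "\<not> l \<prec> k"
proof -
  let ?inj = "\<lambda>k c l. (\<forall>i. i \<prec> k \<longrightarrow> app c i \<prec> l) \<and> (\<forall>i j. i \<prec> j \<longrightarrow> j \<prec> k \<longrightarrow> app c i \<noteq> app c j)"
  let ?P = "\<lambda>l. \<forall>k c. ?inj k c l \<longrightarrow> \<not> l \<prec> k"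
  have "?P l"
  proof (rule ind[of ?P])
    show "ar (\<lambda>e. ?P (e 0))" by (intro ari)
    show "?P \<zero>" by auto
    fix l assume IH: "?P l"
    show "?P (l \<oplus> \<one>)"
    proof (intro allI impI notI)
      fix k c assume c: "?inj k c (l \<oplus> \<one>)" and lk: "l \<oplus> \<one> \<prec> k"
      then obtain k' where k': "k = k' \<oplus> \<one>" using zero_or_succ[of k] by auto
      let ?F = "\<lambda>i. if app c i = l then app c k' else app c i"
      have d: "df (\<lambda>e. ?F (e 0))" by (intro ari)
      have lt: "app c i \<prec> l \<or> app c i = l" if "i \<prec> k' \<oplus> \<one>" for i
      proof -
        have "app c i \<prec> l \<oplus> \<one>" using c that unfolding k' by blast
        then show ?thesis by simp
      qed
      have ne: "app c i \<noteq> app c j" if "i \<prec> j" "j \<prec> k' \<oplus> \<one>" for i j using c k' that by blast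
      have "?F i \<prec> l" if "i \<prec> k'" for i
        using lt[of i] lt[of k'] ne[OF that] that by auto
      moreover have "?F i \<noteq> ?F j" if "i \<prec> j" "j \<prec> k'" for i j
        using ne[of i j] ne[of i k'] ne[of j k'] less_trans[OF that] that by auto
      ultimately have "?inj k' (gr k' ?F) l"
        using gr_simps(5)[OF d] less_trans by simp
      then have "\<not> l \<prec> k'" using IH by blast
      then show False using lk unfolding k' by (simp only: succ_less simp_thms)
    qed
  qed
  moreover have "?inj k (gr k F) l"
    using gr_simps(5)[OF assms(1)] assms(2,3) less_trans by simp
  ultimately show ?thesis by blast
qed

lemma fin_bij_imp:
  assumes "fin_bij M e k a"
  shows "\<And>i. i \<prec> k \<Longrightarrow> app e i \<in> elts a" "\<And>x. x \<in> elts a \<Longrightarrow> \<exists>!i. i \<prec> k \<and> app e i = x"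
proof -
  have e: "fcode e" "\<And>p. fm p e \<Longrightarrow> \<exists>i x. p = \<langle>i, x\<rangle> \<and> i \<prec> k \<and> fm x a" "\<And>i. i \<prec> k \<Longrightarrow> \<exists>!x. fm \<langle>i, x\<rangle> e"
    "\<And>x. fm x a \<Longrightarrow> \<exists>!i. fm \<langle>i, x\<rangle> e"
    using assms unfolding fin_bij_def fapp_def by simp_all
  have ap: "fm \<langle>i, app e i\<rangle> e" if "i \<prec> k" for i
    unfolding app_def in_elts by (rule the0I[OF e(3)[OF that]])
  have ap2: "app e i = x" if "fm \<langle>i, x\<rangle> e" for i x
    using ap[of i] e(2)[OF that] e(3)[of i] that by auto
  show "app e i \<in> elts a" if "i \<prec> k" for i using e(2)[OF ap[OF that]] by (auto simp: in_elts)
  show "\<exists>!i. i \<prec> k \<and> app e i = x" if "x \<in> elts a" for x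
  proof -
    have "\<exists>!i. fm \<langle>i, x\<rangle> e" using e(4) that by (simp add: in_elts)
    then obtain i where "fm \<langle>i, x\<rangle> e \<and> (\<forall>j. fm \<langle>j, x\<rangle> e \<longrightarrow> j = i)" unfolding Ex1_def by (rule exE)
    then have i: "fm \<langle>i, x\<rangle> e" "\<And>j. fm \<langle>j, x\<rangle> e \<Longrightarrow> j = i" by simp_all
    have "i \<prec> k" using e(2)[OF i(1)] by auto
    show ?thesis
    proof (rule ex1I[of _ i])
      show "i \<prec> k \<and> app e i = x" using \<open>i \<prec> k\<close> ap2[OF i(1)] by simp
      show "j = i" if "j \<prec> k \<and> app e j = x" for j using i(2) ap[of j] that by simp
    qed
  qed
qed

lemma fin_bij_le:
  assumes "fin_bij M e k a" "fin_bij M e' l a" shows "\<not> l \<prec> k"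
proof (rule pigeonhole[of "\<lambda>i. the0 (\<lambda>j. j \<prec> l \<and> app e' j = app e i)"])
  let ?F = "\<lambda>i. the0 (\<lambda>j. j \<prec> l \<and> app e' j = app e i)"
  note b = fin_bij_imp[OF assms(1)] and b' = fin_bij_imp[OF assms(2)]
  show "df (\<lambda>e. ?F (e 0))" by (intro ari)
  have F: "?F i \<prec> l \<and> app e' (?F i) = app e i" if "i \<prec> k" for i
    by (rule the0I[OF b'(2)[OF b(1)[OF that]]])
  show "?F i \<prec> l" if "i \<prec> k" for i using F[OF that] by blast
  show "?F i \<noteq> ?F j" if ij: "i \<prec> j" "j \<prec> k" for i j
  proof
    assume "?F i = ?F j"
    then have "app e i = app e j" using F[of i] F[of j] less_trans[OF ij] ij by metis
    then show False using b(2)[OF b(1)[OF ij(2)]] ij less_trans less_irrefl by metis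
  qed
qed

lemma fin_card_unique: "fin_card M a k \<Longrightarrow> fin_card M a l \<Longrightarrow> k = l"
  unfolding fin_card_def using fin_bij_le less_linear by metis

section \<open>The orders \<open>D\<^sup>T(X)\<close>\<close>

lemma ar_fin_bij[ari]:
  assumes "df a" "df b" "df c" shows "ar (\<lambda>e. fin_bij M (a e) (b e) (c e))"
  unfolding fin_bij_def fapp_def by (intro ari df_subst[OF assms(1)] df_subst[OF assms(2)] df_subst[OF assms(3)])

lemma ar_fapp[ari]: "df a \<Longrightarrow> df b \<Longrightarrow> df c \<Longrightarrow> ar (\<lambda>e. fapp M (a e) (b e) (c e))"
  unfolding fapp_def by (intro ari)

lemma ar_fin_card[ari]: assumes "df a" "df b" shows "ar (\<lambda>e. fin_card M (a e) (b e))"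
  unfolding fin_card_def by (intro ari df_subst[OF assms(1)] df_subst[OF assms(2)])

lemma ar_nat_morphism[ari]:
  assumes "df a" "df b" "df c" shows "ar (\<lambda>e. nat_morphism M (a e) (b e) (c e))"
  unfolding nat_morphism_def by (intro ari df_subst[OF assms(1)] df_subst[OF assms(2)] df_subst[OF assms(3)])

lemma ar_fin_union[ari]:
  assumes "df a" "df b" "df c" shows "ar (\<lambda>e. fin_union M (a e) (b e) (c e))"
  unfolding fin_union_def by (intro ari df_subst[OF assms(1)] df_subst[OF assms(2)] df_subst[OF assms(3)])

lemma ar_initial_segment[ari]:
  assumes "df a" "df b" shows "ar (\<lambda>e. initial_segment M (a e) (b e))"
  unfolding initial_segment_def by (intro ari df_subst[OF assms(1)] df_subst[OF assms(2)])

lemma ar_rel[ari]: "ds R \<Longrightarrow> df a \<Longrightarrow> df b \<Longrightarrow> ar (\<lambda>e. rel M (R e) (a e) (b e))"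
  unfolding rel_def by (intro ari)

lemma ar_enumerates[ari]:
  assumes "ds R" "df a" "df b" "df c" shows "ar (\<lambda>e. enumerates M (rel M (R e)) (a e) (b e) (c e))"
  unfolding enumerates_def
  by (intro ari ds_subst[OF assms(1)] df_subst[OF assms(2)] df_subst[OF assms(3)] df_subst[OF assms(4)])

lemma ar_inclusion_morphism[ari]:
  assumes "ds R" "df a" "df b" "df c" "df d" "df f"
  shows "ar (\<lambda>e. inclusion_morphism M (rel M (R e)) (a e) (b e) (c e) (d e) (f e))"
  unfolding inclusion_morphism_def
  by (intro ari ds_subst[OF assms(1)] df_subst[OF assms(2)] df_subst[OF assms(3)] df_subst[OF assms(4)]
      df_subst[OF assms(5)] df_subst[OF assms(6)])

lemma ar_linear_order_elts:
  assumes "ds R" "df a" "df b"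
  shows "ar (\<lambda>e. lin (\<lambda>s. fm s (a e) \<or> fm s (b e)) (rel M (R e)))"
  unfolding linear_order_on_class_def
  by (intro ari ds_subst[OF assms(1)] df_subst[OF assms(2)] df_subst[OF assms(3)])

definition cd where "cd a = the0 (\<lambda>k. fin_card M a k)"

definition en where "en lt a i = the0 (\<lambda>x. \<exists>k e. enumerates M lt a k e \<and> fapp M e i x)"

lemma df_cd[ari]: assumes "df a" shows "df (\<lambda>e. cd (a e))"
  unfolding cd_def by (intro ari df_subst[OF assms])

lemma enum_card: "enumerates M lt a k e \<Longrightarrow> fcode a \<Longrightarrow> fin_card M a k"
  unfolding enumerates_def fin_card_def by blast

lemma cd_eq: "fin_card M a k \<Longrightarrow> cd a = k"
  unfolding cd_def by (rule the0_eq) (auto intro: fin_card_unique)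

lemma nat_morphism_gr:
  assumes "df (\<lambda>e. F (e 0))" "\<And>i. i \<prec> m \<Longrightarrow> F i \<prec> n" "\<And>i j. i \<prec> j \<Longrightarrow> j \<prec> m \<Longrightarrow> F i \<prec> F j"
  shows "nat_morphism M m n (gr m F)"
  unfolding nat_morphism_def gr_simps[OF assms(1)] using assms(2,3) gr_simps(1)[OF assms(1)] by auto

lemma nat_morphismD:
  assumes "nat_morphism M m n f"
  shows "i \<prec> m \<Longrightarrow> app f i \<prec> n" "i \<prec> j \<Longrightarrow> j \<prec> m \<Longrightarrow> app f i \<prec> app f j"
    "fapp M f i j \<longleftrightarrow> i \<prec> m \<and> j = app f i" "f = gr m (app f)"
proof -
  have f: "fcode f" "\<And>p. fm p f \<Longrightarrow> \<exists>i j. p = \<langle>i, j\<rangle> \<and> i \<prec> m \<and> j \<prec> n" "\<And>i. i \<prec> m \<Longrightarrow> \<exists>!j. fm \<langle>i, j\<rangle> f"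
    "\<And>i i' j j'. fm \<langle>i, j\<rangle> f \<Longrightarrow> fm \<langle>i', j'\<rangle> f \<Longrightarrow> i \<prec> i' \<Longrightarrow> j \<prec> j'"
    using assms unfolding nat_morphism_def fapp_def by blast+
  have ap: "fm \<langle>i, app f i\<rangle> f" if "i \<prec> m" for i
    unfolding app_def in_elts by (rule the0I[OF f(3)[OF that]])
  show fa: "fapp M f i j \<longleftrightarrow> i \<prec> m \<and> j = app f i" for i j
    unfolding fapp_def using ap[of i] f(2)[of "\<langle>i, j\<rangle>"] f(3)[of i] by auto
  show "i \<prec> m \<Longrightarrow> app f i \<prec> n" using f(2)[OF ap[of i]] by auto
  show "i \<prec> j \<Longrightarrow> j \<prec> m \<Longrightarrow> app f i \<prec> app f j"
    using f(4)[OF ap[of i] ap[of j]] less_trans[of i j m] by simp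
  have d: "df (\<lambda>e. app f (e 0))" by (intro ari)
  show "f = gr m (app f)"
  proof (rule fcode_unique[OF f(1) gr_simps(1)[OF d]])
    show "fm p f \<longleftrightarrow> fm p (gr m (app f))" for p
      unfolding gr_simps(3)[OF d] using f(2)[of p] fa ap unfolding fapp_def by auto
  qed
qed

end

section \<open>Enumerations and inclusions in a definable linear order\<close>

locale lorder = aca +
  fixes U :: "'a \<Rightarrow> bool" and lt :: "'a \<Rightarrow> 'a \<Rightarrow> bool"
  assumes lin: "lin U lt" and ar_lt: "ar (\<lambda>e. lt (e 0) (e (Suc 0)))"
begin

definition fs where "fs a \<longleftrightarrow> fcode a \<and> (\<forall>x\<in>elts a. U x)"

lemma ar_enum_lt[ari]:
  assumes "df a" "df b" "df c" shows "ar (\<lambda>e. enumerates M lt (a e) (b e) (c e))"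
  unfolding enumerates_def
  by (intro ari ar_comp2[OF ar_lt] df_subst[OF assms(1)] df_subst[OF assms(2)] df_subst[OF assms(3)])

lemma df_en[ari]: assumes "df a" "df b" shows "df (\<lambda>e. en lt (a e) (b e))"
  unfolding en_def by (intro ari df_subst[OF assms(1)] df_subst[OF assms(2)])

lemma en: assumes "fs a"
  shows "incr lt (elts a) (cd a) (en lt a)" "enumerates M lt a k e \<longleftrightarrow> k = cd a \<and> e = gr (cd a) (en lt a)"
proof -
  have l: "\<And>x. x \<in> elts a \<Longrightarrow> U x" "fcode a" using assms by (simp_all add: fs_def)
  obtain k F where F: "df (\<lambda>e. F (e 0))" "incr lt (elts a) k F"
    using incr_ex[OF fin_elts ar_lt lin l(1)] by blast
  have e: "enumerates M lt a k (gr k F)" by (rule incr_imp_enum[OF F(2,1) lin l(1)])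
  have k: "cd a = k" by (rule cd_eq[OF enum_card[OF e l(2)]])
  have u: "k' = k \<and> e' = gr k F" if "enumerates M lt a k' e'" for k' e'
  proof -
    note i = enum_imp_incr[OF that]
    have d: "df (\<lambda>v. app e' (v 0))" by (intro ari)
    have kk: "k' = k" by (rule incr_unique(1)[OF i(1) d F(2,1) lin l(1)])
    have "app e' i = F i" if "i \<prec> k'" for i by (rule incr_unique(2)[OF i(1) d F(2,1) lin l(1) that])
    then have "gr k' (app e') = gr k' F" by (rule gr_cong)
    then show ?thesis using i(2) kk by simp
  qed
  have enF: "en lt a i = F i" if "i \<prec> k" for i
    unfolding en_def
  proof (rule the0_eq)
    show "\<exists>k e. enumerates M lt a k e \<and> fapp M e i (F i)" using e that gr_simps(4)[OF F(1)] by blast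
    show "y = F i" if "\<exists>k e. enumerates M lt a k e \<and> fapp M e i y" for y
      using u that gr_simps(4)[OF F(1)] by blast
  qed
  show "incr lt (elts a) (cd a) (en lt a)" unfolding k using incr_cong[of k "en lt a" F] enF F(2) by blast
  have g: "gr (cd a) (en lt a) = gr k F" unfolding k by (rule gr_cong) (rule enF)
  show "enumerates M lt a k e \<longleftrightarrow> k = cd a \<and> e = gr (cd a) (en lt a)" for k e
    unfolding g unfolding k using u e by metis
qed

lemma enD:
  assumes "fs a"
  shows "i \<prec> cd a \<Longrightarrow> en lt a i \<in> elts a" "x \<in> elts a \<Longrightarrow> \<exists>i. i \<prec> cd a \<and> en lt a i = x"
    "i \<prec> j \<Longrightarrow> j \<prec> cd a \<Longrightarrow> lt (en lt a i) (en lt a j)"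
    "i \<prec> cd a \<Longrightarrow> j \<prec> cd a \<Longrightarrow> en lt a i = en lt a j \<longleftrightarrow> i = j"
    "i \<prec> cd a \<Longrightarrow> j \<prec> cd a \<Longrightarrow> lt (en lt a i) (en lt a j) \<longleftrightarrow> i \<prec> j"
    "fin_card M a (cd a)"
proof -
  note e = en(1)[OF assms, unfolded incr_def]
  show 1: "i \<prec> cd a \<Longrightarrow> en lt a i \<in> elts a" for i using e by blast
  show "x \<in> elts a \<Longrightarrow> \<exists>i. i \<prec> cd a \<and> en lt a i = x" for x using e by blast
  show 3: "i \<prec> j \<Longrightarrow> j \<prec> cd a \<Longrightarrow> lt (en lt a i) (en lt a j)" for i j using e by blast
  have U: "U (en lt a i)" if "i \<prec> cd a" for i using 1[OF that] assms by (auto simp: fs_def)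
  show 4: "i \<prec> cd a \<Longrightarrow> j \<prec> cd a \<Longrightarrow> en lt a i = en lt a j \<longleftrightarrow> i = j" for i j
    using less_linear[of i j] 3[of i j] 3[of j i] linD(1)[OF lin U[of i]] by auto
  show "i \<prec> cd a \<Longrightarrow> j \<prec> cd a \<Longrightarrow> lt (en lt a i) (en lt a j) \<longleftrightarrow> i \<prec> j" for i j
    using less_linear[of i j] 3[of i j] 3[of j i] linD(1)[OF lin U[of i]]
      linD(2)[OF lin U[of i] U[of j] U[of i]] by auto
  have "enumerates M lt a (cd a) (gr (cd a) (en lt a))" by (simp add: en(2)[OF assms])
  then show "fin_card M a (cd a)" using enum_card assms by (simp add: fs_def)
qed

text \<open>On indices, this is the morphism between cardinalities that is induced by the inclusion
  of \<open>a\<close> into \<open>c\<close>; \<open>im\<close> is its code.\<close>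

definition inc where "inc a c i = the0 (\<lambda>j. j \<prec> cd c \<and> en lt c j = en lt a i)"
definition im where "im a c = gr (cd a) (inc a c)"

lemma df_inc[ari]: assumes "df a" "df b" "df c" shows "df (\<lambda>e. inc (a e) (b e) (c e))"
  unfolding inc_def by (intro ari df_subst[OF assms(1)] df_subst[OF assms(2)] df_subst[OF assms(3)])

lemma df_im[ari]: assumes "df a" "df b" shows "df (\<lambda>e. im (a e) (b e))"
  unfolding im_def by (intro ari df_subst[OF assms(1)] df_subst[OF assms(2)])

lemma inc:
  assumes "fs a" "fs c" "elts a \<subseteq> elts c" "i \<prec> cd a"
  shows "inc a c i \<prec> cd c" "en lt c (inc a c i) = en lt a i"
proof -
  have "en lt a i \<in> elts c" using enD(1)[OF assms(1,4)] assms(3) by blast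
  then obtain j where j: "j \<prec> cd c" "en lt c j = en lt a i" using enD(2)[OF assms(2)] by blast
  have "inc a c i = j" unfolding inc_def by (rule the0_eq) (use j enD(4)[OF assms(2)] in \<open>simp, metis\<close>)
  then show "inc a c i \<prec> cd c" "en lt c (inc a c i) = en lt a i" using j by simp_all
qed

lemma inc_mono:
  assumes "fs a" "fs c" "elts a \<subseteq> elts c" "i \<prec> j" "j \<prec> cd a" shows "inc a c i \<prec> inc a c j"
proof -
  have i: "i \<prec> cd a" using assms(4,5) less_trans by blast
  show ?thesis
    using enD(5)[OF assms(2) inc(1)[OF assms(1-3) i] inc(1)[OF assms(1-3,5)]]
      enD(3)[OF assms(1,4,5)] inc(2)[OF assms(1-3) i] inc(2)[OF assms(1-3,5)] by simp
qed

lemma df_inc0: "df (\<lambda>e. inc a c (e 0))" by (intro ari)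

lemma im_morphism: "fs a \<Longrightarrow> fs c \<Longrightarrow> elts a \<subseteq> elts c \<Longrightarrow> nat_morphism M (cd a) (cd c) (im a c)"
  unfolding im_def by (intro nat_morphism_gr df_inc0 inc inc_mono)

text \<open>Uniqueness of increasing enumerations determines all data of an inclusion morphism, so
  that the relational definitions turn into equations.\<close>

lemma inclusion_iff:
  assumes "fs a" "fs c" "elts a \<subseteq> elts c"
  shows "inclusion_morphism M lt a c k n f \<longleftrightarrow> k = cd a \<and> n = cd c \<and> f = im a c"
proof
  have dfe: "df (\<lambda>e. en lt x (e 0))" for x by (intro ari)
  {
    assume "inclusion_morphism M lt a c k n f"
    then have kn: "k = cd a" "n = cd c" and f: "nat_morphism M (cd a) (cd c) f"
      and *: "\<And>i j x y. fapp M (gr (cd a) (en lt a)) i x \<Longrightarrow> fapp M f i j \<Longrightarrow> fapp M (gr (cd c) (en lt c)) j y \<Longrightarrow> x = y"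
      unfolding inclusion_morphism_def en(2)[OF assms(1)] en(2)[OF assms(2)] by auto
    note fD = nat_morphismD[OF f]
    have "app f i = inc a c i" if "i \<prec> cd a" for i
    proof -
      have "en lt a i = en lt c (app f i)"
        by (rule *[of i _ "app f i"]) (use that fD(1,3) in \<open>auto simp: gr_simps(4)[OF dfe]\<close>)
      then show ?thesis
        using enD(4)[OF assms(2) fD(1)[OF that] inc(1)[OF assms that]] inc(2)[OF assms that] by simp
    qed
    then have "f = im a c" using fD(4) gr_cong[of "cd a" "app f" "inc a c"] by (simp add: im_def)
    then show "k = cd a \<and> n = cd c \<and> f = im a c" using kn by blast
  }
  assume k: "k = cd a \<and> n = cd c \<and> f = im a c"
  have "x = y" if "fapp M (gr (cd a) (en lt a)) i x" "fapp M (im a c) i j" "fapp M (gr (cd c) (en lt c)) j y"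
    for i j x y
    using that inc(2)[OF assms] unfolding im_def gr_simps(4)[OF dfe] gr_simps(4)[OF df_inc0] by simp
  then show "inclusion_morphism M lt a c k n f"
    unfolding inclusion_morphism_def using k im_morphism[OF assms] en(2)[OF assms(1)] en(2)[OF assms(2)] by auto
qed

lemma inc_comp:
  assumes "fs a" "fs c" "fs d" "elts a \<subseteq> elts c" "elts c \<subseteq> elts d" "i \<prec> cd a"
  shows "inc c d (inc a c i) = inc a d i"
proof -
  have ad: "elts a \<subseteq> elts d" using assms by blast
  note i1 = inc[OF assms(1,2,4,6)]
  note i2 = inc[OF assms(2,3,5) i1(1)] and i3 = inc[OF assms(1,3) ad assms(6)]
  show ?thesis using enD(4)[OF assms(3) i2(1) i3(1)] i1(2) i2(2) i3(2) by simp
qed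

lemma im_comp:
  assumes "fs a" "fs c" "fs d" "elts a \<subseteq> elts c" "elts c \<subseteq> elts d"
  shows "is_composition M (cd a) (cd c) (cd d) (im a c) (im c d) (im a d)"
  unfolding is_composition_def
proof (intro conjI im_morphism allI impI)
  show "elts a \<subseteq> elts d" using assms by blast
  show "fapp M (im a d) i k" if "fapp M (im a c) i j \<and> fapp M (im c d) j k" for i j k
    using that inc_comp[OF assms] unfolding im_def gr_simps(4)[OF df_inc0] by simp
qed (use assms in auto)

lemma fs_code: "fin A \<Longrightarrow> (\<And>x. x \<in> A \<Longrightarrow> U x) \<Longrightarrow> fs (code A)"
  using code_props by (simp add: fs_def)

lemma fin_union_iff: "fin_union M a b c \<longleftrightarrow> c = code (elts a \<union> elts b)"
proof -
  have f: "fin (elts a \<union> elts b)" by (intro fin_Un fin_elts)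
  have "fin_union M a b c \<longleftrightarrow> fcode c \<and> elts c = elts a \<union> elts b"
    unfolding fin_union_def by (auto simp: set_eq_iff in_elts)
  then show ?thesis using code_props[OF f] code_elts by metis
qed

end

section \<open>Coded prae-dilators in functional notation\<close>

locale prae = aca +
  fixes T :: "'a coded_functor"
  assumes prae: "coded_prae_dilator M T"
begin

abbreviation "mem \<equiv> T_mem M T"
abbreviation "tless \<equiv> T_less M T"
abbreviation "tm \<equiv> T_map M T"
abbreviation "ts \<equiv> T_supp M T"
abbreviation "mor \<equiv> nat_morphism M"

definition act where "act m n f s = the0 (\<lambda>t. tm m n f s t)"
definition supp where "supp n s = the0 (\<lambda>a. ts n s a)"

lemma T_sets: "field_of T \<in> S" "order_of T \<in> S" "action_of T \<in> S" "supp_of T \<in> S"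
  and functorT: "is_functor M T" and nsupp: "natural_supports M T" and scond: "support_condition M T"
  using prae unfolding coded_prae_dilator_def by simp_all

lemma ar_T[ari]:
  "df n \<Longrightarrow> df s \<Longrightarrow> ar (\<lambda>e. mem (n e) (s e))"
  "df n \<Longrightarrow> df s \<Longrightarrow> df t \<Longrightarrow> ar (\<lambda>e. tless (n e) (s e) (t e))"
  "df m \<Longrightarrow> df n \<Longrightarrow> df f \<Longrightarrow> df s \<Longrightarrow> df t \<Longrightarrow> ar (\<lambda>e. tm (m e) (n e) (f e) (s e) (t e))"
  "df n \<Longrightarrow> df s \<Longrightarrow> df t \<Longrightarrow> ar (\<lambda>e. ts (n e) (s e) (t e))"
  unfolding T_mem_def T_less_def T_map_def T_supp_def by ((intro ari T_sets; assumption)+)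

lemma tlin: "lin (mem n) (tless n)"
  by (rule functorT[unfolded is_functor_def, THEN conjunct1, THEN spec])

lemma functor2:
  assumes "mor m n f"
  shows "mem m s \<Longrightarrow> \<exists>!t. tm m n f s t" "mem m s \<Longrightarrow> tm m n f s t \<Longrightarrow> mem n t"
    "mem m s \<Longrightarrow> mem m s' \<Longrightarrow> tm m n f s t \<Longrightarrow> tm m n f s' t' \<Longrightarrow> tless m s s' \<Longrightarrow> tless n t t'"
proof -
  note f = functorT[unfolded is_functor_def, THEN conjunct2, THEN conjunct1, THEN spec, THEN spec, THEN spec, THEN mp, OF assms]
  show "mem m s \<Longrightarrow> \<exists>!t. tm m n f s t" by (rule f[THEN conjunct1, THEN spec, THEN mp])
  show "mem m s \<Longrightarrow> tm m n f s t \<Longrightarrow> mem n t" using f[THEN conjunct2, THEN conjunct1] by simp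
  show "mem m s \<Longrightarrow> mem m s' \<Longrightarrow> tm m n f s t \<Longrightarrow> tm m n f s' t' \<Longrightarrow> tless m s s' \<Longrightarrow> tless n t t'"
    using f[THEN conjunct2, THEN conjunct2] by blast
qed

lemma act: assumes "mor m n f" "mem m s"
  shows "tm m n f s t \<longleftrightarrow> t = act m n f s" "mem n (act m n f s)"
proof -
  note u = functor2(1)[OF assms]
  have a: "tm m n f s (act m n f s)" unfolding act_def by (rule the0I[OF u])
  show "tm m n f s t \<longleftrightarrow> t = act m n f s" using u a by auto
  show "mem n (act m n f s)" by (rule functor2(2)[OF assms a])
qed

text \<open>By definition morphisms only preserve the order; linearity of the two orders gives the
  converse and injectivity.\<close>

lemma act_less: assumes "mor m n f" "mem m s" "mem m s'"
  shows "tless n (act m n f s) (act m n f s') \<longleftrightarrow> tless m s s'" "act m n f s = act m n f s' \<longleftrightarrow> s = s'"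
proof -
  have m: "tless n (act m n f s) (act m n f s')" if "tless m s s'" "mem m s" "mem m s'" for s s'
    using functor2(3)[OF assms(1) that(2,3) _ _ that(1)] act(1)[OF assms(1)] that by simp
  note l = linD(3)[OF tlin assms(2,3)]
  note a = act(2)[OF assms(1,2)] act(2)[OF assms(1,3)]
  have n: "\<not> tless n (act m n f s) (act m n f s)" by (rule linD(1)[OF tlin a(1)])
  show "tless n (act m n f s) (act m n f s') \<longleftrightarrow> tless m s s'"
    using l m[OF _ assms(2,3)] m[OF _ assms(3,2)] n linD(2)[OF tlin a(1,2,1)] by auto
  show "act m n f s = act m n f s' \<longleftrightarrow> s = s'"
    using l m[OF _ assms(2,3)] m[OF _ assms(3,2)] n by auto
qed

lemma act_comp:
  assumes "is_composition M l m n f g h" "mem l s"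
  shows "act m n g (act l m f s) = act l n h s"
proof -
  have c: "mor l m f" "mor m n g" "mor l n h" using assms(1) unfolding is_composition_def by simp_all
  have "\<forall>l m n f g h \<rho> \<sigma> \<tau>. is_composition M l m n f g h \<and> mem l \<rho> \<and> tm l m f \<rho> \<sigma> \<and> tm m n g \<sigma> \<tau> \<longrightarrow> tm l n h \<rho> \<tau>"
    using functorT unfolding is_functor_def by (elim conjE)
  then have "tm l n h s (act m n g (act l m f s))"
    using assms act(1)[OF c(1) assms(2)] act(1)[OF c(2) act(2)[OF c(1) assms(2)]] by blast
  then show ?thesis using act(1)[OF c(3) assms(2)] by simp
qed

lemma supp: assumes "mem n s"
  shows "ts n s a \<longleftrightarrow> a = supp n s" "fcode (supp n s)" "i \<in> elts (supp n s) \<Longrightarrow> i \<prec> n"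
proof -
  have u: "\<exists>!a. ts n s a" using nsupp assms unfolding natural_supports_def by (elim conjE) simp
  have a: "ts n s (supp n s)" unfolding supp_def by (rule the0I[OF u])
  show "ts n s a \<longleftrightarrow> a = supp n s" using u a by auto
  show "fcode (supp n s)" "i \<in> elts (supp n s) \<Longrightarrow> i \<prec> n"
    using nsupp assms a unfolding natural_supports_def in_elts by (elim conjE, simp)+
qed

lemma supp_act: assumes "mor m n f" "mem m s"
  shows "elts (supp n (act m n f s)) = app f ` elts (supp m s)"
proof -
  note a = act[OF assms]
  have "\<forall>m n f \<sigma> \<tau> a b. mor m n f \<and> mem m \<sigma> \<and> tm m n f \<sigma> \<tau> \<and> ts m \<sigma> a \<and> ts n \<tau> b \<longrightarrow>
        (\<forall>j. fm j b \<longleftrightarrow> (\<exists>i. fm i a \<and> fapp M f i j))"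
    using nsupp unfolding natural_supports_def by (elim conjE)
  then have "\<forall>j. fm j (supp n (act m n f s)) \<longleftrightarrow> (\<exists>i. fm i (supp m s) \<and> fapp M f i j)"
    using assms a(1) supp(1)[OF assms(2)] supp(1)[OF a(2)] by blast
  then show ?thesis
    using nat_morphismD(3)[OF assms(1)] supp(3)[OF assms(2)] by (auto simp: set_eq_iff in_elts image_def)
qed

lemma full_support_iff: "full_support M T k s \<longleftrightarrow> mem k s \<and> elts (supp k s) = {i. i \<prec> k}"
proof (cases "mem k s")
  case True
  then show ?thesis using supp[OF True]
    unfolding full_support_def initial_segment_def by (auto simp: set_eq_iff in_elts)
qed (simp add: full_support_def)

lemma ar_full_support[ari]: assumes "df k" "df s" shows "ar (\<lambda>e. full_support M T (k e) (s e))"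
  unfolding full_support_def by (intro ari df_subst[OF assms(1)] df_subst[OF assms(2)])

lemma ar_D_compare[ari]:
  assumes "ds R" "df a" "df b" "df c" "df d"
  shows "ar (\<lambda>e. D_compare M T (rel M (R e)) (a e) (b e) (c e) (d e))"
  unfolding D_compare_def
  by (intro ari ds_subst[OF assms(1)] df_subst[OF assms(2)] df_subst[OF assms(3)] df_subst[OF assms(4)] df_subst[OF assms(5)])

lemma ar_D_pair:
  assumes "ds X" "df a" "df b" shows "ar (\<lambda>e. D_pair M T (\<lambda>x. x \<in> X e) (a e) (b e))"
  unfolding D_pair_def by (intro ari ds_subst[OF assms(1)] df_subst[OF assms(2)] df_subst[OF assms(3)])

lemma ar_D_mem[ari]:
  assumes "ds X" "df a" shows "ar (\<lambda>e. D_mem M T (X e) (a e))"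
  unfolding D_mem_def by (intro ari ar_D_pair ds_subst[OF assms(1)] df_subst[OF assms(2)])

lemma ar_D_less[ari]:
  assumes "ds X" "df a" "df b" shows "ar (\<lambda>e. D_less M T (X e) (a e) (b e))"
  unfolding D_less_def by (intro ari ds_subst[OF assms(1)] df_subst[OF assms(2)] df_subst[OF assms(3)])

end

locale dorder = prae + lorder
begin

lemma D_pair_iff: "D_pair M T U a s \<longleftrightarrow> fs a \<and> mem (cd a) s \<and> elts (supp (cd a) s) = {i. i \<prec> cd a}"
proof -
  have "D_pair M T U a s \<longleftrightarrow> fs a \<and> (\<exists>k. fin_card M a k \<and> full_support M T k s)"
    unfolding D_pair_def fs_def by (auto simp: in_elts)
  also have "\<dots> \<longleftrightarrow> fs a \<and> full_support M T (cd a) s"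
    using enD(6) cd_eq by blast
  finally show ?thesis by (simp add: full_support_iff)
qed

definition val where "val a c s = act (cd a) (cd c) (im a c) s"

text \<open>Since the support of \<open>s\<close> is full, the support of its image consists of the
  places of \<open>a\<close> in \<open>c\<close>. So \<open>a\<close> can be recovered from the
  value, on which \<open>D_total\<close> relies.\<close>

lemma val_props:
  assumes "D_pair M T U a s" "fs c" "elts a \<subseteq> elts c"
  shows "mem (cd c) (val a c s)" "en lt c ` elts (supp (cd c) (val a c s)) = elts a"
proof -
  have a: "fs a" "mem (cd a) s" "elts (supp (cd a) s) = {i. i \<prec> cd a}" using assms(1) by (simp_all add: D_pair_iff)
  note m = im_morphism[OF a(1) assms(2,3)]
  show "mem (cd c) (val a c s)" unfolding val_def by (rule act(2)[OF m a(2)])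
  have "app (im a c) i = inc a c i" if "i \<prec> cd a" for i
    unfolding im_def using gr_simps(5)[OF df_inc0 that] .
  then have "en lt c ` elts (supp (cd c) (val a c s)) = en lt a ` {i. i \<prec> cd a}"
    unfolding val_def supp_act[OF m a(2)] a(3) using inc(2)[OF a(1) assms(2,3)] by (auto simp: image_def)
  also have "\<dots> = elts a" using enD(1,2)[OF a(1)] by blast
  finally show "en lt c ` elts (supp (cd c) (val a c s)) = elts a" .
qed

lemma val_comp:
  assumes "D_pair M T U a s" "fs c" "fs d" "elts a \<subseteq> elts c" "elts c \<subseteq> elts d"
  shows "act (cd c) (cd d) (im c d) (val a c s) = val a d s"
  unfolding val_def using act_comp[OF im_comp[OF _ assms(2-5)]] assms(1) by (simp add: D_pair_iff)

text \<open>The comparison may be made over any larger finite set \<open>d\<close>, because the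
  inclusion of the union into \<open>d\<close> acts as an order embedding. A common \<open>d\<close>
  then reduces the laws for \<open>D_compare\<close> to those for a single order of
  \<open>T\<close>.\<close>

lemma D_compare_iff:
  assumes a: "D_pair M T U a s" and b: "D_pair M T U b t" and d: "fs d" "elts a \<subseteq> elts d" "elts b \<subseteq> elts d"
  shows "D_compare M T lt a s b t \<longleftrightarrow> tless (cd d) (val a d s) (val b d t)"
proof -
  define c where "c = code (elts a \<union> elts b)"
  have f: "fs a" "fs b" "mem (cd a) s" "mem (cd b) t" using a b by (simp_all add: D_pair_iff)
  have fc: "fin (elts a \<union> elts b)" by (intro fin_Un fin_elts)
  then have c: "elts c = elts a \<union> elts b" by (simp add: c_def)
  have fsc: "fs c" unfolding c_def by (rule fs_code[OF fc]) (use f in \<open>auto simp: fs_def\<close>)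
  have sub: "elts a \<subseteq> elts c" "elts b \<subseteq> elts c" "elts c \<subseteq> elts d" using c d by auto
  note ma = im_morphism[OF f(1) fsc sub(1)] and mb = im_morphism[OF f(2) fsc sub(2)]
  have "D_compare M T lt a s b t \<longleftrightarrow> tless (cd c) (val a c s) (val b c t)"
    unfolding D_compare_def fin_union_iff c_def[symmetric] val_def
    using inclusion_iff[OF f(1) fsc sub(1)] inclusion_iff[OF f(2) fsc sub(2)] act(1)[OF ma f(3)] act(1)[OF mb f(4)]
    by simp
  also have "\<dots> \<longleftrightarrow> tless (cd d) (val a d s) (val b d t)"
    using act_less(1)[OF im_morphism[OF fsc d(1) sub(3)] val_props(1)[OF a fsc sub(1)] val_props(1)[OF b fsc sub(2)]]
      val_comp[OF a fsc d(1) sub(1,3)] val_comp[OF b fsc d(1) sub(2,3)] by simp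
  finally show ?thesis .
qed

lemma D_fs_union:
  assumes "D_pair M T U a s" "D_pair M T U b t" "D_pair M T U c u"
  obtains d where "fs d" "elts a \<subseteq> elts d" "elts b \<subseteq> elts d" "elts c \<subseteq> elts d" "elts d = elts a \<union> elts b \<union> elts c"
proof -
  have f: "fin (elts a \<union> elts b \<union> elts c)" by (intro fin_Un fin_elts)
  have "fs (code (elts a \<union> elts b \<union> elts c))"
    by (rule fs_code[OF f]) (use assms in \<open>auto simp: fs_def D_pair_iff\<close>)
  then show thesis using that elts_code[OF f] by auto
qed

lemma D_irrefl: assumes "D_pair M T U a s" shows "\<not> D_compare M T lt a s a s"
proof -
  obtain d where "fs d" "elts a \<subseteq> elts d" by (rule D_fs_union[OF assms assms assms]) (rule that)
  then show ?thesis using D_compare_iff[OF assms assms] linD(1)[OF tlin val_props(1)[OF assms]] by simp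
qed

lemma D_trans:
  assumes a: "D_pair M T U a s" and b: "D_pair M T U b t" and c: "D_pair M T U c u"
    and "D_compare M T lt a s b t" "D_compare M T lt b t c u"
  shows "D_compare M T lt a s c u"
proof -
  obtain d where d: "fs d" "elts a \<subseteq> elts d" "elts b \<subseteq> elts d" "elts c \<subseteq> elts d"
    by (rule D_fs_union[OF a b c]) (rule that)
  show ?thesis
    using assms(4,5) linD(2)[OF tlin val_props(1)[OF a d(1,2)] val_props(1)[OF b d(1,3)] val_props(1)[OF c d(1,4)]]
    unfolding D_compare_iff[OF a b d(1,2,3)] D_compare_iff[OF b c d(1,3,4)] D_compare_iff[OF a c d(1,2,4)] by blast
qed

lemma D_total:
  assumes a: "D_pair M T U a s" and b: "D_pair M T U b t"
  shows "D_compare M T lt a s b t \<or> (a = b \<and> s = t) \<or> D_compare M T lt b t a s"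
proof -
  obtain d where d: "fs d" "elts a \<subseteq> elts d" "elts b \<subseteq> elts d"
    by (rule D_fs_union[OF a b b]) (rule that)
  have "a = b \<and> s = t" if e: "val a d s = val b d t"
  proof -
    have "elts a = elts b" using val_props(2)[OF a d(1,2)] val_props(2)[OF b d(1,3)] e by simp
    moreover have f: "fs a" "fs b" "mem (cd a) s" "mem (cd b) t" using a b by (simp_all add: D_pair_iff)
    ultimately have ab: "a = b" using elts_eq by (simp add: fs_def)
    then show ?thesis
      using act_less(2)[OF im_morphism[OF f(1) d(1,2)] f(3)] f(4) e unfolding val_def by simp
  qed
  then show ?thesis
    using linD(3)[OF tlin val_props(1)[OF a d(1,2)] val_props(1)[OF b d(1,3)]]
    unfolding D_compare_iff[OF a b d(1,2,3)] D_compare_iff[OF b a d(1,3,2)] by blast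
qed

text \<open>By normality the value \<open>\<mu>(x)\<close> separates \<open>\<langle>b, t\<rangle>\<close> from \<open>\<langle>a, s\<rangle>\<close>.\<close>

lemma D_normal:
  assumes mu: "normal_prae_dilator M T \<mu>"
    and a: "D_pair M T U a s" and b: "D_pair M T U b t"
    and x: "x \<in> elts a" "\<And>y. y \<in> elts b \<Longrightarrow> lt y x"
  shows "D_compare M T lt b t a s"
proof -
  obtain d where d: "fs d" "elts a \<subseteq> elts d" "elts b \<subseteq> elts d"
    by (rule D_fs_union[OF a b b]) (rule that)
  note va = val_props[OF a d(1,2)] and vb = val_props[OF b d(1,3)]
  obtain i where i: "i \<prec> cd d" "en lt d i = x" using enD(2)[OF d(1), of x] x(1) d(2) by blast
  have m1: "\<forall>n m. m \<prec> n \<longrightarrow> (\<exists>!\<sigma>. mu_val M \<mu> n m \<sigma>)"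
    and m2: "\<forall>n m \<sigma>. m \<prec> n \<and> mu_val M \<mu> n m \<sigma> \<longrightarrow> mem n \<sigma>"
    and m3: "\<forall>n m \<sigma> \<rho> a. m \<prec> n \<and> mem n \<sigma> \<and> mu_val M \<mu> n m \<rho> \<and> ts n \<sigma> a \<longrightarrow>
        (tless n \<sigma> \<rho> \<longleftrightarrow> (\<forall>i. fm i a \<longrightarrow> i \<prec> m))"
    using mu[unfolded normal_prae_dilator_def] by simp_all
  obtain \<rho> where r: "mu_val M \<mu> (cd d) i \<rho>" using m1 i(1) by (meson ex1_implies_ex)
  have mr: "mem (cd d) \<rho>" using m2 i(1) r by blast
  have m4: "tless (cd d) w \<rho> \<longleftrightarrow> (\<forall>j\<in>elts (supp (cd d) w). j \<prec> i)" if w: "mem (cd d) w" for w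
  proof -
    have "ts (cd d) w (supp (cd d) w)" by (simp add: supp(1)[OF w])
    from m3[THEN spec, THEN spec, THEN spec, THEN spec, THEN spec, THEN mp, OF conjI[OF i(1) conjI[OF w conjI[OF r this]]]]
    show ?thesis by (simp add: in_elts Ball_def)
  qed
  have "j \<prec> i" if j: "j \<in> elts (supp (cd d) (val b d t))" for j
  proof -
    have "en lt d j \<in> elts b" using vb(2) j by blast
    then show ?thesis using x(2) i enD(5)[OF d(1) supp(3)[OF vb(1) j] i(1)] by auto
  qed
  then have 1: "tless (cd d) (val b d t) \<rho>" using m4[OF vb(1)] by blast
  obtain j where j: "j \<in> elts (supp (cd d) (val a d s))" "en lt d j = x"
    using x(1)[folded va(2)] by (elim imageE) (rule that, simp_all)
  then have "j = i" using enD(4)[OF d(1) supp(3)[OF va(1) j(1)] i(1)] i(2) by simp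
  then have "\<not> tless (cd d) (val a d s) \<rho>" using m4[OF va(1)] j(1) less_irrefl by blast
  then have "tless (cd d) \<rho> (val a d s) \<or> val a d s = \<rho>" using linD(3)[OF tlin mr va(1)] by blast
  then have "tless (cd d) (val b d t) (val a d s)" using 1 linD(2)[OF tlin vb(1) mr va(1)] by auto
  then show ?thesis unfolding D_compare_iff[OF b a d(1,3,2)] .
qed

end

context aca
begin

text \<open>Only the order on the union of \<open>a\<close> and \<open>b\<close> enters, which
  allows the order on terms to be constructed in stages.\<close>

lemma D_compare_cong:
  assumes "\<And>x y. x \<in> elts a \<union> elts b \<Longrightarrow> y \<in> elts a \<union> elts b \<Longrightarrow> lt x y \<longleftrightarrow> lt' x y"
  shows "D_compare M T lt a s b t \<longleftrightarrow> D_compare M T lt' a s b t"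
proof -
  have e: "enumerates M lt c k f \<longleftrightarrow> enumerates M lt' c k f" if "elts c \<subseteq> elts a \<union> elts b" for c k f
  proof -
    have "fin_bij M f k c \<Longrightarrow> fapp M f i x \<Longrightarrow> x \<in> elts c" for i x
      unfolding fin_bij_def fapp_def in_elts by (elim conjE) fastforce
    then show ?thesis unfolding enumerates_def using assms that by blast
  qed
  have "inclusion_morphism M lt x c k n f \<longleftrightarrow> inclusion_morphism M lt' x c k n f"
    if "fin_union M a b c" "elts x \<subseteq> elts a \<union> elts b" for x c k n f
  proof -
    have "elts c \<subseteq> elts a \<union> elts b" using that(1) unfolding fin_union_def by (auto simp: in_elts)
    then show ?thesis unfolding inclusion_morphism_def using e that(2) by simp
  qed
  then show ?thesis unfolding D_compare_def by (simp cong: conj_cong)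
qed

end

section \<open>The term system \<open>Fix(T)\<close>\<close>

context prae
begin

lemma D_pair_mono:
  assumes "D_pair M T V a s" "\<And>x. x \<in> elts a \<Longrightarrow> V x \<Longrightarrow> W x" shows "D_pair M T W a s"
  using assms unfolding D_pair_def in_elts by blast

lemma D_mem_pair[simp]: "D_mem M T X \<langle>a, s\<rangle> \<longleftrightarrow> D_pair M T (\<lambda>x. x \<in> X) a s"
  unfolding D_mem_def by auto

lemma D_less_pair[simp]: "D_less M T R \<langle>a, s\<rangle> \<langle>b, t\<rangle> \<longleftrightarrow> D_compare M T (rel M R) a s b t"
  unfolding D_less_def by auto

lemma elts_less_pair: "x \<in> elts a \<Longrightarrow> x \<prec> \<langle>a, s\<rangle>"
  using lt_le_trans[OF fm_less pair_le1] in_elts by blast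

text \<open>Minimality is applied to those terms of \<open>X\<close> that are properly built from
  members of \<open>X\<close>; they already form a closed set.\<close>

lemma is_Fix_mem:
  assumes "is_Fix M T X" shows "s \<in> X \<longleftrightarrow> D_mem M T X s"
proof
  have X: "X \<in> S" "Fix_closed M T X" "\<And>Y. Y \<in> S \<Longrightarrow> Fix_closed M T Y \<Longrightarrow> X \<subseteq> Y"
    using assms by (simp_all add: is_Fix_def)
  let ?Y = "{s. s \<in> X \<and> D_mem M T X s}"
  have "?Y \<in> S" by (rule setI, intro ari X)
  moreover have "Fix_closed M T ?Y" unfolding Fix_closed_def
  proof (intro allI impI)
    fix a s assume d: "D_pair M T (\<lambda>x. x \<in> ?Y) a s"
    have "D_pair M T (\<lambda>x. x \<in> X) a s" by (rule D_pair_mono[OF d]) blast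
    moreover from this have "xi_term M a s \<in> X" using X(2) unfolding Fix_closed_def by blast
    ultimately show "xi_term M a s \<in> ?Y" by (simp add: xi_term_def)
  qed
  ultimately show "s \<in> X \<Longrightarrow> D_mem M T X s" using X(3) by blast
  show "D_mem M T X s \<Longrightarrow> s \<in> X"
    using X(2) unfolding D_mem_def Fix_closed_def xi_term_def by blast
qed

text \<open>A term is accepted iff some finite set contains it and is closed under immediate
  subterms, an arithmetical condition that replaces inductive generation. Leastness follows by
  induction on codes, as subterms have smaller codes.\<close>

lemma Fix_exists: "\<exists>X. is_Fix M T X"
proof -
  let ?w = "\<lambda>w. \<forall>t\<in>elts w. D_mem M T (elts w) t"
  define X where "X = {s. \<exists>w. s \<in> elts w \<and> ?w w}"
  have XS: "X \<in> S" unfolding X_def by (rule setI, intro ari)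
  have below: "\<exists>a r. t = \<langle>a, r\<rangle> \<and> D_pair M T (\<lambda>x. x \<in> X \<and> x \<prec> t) a r" if t: "t \<in> X" for t
  proof -
    obtain w where w: "t \<in> elts w" "?w w" using t unfolding X_def by blast
    then obtain a r where a: "t = \<langle>a, r\<rangle>" "D_pair M T (\<lambda>x. x \<in> elts w) a r" unfolding D_mem_def by blast
    have "elts w \<subseteq> X" using w(2) unfolding X_def by blast
    then have "D_pair M T (\<lambda>x. x \<in> X \<and> x \<prec> t) a r"
      by (intro D_pair_mono[OF a(2)]) (use a(1) elts_less_pair in auto)
    then show ?thesis using a(1) by blast
  qed
  have "Fix_closed M T X" unfolding Fix_closed_def xi_term_def
  proof (intro allI impI)
    fix a r assume d: "D_pair M T (\<lambda>x. x \<in> X) a r"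
    let ?s = "\<langle>a, r\<rangle>"
    \<comment> \<open>Taking all terms of \<open>X\<close> below \<open>?s\<close> avoids choosing
      and joining witnesses for the single subterms.\<close>
    let ?W = "insert ?s {t. t \<in> X \<and> t \<prec> ?s}"
    have "{t. t \<in> X \<and> t \<prec> ?s} \<in> S" by (rule setI, intro ari XS)
    then have fW: "fin ?W" by (intro fin_insert finI[of _ ?s]) auto
    have "D_mem M T ?W t" if "t \<in> ?W" for t
    proof (cases "t = ?s")
      case True
      have "D_pair M T (\<lambda>x. x \<in> ?W) a r" by (rule D_pair_mono[OF d]) (use elts_less_pair in auto)
      then show ?thesis using True by simp
    next
      case False
      then have t: "t \<in> X" "t \<prec> ?s" using that by auto
      obtain b u where b: "t = \<langle>b, u\<rangle>" "D_pair M T (\<lambda>x. x \<in> X \<and> x \<prec> t) b u" using below[OF t(1)] by blast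
      have "D_pair M T (\<lambda>x. x \<in> ?W) b u" by (rule D_pair_mono[OF b(2)]) (use t(2) less_trans in blast)
      then show ?thesis using b(1) by simp
    qed
    then have "?s \<in> elts (code ?W) \<and> ?w (code ?W)" unfolding elts_code[OF fW] by simp
    then show "?s \<in> X" unfolding X_def by blast
  qed
  moreover have "X \<subseteq> Y" if Y: "Y \<in> S" "Fix_closed M T Y" for Y
  proof -
    have "s \<in> X \<longrightarrow> s \<in> Y" for s
    proof (rule sind[of "\<lambda>s. s \<in> X \<longrightarrow> s \<in> Y"])
      show "ar (\<lambda>e. e 0 \<in> X \<longrightarrow> e 0 \<in> Y)" by (intro ari XS Y)
      fix t assume IH: "\<And>m. m \<prec> t \<Longrightarrow> m \<in> X \<longrightarrow> m \<in> Y"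
      show "t \<in> X \<longrightarrow> t \<in> Y"
      proof
        assume "t \<in> X"
        then obtain a r where a: "t = \<langle>a, r\<rangle>" "D_pair M T (\<lambda>x. x \<in> X \<and> x \<prec> t) a r" using below by blast
        have "D_pair M T (\<lambda>x. x \<in> Y) a r" by (rule D_pair_mono[OF a(2)]) (use IH in blast)
        then show "t \<in> Y" using Y(2) a(1) unfolding Fix_closed_def xi_term_def by blast
      qed
    qed
    then show ?thesis by blast
  qed
  ultimately show ?thesis unfolding is_Fix_def using XS by blast
qed

text \<open>The right-hand side of the recursive clause, with the relation that is to be defined as
  parameter \<open>r\<close>.\<close>

definition cmp where
  "cmp r s t \<longleftrightarrow> lin (\<lambda>x. fm x (pi1 s) \<or> fm x (pi1 t)) r \<and> D_compare M T r (pi1 s) (pi2 s) (pi1 t) (pi2 t)"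

lemma cmp_cong:
  assumes "\<And>x y. x \<in> elts (pi1 s) \<union> elts (pi1 t) \<Longrightarrow> y \<in> elts (pi1 s) \<union> elts (pi1 t) \<Longrightarrow> r x y \<longleftrightarrow> r' x y"
  shows "cmp r s t \<longleftrightarrow> cmp r' s t"
proof -
  have "lin U r'" if "lin U r" "\<And>x y. U x \<Longrightarrow> U y \<Longrightarrow> r x y \<longleftrightarrow> r' x y" for U and r r' :: "'a \<Rightarrow> 'a \<Rightarrow> bool"
    unfolding linear_order_on_class_def
  proof (intro conjI allI impI)
    show "\<not> r' x x" if "U x" for x using linD(1)[OF \<open>lin U r\<close> that] \<open>\<And>x y. U x \<Longrightarrow> U y \<Longrightarrow> r x y \<longleftrightarrow> r' x y\<close>[OF that that] by simp
    show "r' x z" if "U x \<and> U y \<and> U z \<and> r' x y \<and> r' y z" for x y z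
      using linD(2)[OF \<open>lin U r\<close>, of x y z] that \<open>\<And>x y. U x \<Longrightarrow> U y \<Longrightarrow> r x y \<longleftrightarrow> r' x y\<close> by simp
    show "r' x y \<or> x = y \<or> r' y x" if "U x \<and> U y" for x y
      using linD(3)[OF \<open>lin U r\<close>, of x y] that \<open>\<And>x y. U x \<Longrightarrow> U y \<Longrightarrow> r x y \<longleftrightarrow> r' x y\<close> by simp
  qed
  from this[of "\<lambda>x. fm x (pi1 s) \<or> fm x (pi1 t)" r r'] this[of "\<lambda>x. fm x (pi1 s) \<or> fm x (pi1 t)" r' r]
  have "lin (\<lambda>x. fm x (pi1 s) \<or> fm x (pi1 t)) r \<longleftrightarrow> lin (\<lambda>x. fm x (pi1 s) \<or> fm x (pi1 t)) r'"
    using assms by (auto simp: in_elts)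
  then show ?thesis unfolding cmp_def using D_compare_cong[of "pi1 s" "pi1 t" r r'] assms by blast
qed

lemma is_Fix_order_iff:
  assumes X: "is_Fix M T X"
  shows "is_Fix_order M T X R \<longleftrightarrow> R \<in> S \<and> (\<forall>p\<in>R. \<exists>s\<in>X. \<exists>t\<in>X. p = \<langle>s, t\<rangle>) \<and>
    (\<forall>s t. s \<in> X \<longrightarrow> t \<in> X \<longrightarrow> (rel M R s t \<longleftrightarrow> cmp (rel M R) s t))"
proof -
  have p: "\<exists>a r. s = \<langle>a, r\<rangle>" if "s \<in> X" for s
    using that is_Fix_mem[OF X] unfolding D_mem_def by blast
  have "(\<forall>a r b u. \<langle>a, r\<rangle> \<in> X \<and> \<langle>b, u\<rangle> \<in> X \<longrightarrow> (rel M R \<langle>a, r\<rangle> \<langle>b, u\<rangle> \<longleftrightarrow>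
      lin (\<lambda>s. fm s a \<or> fm s b) (rel M R) \<and> D_compare M T (rel M R) a r b u)) \<longleftrightarrow>
    (\<forall>s t. s \<in> X \<longrightarrow> t \<in> X \<longrightarrow> (rel M R s t \<longleftrightarrow> cmp (rel M R) s t))" (is "?l \<longleftrightarrow> ?r")
  proof
    assume l: ?l
    show ?r
    proof (intro allI impI)
      fix s t assume st: "s \<in> X" "t \<in> X"
      obtain a r b u where "s = \<langle>a, r\<rangle>" "t = \<langle>b, u\<rangle>" using p[OF st(1)] p[OF st(2)] by blast
      then show "rel M R s t \<longleftrightarrow> cmp (rel M R) s t" using l st by (simp add: cmp_def)
    qed
  next
    assume r: ?r
    show ?l using r[rule_format, of "\<langle>_, _\<rangle>" "\<langle>_, _\<rangle>"] by (simp add: cmp_def)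
  qed
  then show ?thesis unfolding is_Fix_order_def xi_term_def by blast
qed

lemma ar_cmp:
  assumes "ds R" "df a" "df b" shows "ar (\<lambda>e. cmp (rel M (R e)) (a e) (b e))"
  unfolding cmp_def by (intro ari ar_linear_order_elts assms)

text \<open>The stage \<open>F (n \<oplus> \<one>)\<close> decides all pairs of terms up to
  \<open>n\<close> and looks up their subterms, which are below \<open>n\<close>, in
  \<open>F n\<close>. Later stages agree with earlier ones, so the order can be read off from any
  stage that is large enough.\<close>

lemma Fix_order_exists:
  assumes X: "is_Fix M T X" shows "\<exists>R. is_Fix_order M T X R"
proof -
  have XS: "X \<in> S" using X by (simp add: is_Fix_def)
  define St where "St n r = {p. \<exists>s t. p = \<langle>s, t\<rangle> \<and> s \<prec> n \<oplus> \<one> \<and> t \<prec> n \<oplus> \<one> \<and> s \<in> X \<and> t \<in> X \<and> cmp (rel M (elts r)) s t}" for n r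
  have "df (\<lambda>e. code (St (e (Suc 0)) (e (Suc (Suc 0)))))" unfolding St_def by (intro ari ar_cmp XS)
  then obtain F0 where "df (\<lambda>e. F0 (e 0) (e (Suc 0)))" "\<And>K. F0 K \<zero> = code {}" "\<And>K n. F0 K (n \<oplus> \<one>) = code (St n (F0 K n))"
    by (rule primrec_ex[of "\<lambda>K. code {}" "\<lambda>K n r. code (St n r)", OF df_const]) (rule that)
  then obtain F where F: "df (\<lambda>e. F (e 0))" "F \<zero> = code {}" "\<And>n. F (n \<oplus> \<one>) = code (St n (F n))"
    using df_comp2[of F0 "\<lambda>e. \<zero>" "\<lambda>e. e 0", OF _ df_const df_var] by (intro that[of "F0 \<zero>"]) simp_all
  have fSt: "fin (St n r)" for n r
  proof (rule finI[of _ "\<langle>n \<oplus> \<one>, n \<oplus> \<one>\<rangle>"])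
    show "St n r \<in> S" unfolding St_def by (rule setI, intro ari ar_cmp XS)
  qed (auto simp: St_def simp del: less_succ intro: pair_mono12)
  have memF: "\<langle>s, t\<rangle> \<in> elts (F (n \<oplus> \<one>)) \<longleftrightarrow>
    s \<prec> n \<oplus> \<one> \<and> t \<prec> n \<oplus> \<one> \<and> s \<in> X \<and> t \<in> X \<and> cmp (rel M (elts (F n))) s t" for s t n
  proof -
    have e: "elts (F (n \<oplus> \<one>)) = St n (F n)" by (simp only: F(3) elts_code[OF fSt])
    show ?thesis unfolding e by (auto simp: St_def simp del: less_succ)
  qed
  have subX: "x \<prec> s" if "s \<in> X" "x \<in> elts (pi1 s)" for s x
    using that is_Fix_mem[OF X, of s] elts_less_pair unfolding D_mem_def by auto
  let ?C = "\<lambda>n. \<forall>s t. s \<prec> n \<longrightarrow> t \<prec> n \<longrightarrow> (\<langle>s, t\<rangle> \<in> elts (F n) \<longleftrightarrow> \<langle>s, t\<rangle> \<in> elts (F (n \<oplus> \<one>)))"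
  have C: "?C n" for n
  proof (rule ind[of ?C])
    show "ar (\<lambda>e. ?C (e 0))" by (intro ari df_comp1[OF F(1)])
    show "?C \<zero>" by simp
    fix n assume IH: "?C n"
    show "?C (n \<oplus> \<one>)"
    proof (intro allI impI)
      fix s t assume st: "s \<prec> n \<oplus> \<one>" "t \<prec> n \<oplus> \<one>"
      have "cmp (rel M (elts (F n))) s t \<longleftrightarrow> cmp (rel M (elts (F (n \<oplus> \<one>)))) s t" if "s \<in> X" "t \<in> X"
      proof (rule cmp_cong)
        have "x \<prec> n" if "x \<in> elts (pi1 s) \<union> elts (pi1 t)" for x
          using that subX[OF \<open>s \<in> X\<close>, of x] subX[OF \<open>t \<in> X\<close>, of x] st less_trans by auto
        then show "rel M (elts (F n)) x y \<longleftrightarrow> rel M (elts (F (n \<oplus> \<one>))) x y"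
          if "x \<in> elts (pi1 s) \<union> elts (pi1 t)" "y \<in> elts (pi1 s) \<union> elts (pi1 t)" for x y
          unfolding rel_def using IH that by blast
      qed
      moreover have "s \<prec> n \<oplus> \<one> \<oplus> \<one>" "t \<prec> n \<oplus> \<one> \<oplus> \<one>" using st by simp_all
      ultimately show "\<langle>s, t\<rangle> \<in> elts (F (n \<oplus> \<one>)) \<longleftrightarrow> \<langle>s, t\<rangle> \<in> elts (F (n \<oplus> \<one> \<oplus> \<one>))"
        unfolding memF using st by blast
    qed
  qed
  have C2: "\<langle>s, t\<rangle> \<in> elts (F n) \<longleftrightarrow> \<langle>s, t\<rangle> \<in> elts (F (n \<oplus> d))" if st: "s \<prec> n" "t \<prec> n" for s t n d
  proof (rule ind[of "\<lambda>d. \<langle>s, t\<rangle> \<in> elts (F n) \<longleftrightarrow> \<langle>s, t\<rangle> \<in> elts (F (n \<oplus> d))"])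
    show "ar (\<lambda>e. \<langle>s, t\<rangle> \<in> elts (F n) \<longleftrightarrow> \<langle>s, t\<rangle> \<in> elts (F (n \<oplus> e 0)))" by (intro ari df_comp1[OF F(1)])
    fix d assume "\<langle>s, t\<rangle> \<in> elts (F n) \<longleftrightarrow> \<langle>s, t\<rangle> \<in> elts (F (n \<oplus> d))"
    moreover have "s \<prec> n \<oplus> d" "t \<prec> n \<oplus> d" using st lt_le_trans[OF _ le_add] by blast+
    ultimately show "\<langle>s, t\<rangle> \<in> elts (F n) \<longleftrightarrow> \<langle>s, t\<rangle> \<in> elts (F (n \<oplus> (d \<oplus> \<one>)))"
      using C[of "n \<oplus> d"] by (simp only: bas(4))
  qed simp
  define R where "R = {p. \<exists>s t. p = \<langle>s, t\<rangle> \<and> p \<in> elts (F (s \<oplus> t \<oplus> \<one>))}"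
  have RS: "R \<in> S" unfolding R_def by (rule setI, intro ari df_comp1[OF F(1)])
  have stl: "s \<prec> s \<oplus> t \<oplus> \<one>" "t \<prec> s \<oplus> t \<oplus> \<one>" for s t using le_add[of s t] le_add2[of t s] by auto
  have R: "rel M R s t \<longleftrightarrow> \<langle>s, t\<rangle> \<in> elts (F n)" if "s \<prec> n" "t \<prec> n" for s t n
  proof -
    have "\<langle>s, t\<rangle> \<in> elts (F (s \<oplus> t \<oplus> \<one>)) \<longleftrightarrow> \<langle>s, t\<rangle> \<in> elts (F (n \<oplus> (s \<oplus> t \<oplus> \<one>)))"
      using C2[OF stl(1)[of s t] stl(2)[of t s], of n] by (simp add: add_comm[of n])
    also have "\<dots> \<longleftrightarrow> \<langle>s, t\<rangle> \<in> elts (F n)" using C2[OF that] by blast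
    finally show ?thesis unfolding R_def rel_def by auto
  qed
  have "rel M R s t \<longleftrightarrow> cmp (rel M R) s t" if st: "s \<in> X" "t \<in> X" for s t
  proof -
    have "rel M R s t \<longleftrightarrow> cmp (rel M (elts (F (s \<oplus> t)))) s t"
      unfolding R[OF stl] memF using st stl by blast
    also have "\<dots> \<longleftrightarrow> cmp (rel M R) s t"
    proof (rule cmp_cong)
      have lt: "x \<prec> s \<oplus> t" if "x \<in> elts (pi1 s) \<union> elts (pi1 t)" for x
        using that subX[OF st(1), of x] subX[OF st(2), of x] lt_le_trans[OF _ le_add[of s t]] lt_le_trans[OF _ le_add2[of t s]] by blast
      show "rel M (elts (F (s \<oplus> t))) x y \<longleftrightarrow> rel M R x y"
        if "x \<in> elts (pi1 s) \<union> elts (pi1 t)" "y \<in> elts (pi1 s) \<union> elts (pi1 t)" for x y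
        unfolding R[OF lt[OF that(1)] lt[OF that(2)]] by (simp add: rel_def)
    qed
    finally show ?thesis .
  qed
  moreover have "\<exists>s\<in>X. \<exists>t\<in>X. p = \<langle>s, t\<rangle>" if "p \<in> R" for p
    using that memF unfolding R_def by blast
  ultimately have "is_Fix_order M T X R" unfolding is_Fix_order_iff[OF X] using RS by blast
  then show ?thesis by blast
qed

end

section \<open>Linearity and well-foundedness of \<open>Fix(T)\<close>\<close>

locale fixt = prae +
  fixes X R assumes Fix: "is_Fix M T X" and ord: "is_Fix_order M T X R"
begin

lemma XS: "X \<in> S" using Fix by (simp add: is_Fix_def)

lemma RS: "R \<in> S" and R_iff: "s \<in> X \<Longrightarrow> t \<in> X \<Longrightarrow> rel M R s t \<longleftrightarrow> cmp (rel M R) s t"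
  using ord[unfolded is_Fix_order_iff[OF Fix]] by blast+

lemma X_pair: assumes "s \<in> X" obtains a r where "s = \<langle>a, r\<rangle>" "D_pair M T (\<lambda>x. x \<in> X) a r"
  using is_Fix_mem[OF Fix, THEN iffD1, OF assms] unfolding D_mem_def by (elim exE conjE) (rule that)

text \<open>The subterms of a term below \<open>n \<oplus> \<one>\<close> are below
  \<open>n\<close>, where linearity is known by induction. Hence the first condition in
  \<open>cmp\<close> is satisfied, and the laws of \<open>D_compare\<close> carry over to
  terms.\<close>

lemma lin_below: "lin (\<lambda>s. s \<in> X \<and> s \<prec> n) (rel M R)"
proof (rule ind[of "\<lambda>n. lin (\<lambda>s. s \<in> X \<and> s \<prec> n) (rel M R)"])
  show "ar (\<lambda>e. lin (\<lambda>s. s \<in> X \<and> s \<prec> e 0) (rel M R))"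
    unfolding linear_order_on_class_def by (intro ari XS RS)
  show "lin (\<lambda>s. s \<in> X \<and> s \<prec> \<zero>) (rel M R)" by (simp add: linear_order_on_class_def)
  fix n assume l: "lin (\<lambda>s. s \<in> X \<and> s \<prec> n) (rel M R)"
  interpret dorder M T "\<lambda>s. s \<in> X \<and> s \<prec> n" "rel M R"
    by unfold_locales (fact l, intro ari RS)
  have p: "\<exists>a r. s = \<langle>a, r\<rangle> \<and> D_pair M T (\<lambda>s. s \<in> X \<and> s \<prec> n) a r" if s: "s \<in> X \<and> s \<prec> n \<oplus> \<one>" for s
  proof -
    obtain a r where a: "s = \<langle>a, r\<rangle>" "D_pair M T (\<lambda>x. x \<in> X) a r" using s by (elim conjE X_pair)
    have "D_pair M T (\<lambda>s. s \<in> X \<and> s \<prec> n) a r"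
      by (rule D_pair_mono[OF a(2)]) (use s elts_less_pair[of _ a r] less_trans a(1) in auto)
    then show ?thesis using a(1) by blast
  qed
  have r: "rel M R \<langle>a, r\<rangle> \<langle>b, u\<rangle> \<longleftrightarrow> D_compare M T (rel M R) a r b u"
    if "\<langle>a, r\<rangle> \<in> X" "\<langle>b, u\<rangle> \<in> X" and d: "D_pair M T (\<lambda>s. s \<in> X \<and> s \<prec> n) a r" "D_pair M T (\<lambda>s. s \<in> X \<and> s \<prec> n) b u" for a r b u
  proof -
    have "lin (\<lambda>x. fm x a \<or> fm x b) (rel M R)"
      by (rule lin_subset[OF l]) (use d in \<open>auto simp: D_pair_iff fs_def in_elts\<close>)
    then show ?thesis unfolding R_iff[OF that(1,2)] by (simp add: cmp_def)
  qed
  show "lin (\<lambda>s. s \<in> X \<and> s \<prec> n \<oplus> \<one>) (rel M R)"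
    unfolding linear_order_on_class_def
  proof (intro conjI allI impI)
    fix x assume x: "x \<in> X \<and> x \<prec> n \<oplus> \<one>"
    obtain a r where a: "x = \<langle>a, r\<rangle>" "D_pair M T (\<lambda>s. s \<in> X \<and> s \<prec> n) a r" using p[OF x] by blast
    show "\<not> rel M R x x" using r[OF _ _ a(2) a(2)] x a(1) D_irrefl[OF a(2)] by simp
    fix y assume "x \<in> X \<and> x \<prec> n \<oplus> \<one> \<and> y \<in> X \<and> y \<prec> n \<oplus> \<one>"
  next
    fix x y assume xy: "(x \<in> X \<and> x \<prec> n \<oplus> \<one>) \<and> (y \<in> X \<and> y \<prec> n \<oplus> \<one>)"
    obtain a r b u where a: "x = \<langle>a, r\<rangle>" "D_pair M T (\<lambda>s. s \<in> X \<and> s \<prec> n) a r"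
      "y = \<langle>b, u\<rangle>" "D_pair M T (\<lambda>s. s \<in> X \<and> s \<prec> n) b u" using p[of x] p[of y] xy by blast
    show "rel M R x y \<or> x = y \<or> rel M R y x"
      using r[OF _ _ a(2,4)] r[OF _ _ a(4,2)] xy a(1,3) D_total[OF a(2,4)] by auto
  next
    fix x y z assume xy: "(x \<in> X \<and> x \<prec> n \<oplus> \<one>) \<and> (y \<in> X \<and> y \<prec> n \<oplus> \<one>) \<and> (z \<in> X \<and> z \<prec> n \<oplus> \<one>) \<and> rel M R x y \<and> rel M R y z"
    obtain a r b u c v where a: "x = \<langle>a, r\<rangle>" "D_pair M T (\<lambda>s. s \<in> X \<and> s \<prec> n) a r"
      "y = \<langle>b, u\<rangle>" "D_pair M T (\<lambda>s. s \<in> X \<and> s \<prec> n) b u"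
      "z = \<langle>c, v\<rangle>" "D_pair M T (\<lambda>s. s \<in> X \<and> s \<prec> n) c v" using p[of x] p[of y] p[of z] xy by blast
    show "rel M R x z"
      using r[OF _ _ a(2,4)] r[OF _ _ a(4,6)] r[OF _ _ a(2,6)] xy a(1,3,5) D_trans[OF a(2,4,6)] by auto
  qed
qed

lemma linX: "lin (\<lambda>s. s \<in> X) (rel M R)"
proof -
  have b: "x \<prec> x \<oplus> y \<oplus> z \<oplus> \<one>" "y \<prec> x \<oplus> y \<oplus> z \<oplus> \<one>" "z \<prec> x \<oplus> y \<oplus> z \<oplus> \<one>" for x y z
  proof -
    have l: "x \<oplus> y \<preceq> x \<oplus> y \<oplus> z" "z \<preceq> x \<oplus> y \<oplus> z" by (rule le_add le_add2)+
    show "x \<prec> x \<oplus> y \<oplus> z \<oplus> \<one>" unfolding less_succ by (rule le_trans[OF le_add l(1)])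
    show "y \<prec> x \<oplus> y \<oplus> z \<oplus> \<one>" unfolding less_succ by (rule le_trans[OF le_add2 l(1)])
    show "z \<prec> x \<oplus> y \<oplus> z \<oplus> \<one>" unfolding less_succ by (rule l(2))
  qed
  show ?thesis unfolding linear_order_on_class_def
  proof (intro conjI allI impI)
    fix x assume "x \<in> X"
    then show "\<not> rel M R x x" using linD(1)[OF lin_below, of x "x \<oplus> \<one>"] by simp
  next
    fix x y z assume "x \<in> X \<and> y \<in> X \<and> z \<in> X \<and> rel M R x y \<and> rel M R y z"
    then show "rel M R x z" using linD(2)[OF lin_below, of x "x \<oplus> y \<oplus> z \<oplus> \<one>" y z] b(1)[of x y z] b(2)[of y x z] b(3)[of z x y] by simp
  next
    fix x y assume "x \<in> X \<and> y \<in> X"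
    then show "rel M R x y \<or> x = y \<or> rel M R y x"
      using linD(3)[OF lin_below, of x "x \<oplus> y \<oplus> y \<oplus> \<one>" y] b(1)[of x y y] b(2)[of y x y] by simp
  qed
qed

sublocale dorder M T "\<lambda>s. s \<in> X" "rel M R"
  by unfold_locales (fact linX, intro ari RS)

lemma R_D_less: assumes "s \<in> X" "t \<in> X" shows "rel M R s t \<longleftrightarrow> D_less M T R s t"
proof -
  obtain a r where a: "s = \<langle>a, r\<rangle>" "D_pair M T (\<lambda>x. x \<in> X) a r" using assms(1) by (rule X_pair)
  obtain b u where b: "t = \<langle>b, u\<rangle>" "D_pair M T (\<lambda>x. x \<in> X) b u" using assms(2) by (rule X_pair)
  have "lin (\<lambda>x. fm x a \<or> fm x b) (rel M R)"
    by (rule lin_subset[OF linX]) (use a b in \<open>auto simp: D_pair_iff fs_def in_elts\<close>)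
  then show ?thesis unfolding R_iff[OF assms] using a(1) b(1) by (simp add: cmp_def)
qed

lemma fixed_point: "fixed_point M T X R {p. \<exists>d. p = \<langle>d, d\<rangle>}"
proof -
  have S: "{p. \<exists>d. p = \<langle>d, d\<rangle>} \<in> S" by (rule setI, intro ari)
  have e: "rel M {p. \<exists>d. p = \<langle>d, d\<rangle>} d x \<longleftrightarrow> x = d" for d x by (auto simp: rel_def)
  show ?thesis unfolding fixed_point_def e linear_order_set_def
    using XS RS linX S is_Fix_mem[OF Fix] R_D_less by auto
qed

end

context aca
begin

text \<open>The slices of \<open>A\<close> serve as a sequence of orders. As
  \<open>Pi11_induction\<close> speaks about formulas, their well-foundedness is written out as a
  concrete formula with one leading set quantifier.\<close>

lemma Pi11_wf_induct:
  assumes Pi: "Pi11_induction M" and S: "A \<in> S" "R \<in> S"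
    and 0: "well_founded_on_class M (\<lambda>x. \<langle>\<zero>, x\<rangle> \<in> A) (rel M R)"
    and step: "\<And>n. well_founded_on_class M (\<lambda>x. \<langle>n, x\<rangle> \<in> A) (rel M R) \<Longrightarrow>
      well_founded_on_class M (\<lambda>x. \<langle>n \<oplus> \<one>, x\<rangle> \<in> A) (rel M R)"
  shows "well_founded_on_class M (\<lambda>x. \<langle>n, x\<rangle> \<in> A) (rel M R)"
proof -
  define P where "P s t = Add (Mul (Add s t) (Add s t)) s" for s t
  have P: "term_value M e (P s t) = \<langle>term_value M e s, term_value M e t\<rangle>" for e s t
    by (simp add: P_def pair_def)
  define I where "I p q = Neg (Conj p (Neg q))" for p q
  have I: "satisfies M e E (I p q) \<longleftrightarrow> (satisfies M e E p \<longrightarrow> satisfies M e E q)" for e E p q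
    by (simp add: I_def)
  define V where "V = NumVar"
  have V: "term_value M e (V i) = e i" for e i by (simp add: V_def)
  \<comment> \<open>Set variable \<open>0\<close> is the quantified sequence, \<open>1\<close>
    stands for \<open>A\<close> and \<open>2\<close> for \<open>R\<close>; number variable
    \<open>0\<close> is the index of the slice.\<close>
  define q where "q = Neg (Conj (AllNum 1 (Neg (AllNum 2 (Neg (Mem (P (V 1) (V 2)) 0)))))
    (Conj (AllNum 1 (AllNum 2 (AllNum 3 (I (Mem (P (V 1) (V 2)) 0) (I (Mem (P (V 1) (V 3)) 0) (Eq (V 2) (V 3)))))))
    (Conj (AllNum 1 (AllNum 2 (I (Mem (P (V 1) (V 2)) 0) (Mem (P (V 0) (V 2)) 1))))
      (AllNum 1 (AllNum 2 (AllNum 3 (I (Mem (P (V 1) (V 2)) 0)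
        (I (Mem (P (Add (V 1) One) (V 3)) 0) (Mem (P (V 3) (V 2)) 2)))))))))"
  define E where "E i = (if i = 1 then A else R)" for i :: nat
  have ar: "arithmetical q" by (simp add: q_def I_def)
  have sat: "satisfies M ((\<lambda>_. \<zero>)(0 := n)) E (AllSet 0 q) \<longleftrightarrow>
    well_founded_on_class M (\<lambda>x. \<langle>n, x\<rangle> \<in> A) (rel M R)" for n
  proof -
    have "satisfies M ((\<lambda>_. \<zero>)(0 := n)) (E(0 := F)) q \<longleftrightarrow>
      \<not> ((\<forall>n. \<exists>!x. \<langle>n, x\<rangle> \<in> F) \<and> (\<forall>m x. \<langle>m, x\<rangle> \<in> F \<longrightarrow> \<langle>n, x\<rangle> \<in> A) \<and>
      (\<forall>n x y. \<langle>n, x\<rangle> \<in> F \<and> \<langle>n \<oplus> \<one>, y\<rangle> \<in> F \<longrightarrow> rel M R y x))" for F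
    proof -
      have "(\<forall>n. \<exists>!x. \<langle>n, x\<rangle> \<in> F) \<longleftrightarrow>
        (\<forall>n. \<exists>x. \<langle>n, x\<rangle> \<in> F) \<and> (\<forall>n x y. \<langle>n, x\<rangle> \<in> F \<longrightarrow> \<langle>n, y\<rangle> \<in> F \<longrightarrow> x = y)" by (metis (mono_tags, lifting))
      then show ?thesis unfolding q_def by (simp add: P I V E_def rel_def)
    qed
    then show ?thesis by (simp add: well_founded_on_class_def)
  qed
  have "\<forall>n. satisfies M ((\<lambda>_. \<zero>)(0 := n)) E (AllSet 0 q)"
    using Pi[unfolded Pi11_induction_def, THEN spec, THEN spec, THEN spec, THEN spec, of "AllSet 0 q" E "\<lambda>_. \<zero>" 0]
      ar 0 step S unfolding sat by (auto simp: Pi11_formula_def E_def)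
  then show ?thesis unfolding sat by blast
qed

end

context fixt
begin

lemma Fix_wf:
  assumes Pi: "Pi11_induction M" and norm: "normal_prae_dilator M T \<mu>" and dil: "coded_dilator M T"
  shows "well_founded_set M X R"
proof -
  let ?r = "rel M R"
  define U where "U n = {s. s \<in> X \<and> (\<exists>t. t \<in> X \<and> t \<prec> n \<and> (s = t \<or> ?r s t))}" for n
  have US: "U n \<in> S" for n unfolding U_def by (rule setI, intro ari XS RS)
  have UX: "U n \<subseteq> X" for n by (auto simp: U_def)
  have tr: "?r x z" if "?r x y" "?r y z" "x \<in> X" "y \<in> X" "z \<in> X" for x y z
    using linD(2)[OF linX] that by blast
  have down: "s \<in> U n" if "t \<in> U n" "?r s t" "s \<in> X" for s t n
    using that tr unfolding U_def by blast
  define A where "A = {p. \<exists>n s. p = \<langle>n, s\<rangle> \<and> s \<in> U n}"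
  have AS: "A \<in> S" unfolding A_def U_def by (rule setI, intro ari XS RS)
  have A: "\<langle>n, s\<rangle> \<in> A \<longleftrightarrow> s \<in> U n" for n s by (auto simp: A_def)
  have D: "D_mem M T (U n) s" if s: "s \<in> U (n \<oplus> \<one>)" for s n
  proof -
    have sX: "s \<in> X" using s UX by blast
    obtain t where t: "t \<in> X" "t \<prec> n \<oplus> \<one>" "s = t \<or> ?r s t" using s by (auto simp: U_def)
    obtain b u where b: "t = \<langle>b, u\<rangle>" "D_pair M T (\<lambda>x. x \<in> X) b u" using t(1) by (rule X_pair)
    obtain a r where a: "s = \<langle>a, r\<rangle>" "D_pair M T (\<lambda>x. x \<in> X) a r" using sX by (rule X_pair)
    have bU: "x \<in> U n" if "x \<in> elts b" for x
    proof -
      have "x \<prec> n" using elts_less_pair[OF that, of u] t(2) b(1) less_trans by auto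
      moreover have "x \<in> X" using b(2) that by (auto simp: D_pair_iff fs_def)
      ultimately show ?thesis by (auto simp: U_def)
    qed
    \<comment> \<open>A subterm of \<open>s\<close> outside the initial segment \<open>U n\<close>
      lies above all subterms of \<open>t\<close>. By normality \<open>s\<close> would then exceed
      \<open>t\<close>.\<close>
    have "z \<in> U n" if z: "z \<in> elts a" for z
    proof (rule ccontr)
      assume zU: "z \<notin> U n"
      have zX: "z \<in> X" using a(2) z by (auto simp: D_pair_iff fs_def)
      have "?r y z" if "y \<in> elts b" for y
        using bU[OF that] zU down[of y n z] linD(3)[OF linX zX, of y] zX UX by blast
      from D_normal[OF norm a(2) b(2) z this] have "?r t s"
        using R_D_less[OF t(1) sX] a(1) b(1) by simp
      moreover from t(3) have "s = t \<or> ?r s t" .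
      ultimately show False using linD(1)[OF linX t(1)] tr[OF _ _ t(1) sX t(1)] by blast
    qed
    then have "D_pair M T (\<lambda>x. x \<in> U n) a r" by (intro D_pair_mono[OF a(2)]) blast
    then show ?thesis using a(1) by simp
  qed
  have W: "well_founded_on_class M (\<lambda>x. \<langle>n, x\<rangle> \<in> A) ?r" for n
  proof (rule Pi11_wf_induct[OF Pi AS RS])
    show "well_founded_on_class M (\<lambda>x. \<langle>\<zero>, x\<rangle> \<in> A) ?r"
      unfolding well_founded_on_class_def A U_def by auto
    fix n assume "well_founded_on_class M (\<lambda>x. \<langle>n, x\<rangle> \<in> A) ?r"
    then have "well_order_set M (U n) R"
      unfolding well_order_set_def linear_order_set_def well_founded_set_def A
      using US RS lin_subset[OF linX, of "\<lambda>x. x \<in> U n"] UX by auto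
    then have w: "well_founded_on_class M (D_mem M T (U n)) (D_less M T R)"
      using dil US RS unfolding coded_dilator_def by blast
    show "well_founded_on_class M (\<lambda>x. \<langle>n \<oplus> \<one>, x\<rangle> \<in> A) ?r"
      unfolding well_founded_on_class_def A
    proof
      assume "\<exists>F\<in>S. (\<forall>n. \<exists>!x. \<langle>n, x\<rangle> \<in> F) \<and> (\<forall>k x. \<langle>k, x\<rangle> \<in> F \<longrightarrow> x \<in> U (n \<oplus> \<one>)) \<and>
        (\<forall>n x y. \<langle>n, x\<rangle> \<in> F \<and> \<langle>n \<oplus> \<one>, y\<rangle> \<in> F \<longrightarrow> ?r y x)"
      then obtain F where F: "F \<in> S" "\<forall>n. \<exists>!x. \<langle>n, x\<rangle> \<in> F" "\<And>k x. \<langle>k, x\<rangle> \<in> F \<Longrightarrow> x \<in> U (n \<oplus> \<one>)"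
        "\<And>n x y. \<langle>n, x\<rangle> \<in> F \<Longrightarrow> \<langle>n \<oplus> \<one>, y\<rangle> \<in> F \<Longrightarrow> ?r y x" by auto
      have "\<forall>n x y. \<langle>n, x\<rangle> \<in> F \<and> \<langle>n \<oplus> \<one>, y\<rangle> \<in> F \<longrightarrow> D_less M T R y x"
        using F(4) R_D_less F(3) UX by blast
      moreover have "\<forall>k x. \<langle>k, x\<rangle> \<in> F \<longrightarrow> D_mem M T (U n) x" using F(3) D by blast
      ultimately show False using w F(1,2) unfolding well_founded_on_class_def by blast
    qed
  qed
  show ?thesis unfolding well_founded_set_def well_founded_on_class_def
  proof
    assume "\<exists>F\<in>S. (\<forall>n. \<exists>!x. \<langle>n, x\<rangle> \<in> F) \<and> (\<forall>k x. \<langle>k, x\<rangle> \<in> F \<longrightarrow> x \<in> X) \<and>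
        (\<forall>n x y. \<langle>n, x\<rangle> \<in> F \<and> \<langle>n \<oplus> \<one>, y\<rangle> \<in> F \<longrightarrow> ?r y x)"
    then obtain F where F: "F \<in> S" "\<forall>n. \<exists>!x. \<langle>n, x\<rangle> \<in> F" "\<And>k x. \<langle>k, x\<rangle> \<in> F \<Longrightarrow> x \<in> X"
        "\<And>n x y. \<langle>n, x\<rangle> \<in> F \<Longrightarrow> \<langle>n \<oplus> \<one>, y\<rangle> \<in> F \<Longrightarrow> ?r y x" by auto
    \<comment> \<open>A descending sequence never rises above its first element \<open>x0\<close>,
      so it stays inside \<open>U (x0 \<oplus> \<one>)\<close>.\<close>
    obtain x0 where x0: "\<langle>\<zero>, x0\<rangle> \<in> F" using F(2) by (meson ex1_implies_ex)
    have "\<forall>x. \<langle>k, x\<rangle> \<in> F \<longrightarrow> x = x0 \<or> ?r x x0" for k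
    proof (rule ind[of "\<lambda>k. \<forall>x. \<langle>k, x\<rangle> \<in> F \<longrightarrow> x = x0 \<or> ?r x x0"])
      show "ar (\<lambda>e. \<forall>x. \<langle>e 0, x\<rangle> \<in> F \<longrightarrow> x = x0 \<or> ?r x x0)" by (intro ari F(1) RS)
      have "x = x0" if "\<langle>\<zero>, x\<rangle> \<in> F" for x using spec[OF F(2), of \<zero>] x0 that by blast
      then show "\<forall>x. \<langle>\<zero>, x\<rangle> \<in> F \<longrightarrow> x = x0 \<or> ?r x x0" by blast
      fix k assume IH: "\<forall>x. \<langle>k, x\<rangle> \<in> F \<longrightarrow> x = x0 \<or> ?r x x0"
      obtain y where y: "\<langle>k, y\<rangle> \<in> F" using F(2) by (meson ex1_implies_ex)
      show "\<forall>x. \<langle>k \<oplus> \<one>, x\<rangle> \<in> F \<longrightarrow> x = x0 \<or> ?r x x0"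
        using F(4)[OF y] IH y F(3)[OF y] F(3)[OF x0] F(3) tr by blast
    qed
    then have "\<langle>x0 \<oplus> \<one>, x\<rangle> \<in> A" if "\<langle>k, x\<rangle> \<in> F" for k x
      unfolding A U_def using that F(3)[OF that] F(3)[OF x0] lt_succ_self[of x0] by blast
    then have "\<exists>F\<in>S. (\<forall>n. \<exists>!x. \<langle>n, x\<rangle> \<in> F) \<and> (\<forall>k x. \<langle>k, x\<rangle> \<in> F \<longrightarrow> \<langle>x0 \<oplus> \<one>, x\<rangle> \<in> A) \<and>
        (\<forall>n x y. \<langle>n, x\<rangle> \<in> F \<and> \<langle>n \<oplus> \<one>, y\<rangle> \<in> F \<longrightarrow> ?r y x)"
      using F(4) by (intro bexI[OF _ F(1)] conjI F(2)) blast+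
    then show False using W[of "x0 \<oplus> \<one>"] unfolding well_founded_on_class_def by (rule notE[rotated])
  qed
qed

end

context aca
begin

lemma fix_of_prae: "aca M \<Longrightarrow> coded_prae_dilator M T \<Longrightarrow> is_Fix M T X \<Longrightarrow> is_Fix_order M T X R \<Longrightarrow> fixt M T X R"
  by (simp add: fixt_def prae_def prae_axioms_def fixt_axioms_def)

lemma normalD: "normal_dilator M T \<mu> \<Longrightarrow> normal_prae_dilator M T \<mu> \<and> coded_dilator M T \<and> coded_prae_dilator M T"
  by (simp add: normal_dilator_def coded_dilator_def)

lemma Fix_imp_fixed_point:
  assumes "Fix_of_every_normal_dilator_well_founded M" shows "every_normal_dilator_has_wf_fixed_point M"
  unfolding every_normal_dilator_has_wf_fixed_point_def
proof (intro allI impI)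
  fix T \<mu> assume n: "normal_dilator M T \<mu>"
  then obtain X R where X: "is_Fix M T X" "is_Fix_order M T X R" "well_founded_set M X R"
    using assms unfolding Fix_of_every_normal_dilator_well_founded_def Fix_well_founded_def by blast
  interpret fixt M T X R by (rule fix_of_prae[OF aca_axioms _ X(1,2)]) (use normalD[OF n] in blast)
  show "\<exists>X R \<xi>. fixed_point M T X R \<xi> \<and> well_founded_set M X R" using fixed_point X(3) by blast
qed

lemma Pi11_imp_Fix:
  assumes "Pi11_induction M" shows "Fix_of_every_normal_dilator_well_founded M"
  unfolding Fix_of_every_normal_dilator_well_founded_def Fix_well_founded_def
proof (intro allI impI)
  fix T \<mu> assume n: "normal_dilator M T \<mu>"
  note nd = normalD[OF n]
  interpret prae M T by unfold_locales (use nd in blast)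
  obtain X R where X: "is_Fix M T X" "is_Fix_order M T X R" using Fix_exists Fix_order_exists by blast
  interpret fixt M T X R by unfold_locales (fact X)+
  show "\<exists>X R. is_Fix M T X \<and> is_Fix_order M T X R \<and> well_founded_set M X R"
    using X Fix_wf[OF assms] nd by blast
qed

end

section \<open>A normal form for arithmetical formulas\<close>

text \<open>\<open>evid M i E p b e X f m\<close> says that the values \<open>f 0, \<dots>, f (m - 1)\<close> and \<open>X \<inter> m\<close> do not refute
  the claim that \<open>f\<close> is a Skolem function witnessing that the truth value of \<open>p\<close> is \<open>b\<close>.\<close>

primrec evid :: "'a l2_structure \<Rightarrow> nat \<Rightarrow> (nat \<Rightarrow> 'a set) \<Rightarrow> l2_formula \<Rightarrow> bool \<Rightarrow> (nat \<Rightarrow> 'a) \<Rightarrow> 'a set \<Rightarrow>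
    ('a \<Rightarrow> 'a) \<Rightarrow> 'a \<Rightarrow> bool" where
  "evid M i E (Eq s t) b e X f m \<longleftrightarrow> (term_value M e s = term_value M e t) = b"
| "evid M i E (Less s t) b e X f m \<longleftrightarrow> less_of M (term_value M e s) (term_value M e t) = b"
| "evid M i E (Mem t j) b e X f m \<longleftrightarrow>
    (if j = i then less_of M (term_value M e t) m \<longrightarrow> (term_value M e t \<in> X) = b else (term_value M e t \<in> E j) = b)"
| "evid M i E (Neg p) b e X f m \<longleftrightarrow> evid M i E p (\<not> b) e X f m"
| "evid M i E (Conj p q) b e X f m \<longleftrightarrow>
    (if b then \<forall>k. (less_of M k m \<or> k = m) \<longrightarrow>
        ((\<forall>j. less_of M j k \<longrightarrow> less_of M (pair M (zero_of M) j) m) \<longrightarrow>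
          evid M i E p b e X (\<lambda>j. f (pair M (zero_of M) j)) k) \<and>
        ((\<forall>j. less_of M j k \<longrightarrow> less_of M (pair M (one_of M) j) m) \<longrightarrow>
          evid M i E q b e X (\<lambda>j. f (pair M (one_of M) j)) k)
     else \<forall>k. add_of M k (one_of M) = m \<longrightarrow>
        (f (zero_of M) = zero_of M \<longrightarrow> evid M i E p b e X (\<lambda>j. f (add_of M j (one_of M))) k) \<and>
        (f (zero_of M) \<noteq> zero_of M \<longrightarrow> evid M i E q b e X (\<lambda>j. f (add_of M j (one_of M))) k))"
| "evid M i E (AllNum x p) b e X f m \<longleftrightarrow>
    (if b then \<forall>a k. (less_of M k m \<or> k = m) \<longrightarrow> (\<forall>j. less_of M j k \<longrightarrow> less_of M (pair M a j) m) \<longrightarrow>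
        evid M i E p b (e(x := a)) X (\<lambda>j. f (pair M a j)) k
     else \<forall>k. add_of M k (one_of M) = m \<longrightarrow>
        evid M i E p b (e(x := f (zero_of M))) X (\<lambda>j. f (add_of M j (one_of M))) k)"
| "evid M i E (AllSet j p) b e X f m \<longleftrightarrow> True"

context aca
begin

text \<open>The positive clauses for \<open>Conj\<close> and \<open>AllNum\<close> are designed for
  this locality: a component is judged at length \<open>k\<close> only if all pairs that code its
  first \<open>k\<close> values are below \<open>m\<close>.\<close>

lemma evid_cong:
  assumes "\<And>j. j \<prec> m \<Longrightarrow> f j = f' j" "\<And>j. j \<prec> m \<Longrightarrow> j \<in> X \<longleftrightarrow> j \<in> X'"
  shows "evid M i E p b e X f m \<longleftrightarrow> evid M i E p b e X' f' m"
  using assms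
proof (induction p arbitrary: b e f f' m)
  case (Conj p q)
  show ?case
  proof (cases b)
    case True
    have "evid M i E p b e X (\<lambda>j. f \<langle>c, j\<rangle>) k \<longleftrightarrow> evid M i E p b e X' (\<lambda>j. f' \<langle>c, j\<rangle>) k"
      "evid M i E q b e X (\<lambda>j. f \<langle>c, j\<rangle>) k \<longleftrightarrow> evid M i E q b e X' (\<lambda>j. f' \<langle>c, j\<rangle>) k"
      if "k \<preceq> m" "\<forall>j. j \<prec> k \<longrightarrow> \<langle>c, j\<rangle> \<prec> m" for k c
      by (rule Conj.IH; use Conj.prems that lt_le_trans in simp)+
    then show ?thesis using True by (simp cong: imp_cong conj_cong)
  next
    case False
    have "evid M i E p b e X (\<lambda>j. f (j \<oplus> \<one>)) k \<longleftrightarrow> evid M i E p b e X' (\<lambda>j. f' (j \<oplus> \<one>)) k"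
      "evid M i E q b e X (\<lambda>j. f (j \<oplus> \<one>)) k \<longleftrightarrow> evid M i E q b e X' (\<lambda>j. f' (j \<oplus> \<one>)) k"
      "f \<zero> = f' \<zero>" if k: "k \<oplus> \<one> = m" for k
    proof -
      have a: "f (j \<oplus> \<one>) = f' (j \<oplus> \<one>)" "j \<in> X \<longleftrightarrow> j \<in> X'" if "j \<prec> k" for j
        using Conj.prems(1)[of "j \<oplus> \<one>"] Conj.prems(2)[of j] that k succ_less[of j k] less_succ[of j k] by auto
      show "evid M i E p b e X (\<lambda>j. f (j \<oplus> \<one>)) k \<longleftrightarrow> evid M i E p b e X' (\<lambda>j. f' (j \<oplus> \<one>)) k"
        by (rule Conj.IH(1)) (fact a)+
      show "evid M i E q b e X (\<lambda>j. f (j \<oplus> \<one>)) k \<longleftrightarrow> evid M i E q b e X' (\<lambda>j. f' (j \<oplus> \<one>)) k"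
        by (rule Conj.IH(2)) (fact a)+
      show "f \<zero> = f' \<zero>" using Conj.prems(1)[of \<zero>] zero_less_succ[of k] k by simp
    qed
    then show ?thesis using False by (simp cong: imp_cong)
  qed
next
  case (AllNum x p)
  show ?case
  proof (cases b)
    case True
    have "evid M i E p b (e(x := c)) X (\<lambda>j. f \<langle>c, j\<rangle>) k \<longleftrightarrow> evid M i E p b (e(x := c)) X' (\<lambda>j. f' \<langle>c, j\<rangle>) k"
      if "k \<preceq> m" "\<forall>j. j \<prec> k \<longrightarrow> \<langle>c, j\<rangle> \<prec> m" for k c
      by (rule AllNum.IH; use AllNum.prems that lt_le_trans in simp)
    then show ?thesis using True by (simp cong: imp_cong)
  next
    case False
    have "evid M i E p b (e(x := c)) X (\<lambda>j. f (j \<oplus> \<one>)) k \<longleftrightarrow> evid M i E p b (e(x := c)) X' (\<lambda>j. f' (j \<oplus> \<one>)) k"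
      "f \<zero> = f' \<zero>" if k: "k \<oplus> \<one> = m" for k c
    proof -
      have a: "f (j \<oplus> \<one>) = f' (j \<oplus> \<one>)" "j \<in> X \<longleftrightarrow> j \<in> X'" if "j \<prec> k" for j
        using AllNum.prems(1)[of "j \<oplus> \<one>"] AllNum.prems(2)[of j] that k succ_less[of j k] less_succ[of j k] by auto
      show "evid M i E p b (e(x := c)) X (\<lambda>j. f (j \<oplus> \<one>)) k \<longleftrightarrow> evid M i E p b (e(x := c)) X' (\<lambda>j. f' (j \<oplus> \<one>)) k"
        by (rule AllNum.IH) (fact a)+
      show "f \<zero> = f' \<zero>" using AllNum.prems(1)[of \<zero>] zero_less_succ[of k] k by simp
    qed
    then show ?thesis using False by (simp cong: imp_cong)
  qed
qed auto

text \<open>In a positive clause, evidence of length \<open>k\<close> for the component with index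
  \<open>a\<close> is found at length \<open>\<langle>a, k\<rangle>\<close>, because
  \<open>\<langle>a, j\<rangle>\<close> is smaller for all \<open>j \<prec> k\<close>. In a negative
  clause \<open>f \<zero>\<close> selects a failing conjunct or a counterexample, and the shifted
  function continues.\<close>

lemma evid_sound:
  "arithmetical p \<Longrightarrow> (\<And>m. evid M i E p b e X f m) \<Longrightarrow> satisfies M e (E(i := X)) p = b"
proof (induction p arbitrary: b e f)
  case (Mem t j)
  show ?case using Mem(2)[of "term_value M e t \<oplus> \<one>"] by (auto split: if_splits)
next
  case (Neg p)
  have "satisfies M e (E(i := X)) p = (\<not> b)" by (rule Neg.IH[of _ _ f]) (use Neg.prems in auto)
  then show ?case by (simp del: fun_upd_apply)
next
  case (Conj p q)
  show ?case
  proof (cases b)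
    case True
    have "satisfies M e (E(i := X)) p = b"
    proof (rule Conj.IH(1)[of _ _ "\<lambda>j. f \<langle>\<zero>, j\<rangle>"])
      show "evid M i E p b e X (\<lambda>j. f \<langle>\<zero>, j\<rangle>) k" for k
        using Conj.prems(2)[of "\<langle>\<zero>, k\<rangle>", unfolded evid.simps if_P[OF True], THEN spec, THEN mp,
          OF pair_le2, THEN conjunct1] pair_mono2[of _ k "\<zero>"] by blast
    qed (use Conj.prems in auto)
    moreover have "satisfies M e (E(i := X)) q = b"
    proof (rule Conj.IH(2)[of _ _ "\<lambda>j. f \<langle>\<one>, j\<rangle>"])
      show "evid M i E q b e X (\<lambda>j. f \<langle>\<one>, j\<rangle>) k" for k
        using Conj.prems(2)[of "\<langle>\<one>, k\<rangle>", unfolded evid.simps if_P[OF True], THEN spec, THEN mp,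
          OF pair_le2, THEN conjunct2] pair_mono2[of _ k "\<one>"] by blast
    qed (use Conj.prems in auto)
    ultimately show ?thesis using True by (simp del: fun_upd_apply)
  next
    case False
    have "(f \<zero> = \<zero> \<longrightarrow> evid M i E p b e X (\<lambda>j. f (j \<oplus> \<one>)) k) \<and>
        (f \<zero> \<noteq> \<zero> \<longrightarrow> evid M i E q b e X (\<lambda>j. f (j \<oplus> \<one>)) k)" for k
      using Conj.prems(2)[of "k \<oplus> \<one>"] False by simp
    then have "(f \<zero> = \<zero> \<longrightarrow> satisfies M e (E(i := X)) p = b) \<and> (f \<zero> \<noteq> \<zero> \<longrightarrow> satisfies M e (E(i := X)) q = b)"
      using Conj.IH(1)[of b e "\<lambda>j. f (j \<oplus> \<one>)"] Conj.IH(2)[of b e "\<lambda>j. f (j \<oplus> \<one>)"] Conj.prems(1)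
      by (auto simp del: fun_upd_apply)
    then show ?thesis using False by (auto simp del: fun_upd_apply)
  qed
next
  case (AllNum x p)
  show ?case
  proof (cases b)
    case True
    have "satisfies M (e(x := a)) (E(i := X)) p = b" for a
    proof (rule AllNum.IH[of _ _ "\<lambda>j. f \<langle>a, j\<rangle>"])
      show "evid M i E p b (e(x := a)) X (\<lambda>j. f \<langle>a, j\<rangle>) k" for k
        using AllNum.prems(2)[of "\<langle>a, k\<rangle>", unfolded evid.simps if_P[OF True], THEN spec, THEN spec, THEN mp,
          OF pair_le2, THEN mp] pair_mono2[of _ k a] by blast
    qed (use AllNum.prems in auto)
    then show ?thesis using True by (simp del: fun_upd_apply)
  next
    case False
    have "satisfies M (e(x := f \<zero>)) (E(i := X)) p = b"
      by (rule AllNum.IH[of _ _ "\<lambda>j. f (j \<oplus> \<one>)"])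
        (use AllNum.prems(1) AllNum.prems(2)[of "_ \<oplus> \<one>"] False in \<open>auto simp del: fun_upd_apply\<close>)
    then show ?thesis using False by (auto simp del: fun_upd_apply)
  qed
qed auto

lemma df_fun:
  assumes "df (\<lambda>e. F (\<lambda>k. e (Suc k)) (e 0))" "\<And>v. df (\<lambda>e. \<sigma> e v)" "df t"
  shows "df (\<lambda>e. F (\<sigma> e) (t e))"
proof -
  let ?\<tau> = "\<lambda>e v. case v of 0 \<Rightarrow> t e | Suc v \<Rightarrow> \<sigma> e v"
  have "df (\<lambda>e. ?\<tau> e v)" for v using assms by (cases v) simp_all
  from df_subst[where \<sigma> = ?\<tau>, OF assms(1) this] show ?thesis by simp
qed

text \<open>Skolem functions are constructed along the formula, definably and uniformly in the
  assignment \<open>e\<close>. Uniformity serves the universal quantifier, where one function has to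
  collect the evidence for all values of the variable.\<close>

lemma evid_complete:
  assumes X: "X \<in> S" and E: "\<And>v. E v \<in> S"
  shows "arithmetical p \<Longrightarrow> \<exists>F. df (\<lambda>e. F (\<lambda>k. e (Suc k)) (e 0)) \<and>
    (\<forall>e. satisfies M e (E(i := X)) p = b \<longrightarrow> (\<forall>m. evid M i E p b e X (F e) m))"
proof (induction p arbitrary: b)
  case (Neg p)
  then obtain F where F: "df (\<lambda>e. F (\<lambda>k. e (Suc k)) (e 0))"
    "\<forall>e. satisfies M e (E(i := X)) p = (\<not> b) \<longrightarrow> (\<forall>m. evid M i E p (\<not> b) e X (F e) m)"
    by (meson arithmetical.simps(4))
  then show ?case by (intro exI[of _ F]) (cases b; simp del: fun_upd_apply)
next
  case (Conj p q)
  have ar: "arithmetical p" "arithmetical q" using Conj.prems by simp_all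
  obtain F where "df (\<lambda>e. F (\<lambda>k. e (Suc k)) (e 0)) \<and>
    (\<forall>e. satisfies M e (E(i := X)) p = b \<longrightarrow> (\<forall>m. evid M i E p b e X (F e) m))"
    by (rule exE[OF Conj.IH(1)[OF ar(1), of b]])
  then have F: "df (\<lambda>e. F (\<lambda>k. e (Suc k)) (e 0))"
    "\<And>e m. satisfies M e (E(i := X)) p = b \<Longrightarrow> evid M i E p b e X (F e) m" by blast+
  obtain G where "df (\<lambda>e. G (\<lambda>k. e (Suc k)) (e 0)) \<and>
    (\<forall>e. satisfies M e (E(i := X)) q = b \<longrightarrow> (\<forall>m. evid M i E q b e X (G e) m))"
    by (rule exE[OF Conj.IH(2)[OF ar(2), of b]])
  then have G: "df (\<lambda>e. G (\<lambda>k. e (Suc k)) (e 0))"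
    "\<And>e m. satisfies M e (E(i := X)) q = b \<Longrightarrow> evid M i E q b e X (G e) m" by blast+
  have EX: "(E(i := X)) v \<in> S" for v using X E by simp
  show ?case
  proof (cases b)
    case True
    define H where "H e j = (if pi1 j = \<zero> then F e (pi2 j) else G e (pi2 j))" for e j
    have "df (\<lambda>e. H (\<lambda>k. e (Suc k)) (e 0))"
      unfolding H_def by (intro ari df_fun[OF F(1)] df_fun[OF G(1)])
    moreover have "evid M i E (Conj p q) b e X (H e) m" if "satisfies M e (E(i := X)) (Conj p q) = b" for e m
    proof -
      have "satisfies M e (E(i := X)) p = b" "satisfies M e (E(i := X)) q = b"
        using that True by (simp_all del: fun_upd_apply)
      note F(2)[OF this(1)] G(2)[OF this(2)]
      then show ?thesis unfolding evid.simps if_P[OF True] by (simp add: H_def)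
    qed
    ultimately show ?thesis by blast
  next
    case False
    define H where "H e j = (if j = \<zero> then (if satisfies M e (E(i := X)) p then \<one> else \<zero>)
      else if satisfies M e (E(i := X)) p then G e (pd j) else F e (pd j))" for e j
    have "df (\<lambda>e. H (\<lambda>k. e (Suc k)) (e 0))"
      unfolding H_def by (intro ari df_fun[OF F(1)] df_fun[OF G(1)] ar_satisfies[OF ar(1) EX])
    moreover have "evid M i E (Conj p q) b e X (H e) m" if "satisfies M e (E(i := X)) (Conj p q) = b" for e m
      using that False F(2)[of e] G(2)[of e] by (simp add: H_def)
    ultimately show ?thesis by blast
  qed
next
  case (AllNum x p)
  have ar: "arithmetical p" using AllNum.prems by simp
  obtain F where "df (\<lambda>e. F (\<lambda>k. e (Suc k)) (e 0)) \<and>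
    (\<forall>e. satisfies M e (E(i := X)) p = b \<longrightarrow> (\<forall>m. evid M i E p b e X (F e) m))"
    by (rule exE[OF AllNum.IH[OF ar, of b]])
  then have F: "df (\<lambda>e. F (\<lambda>k. e (Suc k)) (e 0))"
    "\<And>e m. satisfies M e (E(i := X)) p = b \<Longrightarrow> evid M i E p b e X (F e) m" by blast+
  have EX: "(E(i := X)) v \<in> S" for v using X E by simp
  show ?case
  proof (cases b)
    case True
    define H where "H e j = F (e(x := pi1 j)) (pi2 j)" for e j
    have "df (\<lambda>e. H (\<lambda>k. e (Suc k)) (e 0))"
      unfolding H_def by (intro df_fun[OF F(1)] df_upd ari)
    moreover have "evid M i E (AllNum x p) b e X (H e) m" if "satisfies M e (E(i := X)) (AllNum x p) = b" for e m
      using that True F(2) by (simp add: H_def del: fun_upd_apply)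
    ultimately show ?thesis by blast
  next
    case False
    \<comment> \<open>Taking the least counterexample makes the choice definable.\<close>
    define w where "w e = the0 (\<lambda>a. \<not> satisfies M (e(x := a)) (E(i := X)) p \<and>
      (\<forall>a'. a' \<prec> a \<longrightarrow> satisfies M (e(x := a')) (E(i := X)) p))" for e
    have dw: "df (\<lambda>e. w (\<lambda>k. e (Suc k)))"
      unfolding w_def by (intro ari ar_satisfies[OF ar EX] df_upd)
    have w: "\<not> satisfies M (e(x := w e)) (E(i := X)) p" if "\<not> satisfies M e (E(i := X)) (AllNum x p)" for e
    proof -
      let ?P = "\<lambda>a. \<not> satisfies M (e(x := a)) (E(i := X)) p"
      obtain a where "?P a" using \<open>\<not> satisfies M e (E(i := X)) (AllNum x p)\<close> by auto
      moreover have "ar (\<lambda>v. ?P (v 0))" by (intro ari ar_satisfies[OF ar EX] df_upd)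
      ultimately obtain k where k: "?P k" "\<And>m. m \<prec> k \<Longrightarrow> \<not> ?P m" using least[of ?P a] by blast
      have "w e = k" unfolding w_def
      proof (rule the0_eq)
        fix y assume y: "?P y \<and> (\<forall>a'. a' \<prec> y \<longrightarrow> satisfies M (e(x := a')) (E(i := X)) p)"
        show "y = k" using less_linear[of y k] k y by blast
      qed (use k in blast)
      then show ?thesis using k(1) by simp
    qed
    define H where "H e j = (if j = \<zero> then w e else F (e(x := w e)) (pd j))" for e j
    have "df (\<lambda>e. H (\<lambda>k. e (Suc k)) (e 0))"
      unfolding H_def by (intro ari df_fun[OF F(1)] df_upd dw)
    moreover have "evid M i E (AllNum x p) b e X (H e) m" if "satisfies M e (E(i := X)) (AllNum x p) = b" for e m
      using that False F(2)[of "e(x := w e)"] w[of e] by (simp add: H_def del: fun_upd_apply)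
    ultimately show ?thesis by blast
  qed
next
  case (Mem t j)
  show ?case by (rule exI[of _ "\<lambda>e j. \<zero>"]) (auto intro: df_const)
next
  case (Eq s t)
  show ?case by (rule exI[of _ "\<lambda>e j. \<zero>"]) (auto intro: df_const)
next
  case (Less s t)
  show ?case by (rule exI[of _ "\<lambda>e j. \<zero>"]) (auto intro: df_const)
qed simp

lemma ar_evid:
  assumes E: "\<And>v. E v \<in> S"
  shows "(\<And>v. df (\<lambda>e. \<epsilon> e v)) \<Longrightarrow> ds X \<Longrightarrow> df (\<lambda>e. f (\<lambda>k. e (Suc k)) (e 0)) \<Longrightarrow> df m \<Longrightarrow>
    ar (\<lambda>e. evid M i E p b (\<epsilon> e) (X e) (f e) (m e))"
proof (induction p arbitrary: b \<epsilon> X f m)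
  case (Eq s t)
  show ?case unfolding evid.simps by (intro ari df_term Eq)
next
  case (Less s t)
  show ?case unfolding evid.simps by (intro ari df_term Less)
next
  case (Mem t j)
  show ?case unfolding evid.simps by (intro ari df_term Mem E)
next
  case (Neg p)
  show ?case unfolding evid.simps by (rule Neg.IH[OF Neg.prems])
next
  case (Conj p q)
  note s = df_subst[OF Conj.prems(1)] ds_subst[OF Conj.prems(2)] df_fun[OF Conj.prems(3)] df_subst[OF Conj.prems(4)]
  have 1: "ar (\<lambda>e. evid M i E r b (\<epsilon> (\<lambda>k. e (Suc k))) (X (\<lambda>k. e (Suc k))) (\<lambda>j. f (\<lambda>k. e (Suc k)) \<langle>c, j\<rangle>) (e 0))"
    if "r = p \<or> r = q" for r c b
    using that by (elim disjE; hypsubst; intro Conj.IH s ari)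
  have 2: "ar (\<lambda>e. evid M i E r b (\<epsilon> (\<lambda>k. e (Suc k))) (X (\<lambda>k. e (Suc k))) (\<lambda>j. f (\<lambda>k. e (Suc k)) (j \<oplus> \<one>)) (e 0))"
    if "r = p \<or> r = q" for r b
    using that by (elim disjE; hypsubst; intro Conj.IH s ari)
  show ?case
  proof (cases b)
    case True
    show ?thesis using True unfolding evid.simps if_P[OF True] by (intro ari 1 s disjI1 disjI2 refl)
  next
    case False
    show ?thesis unfolding evid.simps if_not_P[OF False] by (intro ari 2 s disjI1 disjI2 refl)
  qed
next
  case (AllNum x p)
  note s = df_subst[OF AllNum.prems(1)] ds_subst[OF AllNum.prems(2)] df_fun[OF AllNum.prems(3)] df_subst[OF AllNum.prems(4)]
  have 1: "ar (\<lambda>e. evid M i E p b ((\<epsilon> (\<lambda>k. e (Suc (Suc k))))(x := e (Suc 0))) (X (\<lambda>k. e (Suc (Suc k))))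
      (\<lambda>j. f (\<lambda>k. e (Suc (Suc k))) \<langle>e (Suc 0), j\<rangle>) (e 0))" for b
    by (intro AllNum.IH s ari df_upd)
  have 2: "ar (\<lambda>e. evid M i E p b ((\<epsilon> (\<lambda>k. e (Suc k)))(x := f (\<lambda>k. e (Suc k)) \<zero>)) (X (\<lambda>k. e (Suc k)))
      (\<lambda>j. f (\<lambda>k. e (Suc k)) (j \<oplus> \<one>)) (e 0))" for b
    by (intro AllNum.IH s ari df_upd)
  show ?case
  proof (cases b)
    case True
    show ?thesis unfolding evid.simps if_P[OF True] by (intro ari 1 s)
  next
    case False
    show ?thesis unfolding evid.simps if_not_P[OF False] by (intro ari 2 s)
  qed
next
  case (AllSet j p)
  show ?case unfolding evid.simps by (rule ar_const)
qed

section \<open>Sequences and trees\<close>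

definition seq :: "'a set \<Rightarrow> bool" where
  "seq s \<longleftrightarrow> (\<forall>p\<in>s. \<exists>j y. p = \<langle>j, y\<rangle>) \<and> (\<forall>j y y'. \<langle>j, y\<rangle> \<in> s \<and> \<langle>j, y'\<rangle> \<in> s \<longrightarrow> y = y') \<and>
    (\<forall>j y i. \<langle>j, y\<rangle> \<in> s \<and> i \<prec> j \<longrightarrow> (\<exists>y. \<langle>i, y\<rangle> \<in> s))"

lemma ar_seq[ari]: assumes "ds A" shows "ar (\<lambda>e. seq (A e))"
  unfolding seq_def by (intro ari ds_subst[OF assms])

lemma seq_gr: assumes "df (\<lambda>e. p (e 0))" shows "seq (elts (gr m p))"
  unfolding seq_def gr_simps(2)[OF assms] by (auto simp: image_iff intro: less_trans)

definition initial :: "'a \<Rightarrow> 'a set \<Rightarrow> 'a set" where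
  "initial m s = {p. p \<in> s \<and> (\<exists>j y. p = \<langle>j, y\<rangle> \<and> j \<prec> m)}"

lemma fin_initial: assumes "fin s" shows "fin (initial m s)"
proof (rule fin_subset[OF assms])
  show "initial m s \<in> S" unfolding initial_def by (rule setI, intro ari fin_S assms)
qed (auto simp: initial_def)

end

locale trees = aca +
  fixes Tr :: "'a \<Rightarrow> 'a \<Rightarrow> bool"
  assumes ar_Tr: "ar (\<lambda>e. Tr (e 0) (e (Suc 0)))"
    and Tr_seq: "Tr n s \<Longrightarrow> fcode s \<and> seq (elts s)"
    and Tr_empty: "Tr n (code {})"
    and Tr_0: "Tr \<zero> s \<Longrightarrow> elts s = {}"
    and Tr_initial: "Tr n s \<Longrightarrow> Tr n (code (initial m (elts s)))"
begin

text \<open>Definable functions take the place of functions coded by sets of the model; by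
  comprehension these amount to the same.\<close>

definition path where "path n p \<longleftrightarrow> df (\<lambda>e. p (e 0)) \<and> (\<forall>m. Tr n (gr m p))"

end

text \<open>\<open>\<Pi>\<^sup>1\<^sub>1\<close>-induction in terms of trees: the formula at \<open>n\<close> holds iff \<open>Tr (n + 1)\<close>, the tree of attempts to refute
  it, has no path.\<close>

definition tree_induction :: "'a l2_structure \<Rightarrow> bool" where
  "tree_induction M \<longleftrightarrow> (\<forall>Tr. trees M Tr \<longrightarrow>
    (\<forall>n. (\<nexists>p. trees.path M Tr n p) \<longrightarrow> (\<nexists>p. trees.path M Tr (add_of M n (one_of M)) p)) \<longrightarrow>
    (\<forall>n p. \<not> trees.path M Tr n p))"

context aca
begin

text \<open>A path through the tree at \<open>n \<oplus> \<one>\<close> codes a set together with a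
  Skolem function showing that the matrix \<open>q\<close> fails for this set at \<open>n\<close>.
  By \<open>evid_sound\<close> and \<open>evid_complete\<close> such a path exists iff the formula
  is false at \<open>n\<close>.\<close>

lemma tree_induction_imp_Pi11:
  assumes "tree_induction M" shows "Pi11_induction M"
  unfolding Pi11_induction_def
proof (intro allI impI)
  fix p x e E n
  assume "Pi11_formula p" and rE: "range E \<subseteq> S" and p0: "satisfies M (e(x := \<zero>)) E p"
    and step: "\<forall>n. satisfies M (e(x := n)) E p \<longrightarrow> satisfies M (e(x := n \<oplus> \<one>)) E p"
  obtain i q where q: "arithmetical q" "p = AllSet i q"
    using \<open>Pi11_formula p\<close> by (auto simp: Pi11_formula_def)
  have ES: "E v \<in> S" for v using rE by auto
  \<comment> \<open>The first component of an entry decides membership in the set, the second one is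
    the Skolem value.\<close>
  let ?ev = "\<lambda>n s m. evid M i E q False (e(x := n)) {j. pi1 (app s j) \<noteq> \<zero>} (\<lambda>j. pi2 (app s j)) m"
  \<comment> \<open>Evidence is demanded at every length up to which \<open>s\<close> is defined, so
    that initial segments of nodes are nodes.\<close>
  define Tr where "Tr n s \<longleftrightarrow> fcode s \<and> seq (elts s) \<and> (elts s \<noteq> {} \<longrightarrow>
    (\<exists>k. n = k \<oplus> \<one> \<and> (\<forall>m. (\<forall>j. j \<prec> m \<longrightarrow> (\<exists>y. \<langle>j, y\<rangle> \<in> elts s)) \<longrightarrow> ?ev k s m)))" for n s
  have seq_initial: "seq (initial m s)" if "seq s" for m s
    using that less_trans unfolding seq_def initial_def by fastforce
  have app_elts: "app s j = y" if "seq (elts s)" "\<langle>j, y\<rangle> \<in> elts s" for s j y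
    unfolding app_def by (rule the0_eq) (use that in \<open>auto simp: seq_def\<close>)
  interpret trees M Tr
  proof
    show "ar (\<lambda>e. Tr (e 0) (e (Suc 0)))"
      unfolding Tr_def by (intro ari ar_evid[OF ES] df_upd)
    show "Tr n s \<Longrightarrow> fcode s \<and> seq (elts s)" for n s by (simp add: Tr_def)
    show "Tr n (code {})" for n using code_props(1)[OF fin_empty] by (simp add: Tr_def fin_empty seq_def)
    show "Tr \<zero> s \<Longrightarrow> elts s = {}" for s by (auto simp: Tr_def)
    show "Tr n (code (initial m (elts s)))" if T: "Tr n s" for n s m
    proof -
      let ?t = "code (initial m (elts s))"
      have f: "fin (initial m (elts s))" by (intro fin_initial fin_elts)
      have s: "seq (elts s)" using T by (simp add: Tr_def)
      have t: "seq (elts ?t)" unfolding elts_code[OF f] by (rule seq_initial[OF s])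
      have sub: "elts ?t \<subseteq> elts s" unfolding elts_code[OF f] by (auto simp: initial_def)
      have "?ev k ?t m'" if k: "?ev k s m'" and m': "\<forall>j. j \<prec> m' \<longrightarrow> (\<exists>y. \<langle>j, y\<rangle> \<in> elts ?t)" for k m'
      proof -
        have a: "app ?t j = app s j" if j: "j \<prec> m'" for j
        proof -
          obtain y where y: "\<langle>j, y\<rangle> \<in> elts ?t" using m' j by blast
          then have "\<langle>j, y\<rangle> \<in> elts s" using sub by blast
          from app_elts[OF s this] app_elts[OF t y] show ?thesis by simp
        qed
        show ?thesis using k by (rule evid_cong[THEN iffD1, rotated -1]) (simp_all add: a)
      qed
      then show ?thesis using T t code_props(1)[OF f] sub unfolding Tr_def by blast
    qed
  qed
  have no_path: "(\<nexists>p. path (n \<oplus> \<one>) p) \<longleftrightarrow> satisfies M (e(x := n)) E p" for n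
  proof
    assume np: "\<nexists>p. path (n \<oplus> \<one>) p"
    show "satisfies M (e(x := n)) E p" unfolding q(2) satisfies.simps
    proof (rule ballI, rule ccontr)
      fix X assume X: "X \<in> S" and "\<not> satisfies M (e(x := n)) (E(i := X)) q"
      obtain F where "df (\<lambda>e. F (\<lambda>k. e (Suc k)) (e 0)) \<and>
    (\<forall>e. satisfies M e (E(i := X)) q = False \<longrightarrow> (\<forall>m. evid M i E q False e X (F e) m))"
    by (rule exE[OF evid_complete[OF X ES q(1), where i = i and b = False]])
  then have F: "df (\<lambda>e. F (\<lambda>k. e (Suc k)) (e 0))"
    "\<And>e m. satisfies M e (E(i := X)) q = False \<Longrightarrow> evid M i E q False e X (F e) m" by blast+
      define p where "p j = \<langle>if j \<in> X then \<one> else \<zero>, F (e(x := n)) j\<rangle>" for j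
      have dp: "df (\<lambda>e. p (e 0))" unfolding p_def by (intro ari X df_fun[OF F(1)])
      have ev: "evid M i E q False (e(x := n)) X (F (e(x := n))) m" for m
        by (rule F(2)) (use \<open>\<not> satisfies M (e(x := n)) (E(i := X)) q\<close> in simp)
      have "Tr (n \<oplus> \<one>) (gr m p)" for m
      proof -
        have sq: "seq (elts (gr m p))" by (rule seq_gr[OF dp])
        have evs: "?ev n (gr m p) m'" if m': "\<forall>j. j \<prec> m' \<longrightarrow> (\<exists>y. \<langle>j, y\<rangle> \<in> elts (gr m p))" for m'
        proof -
          have ap: "app (gr m p) j = p j" if "j \<prec> m'" for j
            using m' that by (intro gr_simps(5)[OF dp]) (auto simp: gr_simps(2)[OF dp])
          have "?ev n (gr m p) m' = evid M i E q False (e(x := n)) X (F (e(x := n))) m'"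
            by (rule evid_cong) (simp_all add: ap, simp_all add: p_def)
          then show ?thesis using ev[of m'] by simp
        qed
        show ?thesis unfolding Tr_def
          by (intro conjI impI exI[of _ n] allI) (rule gr_simps(1)[OF dp], rule sq, rule refl, rule evs)
      qed
      then show False using np dp unfolding path_def by blast
    qed
  next
    assume sat: "satisfies M (e(x := n)) E p"
    show "\<nexists>p. path (n \<oplus> \<one>) p"
    proof
      assume "\<exists>p. path (n \<oplus> \<one>) p"
      then obtain p where p: "df (\<lambda>e. p (e 0))" "\<And>m. Tr (n \<oplus> \<one>) (gr m p)" unfolding path_def by blast
      let ?X = "{j. pi1 (p j) \<noteq> \<zero>}"
      have XS: "?X \<in> S" by (rule setI, intro ari df_comp1[OF p(1)])
      have "evid M i E q False (e(x := n)) ?X (\<lambda>j. pi2 (p j)) m" for m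
      proof -
        \<comment> \<open>Length \<open>m \<oplus> \<one>\<close> keeps the node nonempty even for
          \<open>m = \<zero>\<close>; the condition in \<open>Tr\<close> says nothing about the
          empty sequence.\<close>
        have "?ev n (gr (m \<oplus> \<one>) p) m"
          using p(2)[of "m \<oplus> \<one>"] unfolding Tr_def gr_simps(2)[OF p(1)] by auto
        moreover have ap: "app (gr (m \<oplus> \<one>) p) j = p j" if "j \<prec> m" for j
          by (rule gr_simps(5)[OF p(1)]) (simp add: that)
        moreover have "?ev n (gr (m \<oplus> \<one>) p) m = evid M i E q False (e(x := n)) ?X (\<lambda>j. pi2 (p j)) m"
          by (rule evid_cong) (simp_all add: ap)
        ultimately show ?thesis by simp
      qed
      then have "satisfies M (e(x := n)) (E(i := ?X)) q = False" by (rule evid_sound[OF q(1)])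
      then show False using sat XS by (simp add: q(2))
    qed
  qed
  \<comment> \<open>Indices of trees are shifted by one: for \<open>n = \<zero>\<close> the
    conclusion is the base case of the given induction, for successors it is the induction
    step.\<close>
  have "(\<nexists>p. path n p) \<longrightarrow> (\<nexists>p. path (n \<oplus> \<one>) p)" for n
    using zero_or_succ[of n] no_path p0 step by auto
  moreover have "trees M Tr" by unfold_locales
  ultimately have "\<nexists>p. path (n \<oplus> \<one>) p" using assms unfolding tree_induction_def by blast
  then show "satisfies M (e(x := n)) E p" using no_path by blast
qed

section \<open>A dilator of words\<close>

lemma ex1_code: assumes "fin A" shows "\<exists>!c. fcode c \<and> elts c = A"
proof (rule ex1I[of _ "code A"])
  show "c = code A" if "fcode c \<and> elts c = A" for c using that code_elts[of c] by simp
qed (use code_props[OF assms] in simp)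

definition slot :: "'a set \<Rightarrow> 'a \<Rightarrow> 'a set" where "slot W j = {y. \<langle>j, y\<rangle> \<in> W}"

definition lless where
  "lless lt y z \<longleftrightarrow> lt (pi1 y) (pi1 z) \<or> (pi1 y = pi1 z \<and> pi2 y \<prec> pi2 z)"

definition sless where
  "sless lt j A B \<longleftrightarrow> (\<exists>y\<in>A. \<exists>z\<in>B. lless lt y z) \<or> (j \<noteq> \<zero> \<and> A \<noteq> {} \<and> B = {}) \<or> (j = \<zero> \<and> A = {} \<and> B \<noteq> {})"

text \<open>A missing letter is the largest one, as in the Kleene-Brouwer order, except that it is the smallest
  one at position \<open>0\<close>, so that the empty word comes first.\<close>

definition wless where
  "wless lt W V \<longleftrightarrow> (\<exists>j. (\<forall>i. i \<prec> j \<longrightarrow> slot W i = slot V i) \<and> sless lt j (slot W j) (slot V j))"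

definition tree where "tree W = {p. \<exists>j x v. \<langle>j \<oplus> \<one>, \<langle>x, v\<rangle>\<rangle> \<in> W \<and> p = \<langle>j, v\<rangle>}"

text \<open>Words are sets of triples \<open>\<langle>j, \<langle>x, v\<rangle>\<rangle>\<close> of
  a position, an entry from the linear order and a number. Morphisms act on the middle component
  alone, and the middle components make up the support.\<close>

definition rl where "rl f W = (\<lambda>p. \<langle>pi1 p, \<langle>f (pi1 (pi2 p)), pi2 (pi2 p)\<rangle>\<rangle>) ` W"

definition sp where "sp W = (\<lambda>p. pi1 (pi2 p)) ` W"

definition trip where "trip U W \<longleftrightarrow> (\<forall>p\<in>W. \<exists>j x v. p = \<langle>j, \<langle>x, v\<rangle>\<rangle> \<and> U x)"

lemma rl_comp: "rl g (rl f W) = rl (\<lambda>x. g (f x)) W"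
  by (simp add: rl_def image_image)

lemma rl_cong: "(\<And>x. x \<in> sp W \<Longrightarrow> f x = g x) \<Longrightarrow> rl f W = rl g W"
  by (simp add: rl_def sp_def)

lemma rl_id: "trip U W \<Longrightarrow> rl (\<lambda>x. x) W = W"
  unfolding rl_def trip_def by force

lemma sp_rl: "sp (rl f W) = f ` sp W"
  by (simp add: rl_def sp_def image_image)

lemma rl_mem: "trip U W \<Longrightarrow> \<langle>j, \<langle>x, v\<rangle>\<rangle> \<in> rl f W \<longleftrightarrow> (\<exists>x'. \<langle>j, \<langle>x', v\<rangle>\<rangle> \<in> W \<and> x = f x')"
  unfolding rl_def trip_def by force

lemma trip_sp: "trip U W \<Longrightarrow> x \<in> sp W \<Longrightarrow> U x"
  unfolding trip_def sp_def by force

lemma sp_iff: "trip U W \<Longrightarrow> x \<in> sp W \<longleftrightarrow> (\<exists>j v. \<langle>j, \<langle>x, v\<rangle>\<rangle> \<in> W)"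
  unfolding trip_def sp_def by force

lemma trip_mem: "trip U W \<Longrightarrow> \<langle>j, y\<rangle> \<in> W \<Longrightarrow> \<exists>x v. y = \<langle>x, v\<rangle> \<and> U x"
  unfolding trip_def by force

lemma trip_rl: "trip U W \<Longrightarrow> (\<And>x. U x \<Longrightarrow> U' (f x)) \<Longrightarrow> trip U' (rl f W)"
  unfolding trip_def rl_def by force

lemma fin_rl: assumes "fin W" "df (\<lambda>e. f (e 0))" shows "fin (rl f W)"
  unfolding rl_def by (rule fin_image[OF assms(1)]) (intro ari df_comp1[OF assms(2)])

lemma fin_sp: assumes "fin W" shows "fin (sp W)"
  unfolding sp_def by (rule fin_image[OF assms]) (intro ari)

lemma slot_rl: "trip U W \<Longrightarrow> slot (rl f W) j = (\<lambda>y. \<langle>f (pi1 y), pi2 y\<rangle>) ` slot W j"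
  unfolding slot_def trip_def rl_def by force

lemma tree_rl: "trip U W \<Longrightarrow> tree (rl f W) = tree W"
  unfolding tree_def by (auto simp: rl_mem)

lemma fin_tree: assumes "fin W" shows "fin (tree W)"
proof (rule fin_subset)
  show "fin ((\<lambda>p. \<langle>pd (pi1 p), pi2 (pi2 p)\<rangle>) ` W)" by (rule fin_image[OF assms]) (intro ari)
  show "tree W \<in> S" unfolding tree_def by (rule setI, intro ari fin_S assms)
  show "tree W \<subseteq> (\<lambda>p. \<langle>pd (pi1 p), pi2 (pi2 p)\<rangle>) ` W" unfolding tree_def by force
qed

lemma slot_iff: "y \<in> slot W j \<longleftrightarrow> \<langle>j, y\<rangle> \<in> W" by (simp add: slot_def)

lemma ds_slot[ari]: assumes "ds W" "df j" shows "ds (\<lambda>e. slot (W e) (j e))"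
  unfolding slot_def by (intro ari ds_subst[OF assms(1)] df_subst[OF assms(2)])

lemma ds_tree[ari]: assumes "ds W" shows "ds (\<lambda>e. tree (W e))"
  unfolding tree_def by (intro ari ds_subst[OF assms])

lemma ds_sp[ari]: "ds W \<Longrightarrow> ds (\<lambda>e. sp (W e))"
  unfolding sp_def by (intro ari)

lemma ds_rl[ari]: assumes "df (\<lambda>e. f (\<lambda>k. e (Suc k)) (e 0))" "ds W" shows "ds (\<lambda>e. rl (f e) (W e))"
  unfolding rl_def by (intro ari assms df_fun[OF assms(1)])

lemma ar_wless_M[ari]: assumes "ds W" "ds V" shows "ar (\<lambda>e. wless (\<lambda>x y. x \<prec> y) (W e) (V e))"
  unfolding wless_def sless_def lless_def
  by (intro ari ds_subst[OF assms(1)] ds_subst[OF assms(2)])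

definition slt where "slt U A \<longleftrightarrow> A = {} \<or> (\<exists>x v. A = {\<langle>x, v\<rangle>} \<and> U x)"

lemma slt_slot: "trip U W \<Longrightarrow> seq W \<Longrightarrow> slt U (slot W j)"
proof -
  assume W: "trip U W" "seq W"
  show ?thesis
  proof (cases "slot W j = {}")
    case False
    then obtain y where y: "\<langle>j, y\<rangle> \<in> W" by (auto simp: slot_def)
    then obtain x v where x: "y = \<langle>x, v\<rangle>" "U x" using trip_mem[OF W(1)] by blast
    have "slot W j = {\<langle>x, v\<rangle>}" using W(2) y x(1) unfolding slot_def seq_def by blast
    then show ?thesis using x(2) by (auto simp: slt_def)
  qed (simp add: slt_def)
qed

section \<open>Linearity of the order of words\<close>

context
  fixes U :: "'a \<Rightarrow> bool" and lt :: "'a \<Rightarrow> 'a \<Rightarrow> bool" assumes l: "lin U lt"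
begin

lemma sless_irrefl: "slt U A \<Longrightarrow> \<not> sless lt j A A"
  using linD(1)[OF l] less_irrefl by (auto simp: slt_def sless_def lless_def)

lemma lless_trans:
  "U x \<Longrightarrow> U y \<Longrightarrow> U z \<Longrightarrow> lless lt \<langle>x, u\<rangle> \<langle>y, v\<rangle> \<Longrightarrow> lless lt \<langle>y, v\<rangle> \<langle>z, w\<rangle> \<Longrightarrow> lless lt \<langle>x, u\<rangle> \<langle>z, w\<rangle>"
  unfolding lless_def pi_pair using linD(2)[OF l, of x y z] less_trans[of u v w] by auto

lemma sless_trans:
  assumes "slt U A" "slt U B" "slt U C" "sless lt j A B" "sless lt j B C" shows "sless lt j A C"
proof -
  consider "A = {}" | "C = {}" "A \<noteq> {}" | "B = {}" "A \<noteq> {}" "C \<noteq> {}" | x u y v z w where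
    "A = {\<langle>x, u\<rangle>}" "B = {\<langle>y, v\<rangle>}" "C = {\<langle>z, w\<rangle>}" "U x" "U y" "U z"
    using assms(1-3) unfolding slt_def by (elim disjE exE conjE) simp_all
  then show ?thesis
  proof cases
    case 4
    have "lless lt \<langle>x, u\<rangle> \<langle>y, v\<rangle>" "lless lt \<langle>y, v\<rangle> \<langle>z, w\<rangle>"
      using assms(4,5) unfolding sless_def 4 by simp_all
    then have "lless lt \<langle>x, u\<rangle> \<langle>z, w\<rangle>" by (rule lless_trans[OF 4(4-6)])
    then show ?thesis unfolding sless_def 4 by simp
  qed (use assms(4,5) in \<open>auto simp: sless_def\<close>)
qed

lemma sless_total: "slt U A \<Longrightarrow> slt U B \<Longrightarrow> sless lt j A B \<or> A = B \<or> sless lt j B A"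
proof -
  assume A: "slt U A" "slt U B"
  consider "A = {}" "B = {}" | x v where "A = {\<langle>x, v\<rangle>}" "B = {}" | x v where "B = {\<langle>x, v\<rangle>}" "A = {}"
    | x v y u where "A = {\<langle>x, v\<rangle>}" "B = {\<langle>y, u\<rangle>}" "U x" "U y"
    using A unfolding slt_def by blast
  then show ?thesis
  proof cases
    case 4
    then show ?thesis using linD(3)[OF l 4(3,4)] less_linear[of v u] by (auto simp: sless_def lless_def)
  qed (auto simp: sless_def)
qed

text \<open>Distinct words have a least position at which they differ, since the slots are
  definable. There the linear order of slots, each with at most one letter, decides.\<close>

lemma wless_lin: "lin (\<lambda>c. fcode c \<and> trip U (elts c) \<and> seq (elts c)) (\<lambda>c d. wless lt (elts c) (elts d))"
  unfolding linear_order_on_class_def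
proof (intro conjI allI impI)
  have st: "slt U (slot (elts c) j)" if "fcode c \<and> trip U (elts c) \<and> seq (elts c)" for c j
    using slt_slot that by blast
  fix c assume c: "fcode c \<and> trip U (elts c) \<and> seq (elts c)"
  show "\<not> wless lt (elts c) (elts c)" using sless_irrefl[OF st[OF c]] by (auto simp: wless_def)
next
  have st: "slt U (slot (elts c) j)" if "fcode c \<and> trip U (elts c) \<and> seq (elts c)" for c j
    using slt_slot that by blast
  fix c d b assume "(fcode c \<and> trip U (elts c) \<and> seq (elts c)) \<and> (fcode d \<and> trip U (elts d) \<and> seq (elts d)) \<and>
    (fcode b \<and> trip U (elts b) \<and> seq (elts b)) \<and> wless lt (elts c) (elts d) \<and> wless lt (elts d) (elts b)"
  then have s: "slt U (slot (elts c) j)" "slt U (slot (elts d) j)" "slt U (slot (elts b) j)"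
    and w: "wless lt (elts c) (elts d)" "wless lt (elts d) (elts b)" for j using st by blast+
  obtain j where j: "\<forall>i. i \<prec> j \<longrightarrow> slot (elts c) i = slot (elts d) i" "sless lt j (slot (elts c) j) (slot (elts d) j)"
    using w(1) unfolding wless_def by blast
  obtain k where k: "\<forall>i. i \<prec> k \<longrightarrow> slot (elts d) i = slot (elts b) i" "sless lt k (slot (elts d) k) (slot (elts b) k)"
    using w(2) unfolding wless_def by blast
  consider "j \<prec> k" | "j = k" | "k \<prec> j" using less_linear by blast
  then show "wless lt (elts c) (elts b)"
  proof cases
    case 1
    then show ?thesis unfolding wless_def using j k(1) less_trans[OF _ 1] by (intro exI[of _ j]) auto
  next
    case 2
    then show ?thesis unfolding wless_def using j k sless_trans[OF s] by (intro exI[of _ j]) auto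
  next
    case 3
    then show ?thesis unfolding wless_def using k j(1) less_trans[OF _ 3] by (intro exI[of _ k]) auto
  qed
next
  have st: "slt U (slot (elts c) j)" if "fcode c \<and> trip U (elts c) \<and> seq (elts c)" for c j
    using slt_slot that by blast
  fix c d assume cd: "(fcode c \<and> trip U (elts c) \<and> seq (elts c)) \<and> (fcode d \<and> trip U (elts d) \<and> seq (elts d))"
  show "wless lt (elts c) (elts d) \<or> c = d \<or> wless lt (elts d) (elts c)"
  proof (cases "\<exists>j. slot (elts c) j \<noteq> slot (elts d) j")
    case True
    then obtain j0 where j0: "slot (elts c) j0 \<noteq> slot (elts d) j0" by blast
    have "ar (\<lambda>e. slot (elts c) (e 0) \<noteq> slot (elts d) (e 0))" by (intro ari)
    then obtain j where j: "slot (elts c) j \<noteq> slot (elts d) j" "\<And>i. i \<prec> j \<Longrightarrow> slot (elts c) i = slot (elts d) i"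
      by (rule least[of "\<lambda>j. slot (elts c) j \<noteq> slot (elts d) j", OF _ j0]) (rule that, simp_all)
    have "sless lt j (slot (elts c) j) (slot (elts d) j) \<or> sless lt j (slot (elts d) j) (slot (elts c) j)"
      using sless_total[OF st st, of c d j j j] cd j(1) by blast
    then show ?thesis unfolding wless_def using j(2) by metis
  next
    case False
    have "elts c = elts d"
    proof -
      have "p \<in> elts c \<longleftrightarrow> p \<in> elts d" for p
      proof (cases "\<exists>j y. p = \<langle>j, y\<rangle>")
        case True
        then show ?thesis using False slot_iff by blast
      next
        case False
        then show ?thesis using cd unfolding trip_def by blast
      qed
      then show ?thesis by blast
    qed
    then show ?thesis using elts_eq cd by blast
  qed
qed

text \<open>An order embedding of the entries affects neither equality nor order of letters, and
  numbers and positions stay the same.\<close>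

lemma wless_rl:
  assumes f: "\<And>x y. U x \<Longrightarrow> U y \<Longrightarrow> lt' (f x) (f y) \<longleftrightarrow> lt x y" "\<And>x y. U x \<Longrightarrow> U y \<Longrightarrow> f x = f y \<Longrightarrow> x = y"
    and W: "trip U W" "trip U V"
  shows "wless lt' (rl f W) (rl f V) \<longleftrightarrow> wless lt W V"
proof -
  let ?m = "\<lambda>y. \<langle>f (pi1 y), pi2 y\<rangle>"
  let ?L = "{y. \<exists>x v. y = \<langle>x, v\<rangle> \<and> U x}"
  have sub: "slot W j \<subseteq> ?L" "slot V j \<subseteq> ?L" for j using trip_mem[OF W(1)] trip_mem[OF W(2)] by (auto simp: slot_def)
  have inj: "inj_on ?m ?L" using f(2) by (auto simp: inj_on_def)
  have eq: "slot (rl f W) j = slot (rl f V) j \<longleftrightarrow> slot W j = slot V j" for j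
    unfolding slot_rl[OF W(1)] slot_rl[OF W(2)] by (rule inj_on_image_eq_iff[OF inj sub])
  have ll: "lless lt' (?m y) (?m z) \<longleftrightarrow> lless lt y z" if "y \<in> ?L" "z \<in> ?L" for y z
  proof -
    obtain x u where "y = \<langle>x, u\<rangle>" "U x" using \<open>y \<in> ?L\<close> by auto
    moreover obtain x' u' where "z = \<langle>x', u'\<rangle>" "U x'" using \<open>z \<in> ?L\<close> by auto
    ultimately show ?thesis using f(1)[of x x'] f(2)[of x x'] by (auto simp: lless_def)
  qed
  have "(\<exists>y\<in>slot W j. \<exists>z\<in>slot V j. lless lt' (?m y) (?m z)) \<longleftrightarrow> (\<exists>y\<in>slot W j. \<exists>z\<in>slot V j. lless lt y z)" for j
    by (intro bex_cong refl) (rule ll[OF subsetD[OF sub(1)] subsetD[OF sub(2)]])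
  then have "sless lt' j (slot (rl f W) j) (slot (rl f V) j) \<longleftrightarrow> sless lt j (slot W j) (slot V j)" for j
    unfolding sless_def slot_rl[OF W(1)] slot_rl[OF W(2)] by simp
  then show ?thesis unfolding wless_def eq by simp
qed

end

end

section \<open>The prae-dilator of words\<close>

context trees
begin

text \<open>A nonempty word consists of a header \<open>\<langle>b, n\<rangle>\<close> at position \<open>0\<close> and of letters \<open>\<langle>g j, t j\<rangle>\<close> at positions \<open>j + 1\<close>,
  for \<open>j\<close> below some \<open>l\<close>, where \<open>t\<close> is a node of \<open>Tr n\<close> and \<open>g\<close> ranks, with values below \<open>b\<close>, the nodes of
  \<open>Tr (n - 1)\<close> that have code below \<open>l\<close>. Only the entries \<open>b\<close> and \<open>g j\<close> count as letters over the linear order.\<close>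

definition word where
  "word U lt W \<longleftrightarrow> trip U W \<and> seq W \<and> (\<forall>b n. \<langle>\<zero>, \<langle>b, n\<rangle>\<rangle> \<in> W \<longrightarrow>
    Tr n (code (tree W)) \<and> (\<forall>j x v. \<langle>j \<oplus> \<one>, \<langle>x, v\<rangle>\<rangle> \<in> W \<longrightarrow> lt x b) \<and>
    (\<forall>k i j x y u v. n = k \<oplus> \<one> \<and> Tr k i \<and> Tr k j \<and> elts i \<subset> elts j \<and>
      \<langle>i \<oplus> \<one>, \<langle>x, u\<rangle>\<rangle> \<in> W \<and> \<langle>j \<oplus> \<one>, \<langle>y, v\<rangle>\<rangle> \<in> W \<longrightarrow> lt y x))"

lemma ar_Tr'[ari]: "df a \<Longrightarrow> df b \<Longrightarrow> ar (\<lambda>e. Tr (a e) (b e))"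
  by (rule ar_comp2[OF ar_Tr])

lemma wordD:
  assumes "word U lt W"
  shows "trip U W" "seq W" "\<langle>\<zero>, \<langle>b, n\<rangle>\<rangle> \<in> W \<Longrightarrow> Tr n (code (tree W))"
    "\<langle>\<zero>, \<langle>b, n\<rangle>\<rangle> \<in> W \<Longrightarrow> \<langle>j \<oplus> \<one>, \<langle>x, v\<rangle>\<rangle> \<in> W \<Longrightarrow> lt x b"
    "\<langle>\<zero>, \<langle>b, k \<oplus> \<one>\<rangle>\<rangle> \<in> W \<Longrightarrow> Tr k i \<Longrightarrow> Tr k j \<Longrightarrow> elts i \<subset> elts j \<Longrightarrow>
      \<langle>i \<oplus> \<one>, \<langle>x, u\<rangle>\<rangle> \<in> W \<Longrightarrow> \<langle>j \<oplus> \<one>, \<langle>y, v\<rangle>\<rangle> \<in> W \<Longrightarrow> lt y x"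
  using assms unfolding word_def by blast+

lemma wordI:
  assumes "trip U W" "seq W" "\<And>b n. \<langle>\<zero>, \<langle>b, n\<rangle>\<rangle> \<in> W \<Longrightarrow> Tr n (code (tree W))"
    "\<And>b n j x v. \<langle>\<zero>, \<langle>b, n\<rangle>\<rangle> \<in> W \<Longrightarrow> \<langle>j \<oplus> \<one>, \<langle>x, v\<rangle>\<rangle> \<in> W \<Longrightarrow> lt x b"
    "\<And>b k i j x y u v. \<langle>\<zero>, \<langle>b, k \<oplus> \<one>\<rangle>\<rangle> \<in> W \<Longrightarrow> Tr k i \<Longrightarrow> Tr k j \<Longrightarrow> elts i \<subset> elts j \<Longrightarrow>
      \<langle>i \<oplus> \<one>, \<langle>x, u\<rangle>\<rangle> \<in> W \<Longrightarrow> \<langle>j \<oplus> \<one>, \<langle>y, v\<rangle>\<rangle> \<in> W \<Longrightarrow> lt y x"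
  shows "word U lt W"
  unfolding word_def using assms(1,2)
proof (intro conjI allI impI)
  fix b n assume h: "\<langle>\<zero>, \<langle>b, n\<rangle>\<rangle> \<in> W"
  show "Tr n (code (tree W))" by (rule assms(3)[OF h])
  show "lt x b" if "\<langle>j \<oplus> \<one>, \<langle>x, v\<rangle>\<rangle> \<in> W" for j x v by (rule assms(4)[OF h that])
  show "lt y x" if "n = k \<oplus> \<one> \<and> Tr k i \<and> Tr k j \<and> elts i \<subset> elts j \<and>
      \<langle>i \<oplus> \<one>, \<langle>x, u\<rangle>\<rangle> \<in> W \<and> \<langle>j \<oplus> \<one>, \<langle>y, v\<rangle>\<rangle> \<in> W" for k i j x y u v
  proof -
    have h': "\<langle>\<zero>, \<langle>b, k \<oplus> \<one>\<rangle>\<rangle> \<in> W" using h that by simp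
    from that show ?thesis by (elim conjE) (rule assms(5)[OF h'])
  qed
qed

lemma seq_rl: assumes "trip U W" "seq W" shows "seq (rl f W)"
  unfolding seq_def
proof (intro conjI allI impI)
  have t: "trip (\<lambda>_. True) (rl f W)" by (rule trip_rl[OF assms(1)]) simp
  then show "\<forall>p\<in>rl f W. \<exists>j y. p = \<langle>j, y\<rangle>" by (auto simp: trip_def)
  show "y = z" if yz: "\<langle>j, y\<rangle> \<in> rl f W \<and> \<langle>j, z\<rangle> \<in> rl f W" for j y z
  proof -
    have s: "slot W j = {} \<or> (\<exists>x v. slot W j = {\<langle>x, v\<rangle>})" using slt_slot[OF assms, of j] by (auto simp: slt_def)
    have "y \<in> slot (rl f W) j" "z \<in> slot (rl f W) j" using yz by (simp_all add: slot_iff)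
    then show ?thesis using s unfolding slot_rl[OF assms(1)] by auto
  qed
  show "\<exists>y. \<langle>i, y\<rangle> \<in> rl f W" if yz: "\<langle>j, y\<rangle> \<in> rl f W \<and> i \<prec> j" for i j y
  proof -
    have "y \<in> slot (rl f W) j" using yz by (simp add: slot_iff)
    then obtain z where "z \<in> slot W j" unfolding slot_rl[OF assms(1)] by blast
    then obtain z where "\<langle>i, z\<rangle> \<in> W" using assms(2) yz unfolding seq_def slot_iff by blast
    then have "z \<in> slot W i" by (simp add: slot_iff)
    then have "\<langle>f (pi1 z), pi2 z\<rangle> \<in> slot (rl f W) i" unfolding slot_rl[OF assms(1)] by blast
    then show ?thesis unfolding slot_iff by blast
  qed
qed

lemma word_rl:
  assumes W: "word U lt W" and f: "\<And>x. U x \<Longrightarrow> U' (f x)" "\<And>x y. U x \<Longrightarrow> U y \<Longrightarrow> lt x y \<Longrightarrow> lt' (f x) (f y)"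
  shows "word U' lt' (rl f W)"
proof -
  note w = wordD[OF W]
  have U: "U x" if "\<langle>j, \<langle>x, v\<rangle>\<rangle> \<in> W" for j x v using trip_mem[OF w(1) that] by simp
  show ?thesis
  proof (rule wordI)
    show "trip U' (rl f W)" by (rule trip_rl[OF w(1)]) (rule f(1))
    show "seq (rl f W)" by (rule seq_rl[OF w(1,2)])
    show "Tr n (code (tree (rl f W)))" if "\<langle>\<zero>, \<langle>b, n\<rangle>\<rangle> \<in> rl f W" for b n
      using that w(3) unfolding tree_rl[OF w(1)] rl_mem[OF w(1)] by blast
    show "lt' x b" if "\<langle>\<zero>, \<langle>b, n\<rangle>\<rangle> \<in> rl f W" "\<langle>j \<oplus> \<one>, \<langle>x, v\<rangle>\<rangle> \<in> rl f W" for b n j x v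
    proof -
      note h = that
      obtain b' x' where b: "\<langle>\<zero>, \<langle>b', n\<rangle>\<rangle> \<in> W" "\<langle>j \<oplus> \<one>, \<langle>x', v\<rangle>\<rangle> \<in> W" "b = f b'" "x = f x'"
        using h[unfolded rl_mem[OF w(1)]] by (elim exE conjE) (rule that)
      show ?thesis unfolding b(3,4) by (rule f(2)[OF U[OF b(2)] U[OF b(1)] w(4)[OF b(1,2)]])
    qed
    show "lt' y x" if t: "\<langle>\<zero>, \<langle>b, k \<oplus> \<one>\<rangle>\<rangle> \<in> rl f W" "Tr k i" "Tr k j" "elts i \<subset> elts j"
      "\<langle>i \<oplus> \<one>, \<langle>x, u\<rangle>\<rangle> \<in> rl f W" "\<langle>j \<oplus> \<one>, \<langle>y, v\<rangle>\<rangle> \<in> rl f W" for b k i j x y u v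
    proof -
      obtain b' x' y' where b: "\<langle>\<zero>, \<langle>b', k \<oplus> \<one>\<rangle>\<rangle> \<in> W" "\<langle>i \<oplus> \<one>, \<langle>x', u\<rangle>\<rangle> \<in> W" "\<langle>j \<oplus> \<one>, \<langle>y', v\<rangle>\<rangle> \<in> W"
        "x = f x'" "y = f y'"
        using t(1,5,6)[unfolded rl_mem[OF w(1)]] by (elim exE conjE) (rule that)
      show ?thesis unfolding b(4,5) by (rule f(2)[OF U[OF b(3)] U[OF b(2)] w(5)[OF b(1) t(2-4) b(2,3)]])
    qed
  qed
qed

text \<open>For relabellings that are only known to be increasing on the support of the given
  word.\<close>

lemma word_restrict: assumes "word U lt W" shows "word (\<lambda>x. x \<in> sp W) lt W"
proof -
  have "trip (\<lambda>x. x \<in> sp W) W" unfolding trip_def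
  proof
    fix p assume p: "p \<in> W"
    obtain j x v where "p = \<langle>j, \<langle>x, v\<rangle>\<rangle>" using wordD(1)[OF assms] p unfolding trip_def by blast
    then show "\<exists>j x v. p = \<langle>j, \<langle>x, v\<rangle>\<rangle> \<and> x \<in> sp W" using p unfolding sp_def by force
  qed
  with assms show ?thesis unfolding word_def by (elim conjE) (intro conjI)
qed

lemma word_empty: "word U lt {}"
  by (rule wordI) (auto simp: trip_def seq_def)

lemma word_header: assumes "U b" shows "word U lt {\<langle>\<zero>, \<langle>b, n\<rangle>\<rangle>}"
proof (rule wordI)
  have "tree {\<langle>\<zero>, \<langle>b, n\<rangle>\<rangle>} = {}" by (auto simp: tree_def)
  then show "Tr m (code (tree {\<langle>\<zero>, \<langle>b, n\<rangle>\<rangle>}))" for m using Tr_empty by simp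
qed (auto simp: trip_def seq_def assms)

lemma word_slot0: assumes "word U lt W" "slot W \<zero> = {}" shows "W = {}"
proof (rule ccontr)
  assume "W \<noteq> {}"
  then obtain p where p: "p \<in> W" by blast
  then obtain j x v where "p = \<langle>j, \<langle>x, v\<rangle>\<rangle>" using wordD(1)[OF assms(1)] unfolding trip_def by blast
  then have j: "\<langle>j, \<langle>x, v\<rangle>\<rangle> \<in> W" using p by simp
  then have "\<exists>y. \<langle>\<zero>, y\<rangle> \<in> W" using zero_le[of j] wordD(2)[OF assms(1)] unfolding seq_def by blast
  then show False using assms(2) by (auto simp: slot_def)
qed

lemma ar_word_M[ari]:
  assumes "df n" "ds W" shows "ar (\<lambda>e. word (\<lambda>x. x \<prec> n e) (\<lambda>x y. x \<prec> y) (W e))"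
  unfolding word_def trip_def psubset_eq by (intro ari df_subst[OF assms(1)] ds_subst[OF assms(2)])

definition Tw :: "'a coded_functor" where
  "Tw = \<lparr>field_of = {p. \<exists>n s. p = \<langle>n, s\<rangle> \<and> fcode s \<and> word (\<lambda>x. x \<prec> n) (\<lambda>x y. x \<prec> y) (elts s)},
    order_of = {p. \<exists>n s t. p = \<langle>n, \<langle>s, t\<rangle>\<rangle> \<and> wless (\<lambda>x y. x \<prec> y) (elts s) (elts t)},
    action_of = {p. \<exists>m n f s t. p = \<langle>m, \<langle>n, \<langle>f, \<langle>s, t\<rangle>\<rangle>\<rangle>\<rangle> \<and> fcode t \<and> elts t = rl (app f) (elts s)},
    supp_of = {p. \<exists>n s a. p = \<langle>n, \<langle>s, a\<rangle>\<rangle> \<and> fcode a \<and> elts a = sp (elts s)}\<rparr>"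

text \<open>This is the least word whose header entry is at least \<open>m\<close>: its number is
  the least possible, and since \<open>Tr \<zero>\<close> is trivial no word with this header has
  further letters.\<close>

definition muw :: "'a set" where
  "muw = {p. \<exists>n m s. p = \<langle>n, \<langle>m, s\<rangle>\<rangle> \<and> m \<prec> n \<and> fcode s \<and> elts s = {\<langle>\<zero>, \<langle>m, \<zero>\<rangle>\<rangle>}}"

lemma Tw_simps:
  "T_mem M Tw n s \<longleftrightarrow> fcode s \<and> word (\<lambda>x. x \<prec> n) (\<lambda>x y. x \<prec> y) (elts s)"
  "T_less M Tw n s t \<longleftrightarrow> wless (\<lambda>x y. x \<prec> y) (elts s) (elts t)"
  "T_map M Tw m n f s t \<longleftrightarrow> fcode t \<and> elts t = rl (app f) (elts s)"
  "T_supp M Tw n s a \<longleftrightarrow> fcode a \<and> elts a = sp (elts s)"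
  "mu_val M muw n m s \<longleftrightarrow> m \<prec> n \<and> fcode s \<and> elts s = {\<langle>\<zero>, \<langle>m, \<zero>\<rangle>\<rangle>}"
  by (simp_all add: T_mem_def T_less_def T_map_def T_supp_def mu_val_def Tw_def muw_def)

lemma Tw_sets: "field_of Tw \<in> S" "order_of Tw \<in> S" "action_of Tw \<in> S" "supp_of Tw \<in> S" "muw \<in> S"
proof -
  show "field_of Tw \<in> S" unfolding Tw_def coded_functor.simps by (rule setI, intro ari)
  show "order_of Tw \<in> S" unfolding Tw_def coded_functor.simps by (rule setI, intro ari)
  show "action_of Tw \<in> S" unfolding Tw_def coded_functor.simps by (rule setI, intro ari)
  show "supp_of Tw \<in> S" unfolding Tw_def coded_functor.simps by (rule setI, intro ari)
  show "muw \<in> S" unfolding muw_def by (rule setI, intro ari)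
qed

lemma lin_M: "lin U (\<lambda>x y. x \<prec> y)"
  unfolding linear_order_on_class_def using less_irrefl less_trans less_linear by blast

lemma nat_morphism_iff:
  assumes "nat_morphism M m n f" "x \<prec> m" "y \<prec> m"
  shows "app f x \<prec> app f y \<longleftrightarrow> x \<prec> y" "app f x = app f y \<longleftrightarrow> x = y"
  using less_linear[of x y] nat_morphismD(2)[OF assms(1), of x y] nat_morphismD(2)[OF assms(1), of y x]
    assms(2,3) less_irrefl less_trans by metis+

lemma Tw_functor: "is_functor M Tw"
  unfolding is_functor_def
proof (intro conjI allI impI)
  fix n show "lin (T_mem M Tw n) (T_less M Tw n)"
  proof -
    have e: "T_mem M Tw n = (\<lambda>s. fcode s \<and> word (\<lambda>x. x \<prec> n) (\<lambda>x y. x \<prec> y) (elts s))"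
      "T_less M Tw n = (\<lambda>s t. wless (\<lambda>x y. x \<prec> y) (elts s) (elts t))"
      by (simp_all add: fun_eq_iff Tw_simps)
    show ?thesis unfolding e
      by (rule lin_subset[OF wless_lin[OF lin_M, of "\<lambda>x. x \<prec> n"]]) (use wordD(1,2) in blast)
  qed
next
  fix m n f s assume f: "nat_morphism M m n f" and s: "T_mem M Tw m s"
  have fr: "fin (rl (app f) (elts s))" by (intro fin_rl fin_elts ari)
  show "\<exists>!t. T_map M Tw m n f s t"
    unfolding Tw_simps by (rule ex1_code[OF fr])
next
  fix m n f s t assume f: "nat_morphism M m n f" and s: "T_mem M Tw m s \<and> T_map M Tw m n f s t"
  have "word (\<lambda>x. x \<prec> n) (\<lambda>x y. x \<prec> y) (rl (app f) (elts s))"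
    by (rule word_rl[of "\<lambda>x. x \<prec> m" "\<lambda>x y. x \<prec> y"]) (use s nat_morphismD(1,2)[OF f] in \<open>auto simp: Tw_simps\<close>)
  then show "T_mem M Tw n t" using s by (simp add: Tw_simps)
next
  fix m n f s s' t t'
  assume f: "nat_morphism M m n f" and s: "T_mem M Tw m s \<and> T_mem M Tw m s' \<and> T_map M Tw m n f s t \<and>
    T_map M Tw m n f s' t' \<and> T_less M Tw m s s'"
  have tr: "trip (\<lambda>x. x \<prec> m) (elts s)" "trip (\<lambda>x. x \<prec> m) (elts s')"
    using s wordD(1) by (auto simp: Tw_simps)
  have "wless (\<lambda>x y. x \<prec> y) (rl (app f) (elts s)) (rl (app f) (elts s')) \<longleftrightarrow> wless (\<lambda>x y. x \<prec> y) (elts s) (elts s')"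
    by (rule wless_rl[OF lin_M[of "\<lambda>x. x \<prec> m"]]) (simp_all add: nat_morphism_iff[OF f] tr)
  then show "T_less M Tw n t t'" using s by (simp add: Tw_simps)
next
  fix n f s assume a: "is_identity M n f \<and> T_mem M Tw n s"
  have f: "nat_morphism M n n f" and fi: "\<And>i. i \<prec> n \<Longrightarrow> app f i = i"
    using a nat_morphismD(3)[of n n f] unfolding is_identity_def by auto
  have t: "trip (\<lambda>x. x \<prec> n) (elts s)" using a wordD(1) by (auto simp: Tw_simps)
  have "rl (app f) (elts s) = rl (\<lambda>x. x) (elts s)" by (rule rl_cong) (use fi trip_sp[OF t] in blast)
  then show "T_map M Tw n n f s s" using rl_id[OF t] a by (simp add: Tw_simps)
next
  fix l m n f g h r s t
  assume a: "is_composition M l m n f g h \<and> T_mem M Tw l r \<and> T_map M Tw l m f r s \<and> T_map M Tw m n g s t"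
  then have f: "nat_morphism M l m f" "nat_morphism M m n g" "nat_morphism M l n h"
    and c: "\<And>i j k. fapp M f i j \<Longrightarrow> fapp M g j k \<Longrightarrow> fapp M h i k" unfolding is_composition_def by blast+
  have h: "app h i = app g (app f i)" if "i \<prec> l" for i
    using c[of i "app f i" "app g (app f i)"] that nat_morphismD(1,3)[OF f(1)] nat_morphismD(3)[OF f(2)] nat_morphismD(3)[OF f(3)] by simp
  have tr: "trip (\<lambda>x. x \<prec> l) (elts r)" using a wordD(1) by (auto simp: Tw_simps)
  have "rl (app h) (elts r) = rl (\<lambda>x. app g (app f x)) (elts r)" by (rule rl_cong) (use h trip_sp[OF tr] in blast)
  then show "T_map M Tw l n h r t" using a by (simp add: Tw_simps rl_comp)
qed

lemma Tw_supports: "natural_supports M Tw"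
  unfolding natural_supports_def
proof (intro conjI allI impI)
  fix n s assume "T_mem M Tw n s"
  have f: "fin (sp (elts s))" by (intro fin_sp fin_elts)
  show "\<exists>!a. T_supp M Tw n s a"
    unfolding Tw_simps by (rule ex1_code[OF f])
next
  fix n s a assume "T_mem M Tw n s \<and> T_supp M Tw n s a"
  then show "fcode a" by (simp add: Tw_simps)
next
  fix n s a i assume a: "T_mem M Tw n s \<and> T_supp M Tw n s a" "fm i a"
  then have "i \<in> sp (elts s)" using in_elts by (auto simp: Tw_simps)
  then show "i \<prec> n" using trip_sp[of "\<lambda>x. x \<prec> n"] a(1) wordD(1) unfolding Tw_simps by blast
next
  fix m n f s t a b j
  assume a: "nat_morphism M m n f \<and> T_mem M Tw m s \<and> T_map M Tw m n f s t \<and> T_supp M Tw m s a \<and> T_supp M Tw n t b"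
  have sp: "elts b = app f ` elts a" using a by (simp add: Tw_simps sp_rl)
  have "i \<prec> m" if "i \<in> elts a" for i
    using that a trip_sp[of "\<lambda>x. x \<prec> m"] wordD(1) unfolding Tw_simps by blast
  then show "fm j b \<longleftrightarrow> (\<exists>i. fm i a \<and> fapp M f i j)"
    using sp nat_morphismD(3)[of m n f] a unfolding in_elts[symmetric] by auto
qed

text \<open>The support is the range of \<open>f\<close>, so the word can be relabelled by the
  inverse \<open>g\<close> of \<open>f\<close>, which is increasing there.\<close>

lemma Tw_support_condition: "support_condition M Tw"
  unfolding support_condition_def
proof (intro allI impI)
  fix n s a k f
  assume as: "T_mem M Tw n s \<and> T_supp M Tw n s a \<and> fin_card M a k \<and> nat_morphism M k n f \<and>
    (\<forall>j. fm j a \<longleftrightarrow> (\<exists>i. fapp M f i j))"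
  then have f: "nat_morphism M k n f" and w: "fcode s" "word (\<lambda>x. x \<prec> n) (\<lambda>x y. x \<prec> y) (elts s)"
    and a: "elts a = sp (elts s)" by (simp_all add: Tw_simps)
  note fD = nat_morphismD[OF f] and fi = nat_morphism_iff[OF f]
  define g where "g x = the0 (\<lambda>i. i \<prec> k \<and> app f i = x)" for x
  have dg: "df (\<lambda>e. g (e 0))" unfolding g_def by (intro ari)
  have g: "g x \<prec> k \<and> app f (g x) = x" if x: "x \<in> sp (elts s)" for x
  proof -
    have "fm x a" using x a in_elts by blast
    moreover have "\<forall>j. fm j a \<longleftrightarrow> (\<exists>i. fapp M f i j)" using as by simp
    ultimately obtain i where "fapp M f i x" by blast
    then have i: "i \<prec> k" "app f i = x" using fD(3) by auto
    have "g x = i" unfolding g_def by (rule the0_eq) (use i fi(2) in auto)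
    then show ?thesis using i by simp
  qed
  have fr: "fin (rl g (elts s))" by (intro fin_rl fin_elts dg)
  let ?s = "code (rl g (elts s))"
  have "word (\<lambda>x. x \<prec> k) (\<lambda>x y. x \<prec> y) (rl g (elts s))"
  proof (rule word_rl[OF word_restrict[OF w(2)]])
    show "g x \<prec> g y" if "x \<in> sp (elts s)" "y \<in> sp (elts s)" "x \<prec> y" for x y
      using fi(1)[of "g x" "g y"] g[OF that(1)] g[OF that(2)] that(3) by simp
  qed (use g in blast)
  then have 1: "T_mem M Tw k ?s" using code_props[OF fr] by (simp add: Tw_simps)
  have "rl (app f) (rl g (elts s)) = rl (\<lambda>x. x) (elts s)" unfolding rl_comp by (rule rl_cong) (use g in blast)
  then have 2: "T_map M Tw k n f ?s s" using code_props[OF fr] rl_id[OF wordD(1)[OF w(2)]] w(1) by (simp add: Tw_simps)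
  show "\<exists>s'. T_mem M Tw k s' \<and> T_map M Tw k n f s' s" using 1 2 by blast
qed

lemma Tw_prae: "coded_prae_dilator M Tw"
  unfolding coded_prae_dilator_def using Tw_sets Tw_functor Tw_supports Tw_support_condition by blast

text \<open>All entries of a nonempty word are bounded by its header entry \<open>b\<close>, so that
  both sides say \<open>b \<prec> m\<close>. The empty word comes first and has empty
  support.\<close>

lemma header_wless:
  assumes fW: "fin W" and W: "word (\<lambda>x. x \<prec> n) (\<lambda>x y. x \<prec> y) W"
  shows "wless (\<lambda>x y. x \<prec> y) W {\<langle>\<zero>, \<langle>m, \<zero>\<rangle>\<rangle>} \<longleftrightarrow> (\<forall>i\<in>sp W. i \<prec> m)"
proof -
  note w = wordD[OF W]
  have s0: "slot {\<langle>\<zero>, \<langle>m, \<zero>\<rangle>\<rangle>} \<zero> = {\<langle>m, \<zero>\<rangle>}" by (auto simp: slot_def)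
  have s1: "slot {\<langle>\<zero>, \<langle>m, \<zero>\<rangle>\<rangle>} j = {}" if "j \<noteq> \<zero>" for j using that by (auto simp: slot_def)
  show ?thesis
  proof (cases "slot W \<zero> = {}")
    case True
    then have "W = {}" by (rule word_slot0[OF W])
    moreover have "wless (\<lambda>x y. x \<prec> y) {} {\<langle>\<zero>, \<langle>m, \<zero>\<rangle>\<rangle>}"
      unfolding wless_def by (rule exI[of _ \<zero>]) (simp add: sless_def s0, simp add: slot_def)
    ultimately show ?thesis by (simp add: sp_def)
  next
    case False
    then obtain b v where b: "slot W \<zero> = {\<langle>b, v\<rangle>}" using slt_slot[OF w(1,2), of \<zero>] by (auto simp: slt_def)
    then have bW: "\<langle>\<zero>, \<langle>b, v\<rangle>\<rangle> \<in> W" using slot_iff[of "\<langle>b, v\<rangle>" W \<zero>] by simp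
    have "sless (\<lambda>x y. x \<prec> y) \<zero> (slot W \<zero>) {\<langle>m, \<zero>\<rangle>} \<longleftrightarrow> b \<prec> m" by (simp add: b sless_def lless_def)
    \<comment> \<open>A proper extension of a header would come before it, as missing letters are
      largest at later positions. For the number \<open>\<zero>\<close> such extensions are excluded
      by \<open>Tr_0\<close>.\<close>
    moreover have "\<not> sless (\<lambda>x y. x \<prec> y) j (slot W j) {}" if e: "slot W \<zero> = {\<langle>m, \<zero>\<rangle>}" and "j \<noteq> \<zero>" for j
    proof -
      obtain i where i: "j = i \<oplus> \<one>" using zero_or_succ[of j] \<open>j \<noteq> \<zero>\<close> by blast
      have "v = \<zero>" using b e by simp
      then have "Tr \<zero> (code (tree W))" using w(3)[OF bW] by simp
      then have e: "elts (code (tree W)) = {}" by (rule Tr_0)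
      have "slot W j = {}"
      proof (rule ccontr)
        assume "slot W j \<noteq> {}"
        then obtain y where y: "\<langle>i \<oplus> \<one>, y\<rangle> \<in> W" using i by (auto simp: slot_def)
        obtain x u where "y = \<langle>x, u\<rangle>" using trip_mem[OF w(1) y] by blast
        then have "\<langle>i, u\<rangle> \<in> tree W" using y unfolding tree_def by blast
        then show False using e elts_code[OF fin_tree[OF fW]] by auto
      qed
      then show ?thesis by (simp add: sless_def)
    qed
    ultimately have 1: "wless (\<lambda>x y. x \<prec> y) W {\<langle>\<zero>, \<langle>m, \<zero>\<rangle>\<rangle>} \<longleftrightarrow> b \<prec> m"
      unfolding wless_def using s0 s1 zero_le by (metis zero_least)
    have "(\<forall>i\<in>sp W. i \<prec> m) \<longleftrightarrow> b \<prec> m"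
    proof
      show "b \<prec> m" if "\<forall>i\<in>sp W. i \<prec> m" using that bW sp_iff[OF w(1)] by blast
      show "\<forall>i\<in>sp W. i \<prec> m" if bm: "b \<prec> m"
      proof
        fix x assume "x \<in> sp W"
        then obtain j u where j: "\<langle>j, \<langle>x, u\<rangle>\<rangle> \<in> W" using sp_iff[OF w(1)] by blast
        show "x \<prec> m"
        proof (cases "j = \<zero>")
          case True
          then have "\<langle>x, u\<rangle> \<in> slot W \<zero>" using j by (simp add: slot_iff)
          then show ?thesis using b bm by simp
        next
          case False
          then obtain i where "j = i \<oplus> \<one>" using zero_or_succ[of j] by blast
          then have "x \<prec> b" using w(4)[OF bW] j by blast
          then show ?thesis using bm less_trans by blast
        qed
      qed
    qed
    then show ?thesis using 1 by simp
  qed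
qed

section \<open>Descending sequences of words\<close>

lemma Tw_normal: "normal_prae_dilator M Tw muw"
  unfolding normal_prae_dilator_def
proof (intro conjI allI impI)
  show "coded_prae_dilator M Tw" "muw \<in> S" by (rule Tw_prae, rule Tw_sets(5))
  fix n m assume "m \<prec> n"
  then show "\<exists>!s. mu_val M muw n m s" unfolding Tw_simps using ex1_code[OF fin_single] by simp
next
  fix n m s assume "m \<prec> n \<and> mu_val M muw n m s"
  then show "T_mem M Tw n s" using word_header[of "\<lambda>x. x \<prec> n" m] by (simp add: Tw_simps)
next
  fix n m m' s s' assume a: "m \<prec> m' \<and> m' \<prec> n \<and> mu_val M muw n m s \<and> mu_val M muw n m' s'"
  have "slot {\<langle>\<zero>, \<langle>m, \<zero>\<rangle>\<rangle>} \<zero> = {\<langle>m, \<zero>\<rangle>}" for m by (auto simp: slot_def)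
  then show "T_less M Tw n s s'"
    using a unfolding Tw_simps wless_def by (intro exI[of _ \<zero>]) (auto simp: sless_def lless_def)
next
  fix m n f i j s t assume a: "nat_morphism M m n f \<and> fapp M f i j \<and> mu_val M muw m i s \<and> mu_val M muw n j t"
  then have "j = app f i" using nat_morphismD(3) by blast
  then show "T_map M Tw m n f s t" using a by (simp add: Tw_simps rl_def)
next
  fix n m s r a assume "m \<prec> n \<and> T_mem M Tw n s \<and> mu_val M muw n m r \<and> T_supp M Tw n s a"
  then show "T_less M Tw n s r \<longleftrightarrow> (\<forall>i. fm i a \<longrightarrow> i \<prec> m)"
    using header_wless[OF fin_elts, of n s m] by (auto simp: Tw_simps simp flip: in_elts)
qed

end

section \<open>Elements of \<open>D_mem M Tw X\<close> as words over \<open>X\<close>\<close>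

locale wtrees = trees +
  fixes X R
  assumes XS: "X \<in> S" and RS: "R \<in> S" and linX: "lin (\<lambda>x. x \<in> X) (rel M R)"

sublocale wtrees \<subseteq> dorder M Tw "\<lambda>x. x \<in> X" "rel M R"
proof
  show "coded_prae_dilator M Tw" by (rule Tw_prae)
  show "lin (\<lambda>x. x \<in> X) (rel M R)" by (rule linX)
  show "ar (\<lambda>e. rel M R (e 0) (e (Suc 0)))" by (intro ari RS)
qed

context wtrees
begin

abbreviation "r \<equiv> rel M R"
abbreviation "wordX \<equiv> word (\<lambda>x. x \<in> X) r"

text \<open>The word over \<open>X\<close> for which the pair \<open>\<langle>a, s\<rangle>\<close>
  stands: indices are replaced by the elements of \<open>a\<close> that they denote.\<close>

definition un where "un a s = rl (en r a) (elts s)"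

lemma ds_un[ari]: assumes "df a" "df s" shows "ds (\<lambda>e. un (a e) (s e))"
  unfolding un_def by (intro ari assms df_subst[OF assms(1)])

lemma D_pair_word:
  assumes "D_pair M Tw (\<lambda>x. x \<in> X) a s"
  shows "fs a" "word (\<lambda>x. x \<prec> cd a) (\<lambda>x y. x \<prec> y) (elts s)" "sp (elts s) = {i. i \<prec> cd a}" "fcode s"
proof -
  have d: "fs a" "mem (cd a) s" "elts (supp (cd a) s) = {i. i \<prec> cd a}" using assms by (simp_all add: D_pair_iff)
  show "fs a" by (rule d)
  show "word (\<lambda>x. x \<prec> cd a) (\<lambda>x y. x \<prec> y) (elts s)" "fcode s" using d(2) by (simp_all add: Tw_simps)
  have "ts (cd a) s (supp (cd a) s)" by (simp add: supp(1)[OF d(2)])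
  then show "sp (elts s) = {i. i \<prec> cd a}" using d(3) by (simp add: Tw_simps)
qed

lemma un_word:
  assumes "D_pair M Tw (\<lambda>x. x \<in> X) a s"
  shows "wordX (un a s)" "fin (un a s)" "sp (un a s) = elts a"
proof -
  note d = D_pair_word[OF assms]
  show "wordX (un a s)" unfolding un_def
    by (rule word_rl[OF d(2)]) (use enD(1,3)[OF d(1)] d(1) in \<open>auto simp: fs_def\<close>)
  show "fin (un a s)" unfolding un_def by (intro fin_rl fin_elts ari)
  show "sp (un a s) = elts a" unfolding un_def sp_rl d(3) using enD(1,2)[OF d(1)] by blast
qed

lemma un_val:
  assumes a: "D_pair M Tw (\<lambda>x. x \<in> X) a s" and d: "fs d" "elts a \<subseteq> elts d"
  shows "rl (en r d) (elts (val a d s)) = un a s"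
proof -
  note w = D_pair_word[OF a]
  have m: "mem (cd a) s" using w by (simp add: Tw_simps)
  have "tm (cd a) (cd d) (im a d) s (val a d s)"
    unfolding val_def by (simp add: act(1)[OF im_morphism[OF w(1) d] m])
  then have e: "elts (val a d s) = rl (app (im a d)) (elts s)" by (simp add: Tw_simps)
  have "en r d (app (im a d) x) = en r a x" if "x \<in> sp (elts s)" for x
    using that inc(2)[OF w(1) d, of x] gr_simps(5)[OF df_inc0, of x "cd a" a d] unfolding w(3) im_def by simp
  then show ?thesis unfolding e rl_comp un_def by (rule rl_cong)
qed

text \<open>Both pairs are evaluated over a common finite set \<open>d\<close>, whose enumeration is
  an order embedding and turns the values into the two words.\<close>

lemma D_compare_un:
  assumes a: "D_pair M Tw (\<lambda>x. x \<in> X) a s" and b: "D_pair M Tw (\<lambda>x. x \<in> X) b t"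
  shows "D_compare M Tw r a s b t \<longleftrightarrow> wless r (un a s) (un b t)"
proof -
  obtain d where d: "fs d" "elts a \<subseteq> elts d" "elts b \<subseteq> elts d"
    by (rule D_fs_union[OF a b b]) (rule that)
  have t: "trip (\<lambda>x. x \<prec> cd d) (elts (val a d s))" "trip (\<lambda>x. x \<prec> cd d) (elts (val b d t))"
    using val_props(1)[OF a d(1,2)] val_props(1)[OF b d(1,3)] wordD(1) by (auto simp: Tw_simps)
  have "wless r (rl (en r d) (elts (val a d s))) (rl (en r d) (elts (val b d t))) \<longleftrightarrow>
    wless (\<lambda>x y. x \<prec> y) (elts (val a d s)) (elts (val b d t))"
    by (rule wless_rl[OF lin_M[of "\<lambda>x. x \<prec> cd d"]]) (simp_all add: enD(4,5)[OF d(1)] t)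
  then show ?thesis
    unfolding D_compare_iff[OF a b d] Tw_simps un_val[OF a d(1,2)] un_val[OF b d(1,3)] by simp
qed

lemma wlessX_irrefl: assumes "wordX W" shows "\<not> wless r W W"
  using sless_irrefl[OF linX slt_slot[OF wordD(1,2)[OF assms]]] by (auto simp: wless_def)

end

locale wf_wtrees = wtrees +
  assumes wf: "well_founded_set M X R"
begin

lemma wfD:
  assumes "df (\<lambda>e. F (e 0))" "\<And>n. F n \<in> X" "\<And>n. r (F (n \<oplus> \<one>)) (F n)" shows False
proof -
  let ?F = "{p. \<exists>n. p = \<langle>n, F n\<rangle>}"
  have "?F \<in> S" by (rule setI, intro ari df_comp1[OF assms(1)])
  moreover have "\<forall>n. \<exists>!x. \<langle>n, x\<rangle> \<in> ?F" "\<forall>n x. \<langle>n, x\<rangle> \<in> ?F \<longrightarrow> x \<in> X"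
    "\<forall>n x y. \<langle>n, x\<rangle> \<in> ?F \<and> \<langle>n \<oplus> \<one>, y\<rangle> \<in> ?F \<longrightarrow> r y x"
    using assms(2,3) by simp_all
  ultimately show False using wf unfolding well_founded_set_def well_founded_on_class_def by blast
qed

text \<open>Well-foundedness only excludes descending sequences in the model. Without a minimal
  element, such a sequence arises by passing repeatedly to the numerically least \<open>z\<close>
  below the current element.\<close>

lemma min_ex:
  assumes B: "B \<in> S" "B \<subseteq> X" "x \<in> B" shows "\<exists>y\<in>B. \<forall>z\<in>B. \<not> r z y"
proof (rule ccontr)
  assume "\<not> ?thesis"
  then have ex: "\<exists>z. z \<in> B \<and> r z y" if "y \<in> B" for y using that by blast
  define G where "G y = the0 (\<lambda>z. (z \<in> B \<and> r z y) \<and> (\<forall>u. u \<prec> z \<longrightarrow> \<not> (u \<in> B \<and> r u y)))" for y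
  have dG: "df (\<lambda>e. G (e 0))" unfolding G_def by (intro ari B RS)
  have G: "G y \<in> B \<and> r (G y) y" if y: "y \<in> B" for y
  proof -
    obtain z where z: "z \<in> B \<and> r z y" using ex[OF y] by blast
    have "ar (\<lambda>e. e 0 \<in> B \<and> r (e 0) y)" by (intro ari B RS)
    then obtain k where k: "k \<in> B \<and> r k y" "\<And>m. m \<prec> k \<Longrightarrow> \<not> (m \<in> B \<and> r m y)"
      by (rule least[of "\<lambda>z. z \<in> B \<and> r z y", OF _ z]) (rule that)
    have "G y = k" unfolding G_def
    proof (rule the0_eq)
      fix u assume u: "(u \<in> B \<and> r u y) \<and> (\<forall>v. v \<prec> u \<longrightarrow> \<not> (v \<in> B \<and> r v y))"
      show "u = k" using less_linear[of u k] u k by blast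
    qed (use k in simp)
    then show ?thesis using k(1) by simp
  qed
  obtain F where F: "df (\<lambda>e. F (e 0) (e (Suc 0)))" "\<And>K. F K \<zero> = x" "\<And>K n. F K (n \<oplus> \<one>) = G (F K n)"
  proof (rule primrec_ex[of "\<lambda>K. x" "\<lambda>K n y. G y", OF df_const])
    show "df (\<lambda>e. G (e (Suc (Suc 0))))" by (rule df_comp1[OF dG df_var])
  qed (rule that)
  have FB: "F \<zero> n \<in> B" for n
  proof (rule ind[of "\<lambda>n. F \<zero> n \<in> B"])
    show "ar (\<lambda>e. F \<zero> (e 0) \<in> B)" by (intro ari B df_comp2[OF F(1)])
  qed (use F B G in simp_all)
  show False
  proof (rule wfD[of "F \<zero>"])
    show "df (\<lambda>e. F \<zero> (e 0))" by (intro df_comp2[OF F(1)] ari)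
    show "F \<zero> n \<in> X" for n using FB B by blast
    show "r (F \<zero> (n \<oplus> \<one>)) (F \<zero> n)" for n using G[OF FB] F(3) by simp
  qed
qed

text \<open>The entry is minimised in \<open>X\<close> first, then the number among letters with
  this entry.\<close>

lemma letter_min_ex:
  assumes B: "B \<in> S" "\<And>y. y \<in> B \<Longrightarrow> \<exists>x v. y = \<langle>x, v\<rangle> \<and> x \<in> X" "y \<in> B"
  shows "\<exists>y\<in>B. \<forall>z\<in>B. \<not> lless r z y"
proof -
  have "pi1 ` B \<in> S" by (rule setI, intro ari B)
  moreover have "pi1 ` B \<subseteq> X" using B(2) by force
  ultimately have "\<exists>y\<in>pi1 ` B. \<forall>z\<in>pi1 ` B. \<not> r z y" by (rule min_ex[OF _ _ imageI[OF B(3)]])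
  then obtain x where x: "x \<in> pi1 ` B" "\<forall>z\<in>pi1 ` B. \<not> r z x" by (elim bexE) (rule that)
  then obtain v where v: "\<langle>x, v\<rangle> \<in> B" using B(2) by force
  have "ar (\<lambda>e. \<langle>x, e 0\<rangle> \<in> B)" by (intro ari B)
  then obtain u where u: "\<langle>x, u\<rangle> \<in> B" "\<And>w. w \<prec> u \<Longrightarrow> \<not> \<langle>x, w\<rangle> \<in> B"
    by (rule least[of "\<lambda>v. \<langle>x, v\<rangle> \<in> B", OF _ v]) (rule that)
  have "\<not> lless r z \<langle>x, u\<rangle>" if z: "z \<in> B" for z
  proof -
    obtain x' w where w: "z = \<langle>x', w\<rangle>" using B(2)[OF z] by blast
    have "x' \<in> pi1 ` B" using z w by force
    then show ?thesis using x(2) u(2)[of w] z w by (auto simp: lless_def)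
  qed
  then show ?thesis using u(1) by blast
qed

text \<open>A descending sequence of words converges to an infinite word, which yields a path through one tree and
  a ranking of the preceding tree in \<open>X\<close>.\<close>

lemma words_wf:
  assumes prog: "\<And>n. (\<nexists>p. path n p) \<Longrightarrow> (\<nexists>p. path (n \<oplus> \<one>) p)"
    and w: "df (\<lambda>e. w (e 0))" "\<And>k. wordX (elts (w k))" "\<And>k. wless r (elts (w (k \<oplus> \<one>))) (elts (w k))"
  shows False
proof -
  define s where "s k j = slot (elts (w k)) j" for k j
  have ds_s: "ds (\<lambda>e. s (f e) (g e))" if "df f" "df g" for f g
    unfolding s_def by (intro ari df_comp1[OF w(1)] that)
  have sl: "slt (\<lambda>x. x \<in> X) (s k j)" for k j unfolding s_def by (rule slt_slot[OF wordD(1,2)[OF w(2)]])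
  have irr: "\<not> sless r j (s k i) (s k i)" for k i j by (rule sless_irrefl[OF linX sl])
  have down: "s k j = {}" if "s k i = {}" "i \<prec> j \<or> i = j" for k i j
    using wordD(2)[OF w(2)[of k]] that unfolding s_def slot_def seq_def by blast
  have wl: "\<exists>j. (\<forall>i. i \<prec> j \<longrightarrow> s (k \<oplus> \<one>) i = s k i) \<and> sless r j (s (k \<oplus> \<one>) j) (s k j)" for k
    using w(3)[of k] unfolding wless_def s_def .
  \<comment> \<open>The empty word is the least one, so nothing can follow it in a descending
    sequence.\<close>
  have ne0: "s k \<zero> \<noteq> {}" for k
  proof
    assume e: "s k \<zero> = {}"
    then have ej: "s k j = {}" for j using down zero_le by blast
    obtain j where j: "\<forall>i. i \<prec> j \<longrightarrow> s (k \<oplus> \<one>) i = s k i" "sless r j (s (k \<oplus> \<one>) j) (s k j)" using wl by blast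
    then have j0: "j \<noteq> \<zero>" "s (k \<oplus> \<one>) j \<noteq> {}" unfolding ej sless_def by auto
    then have "\<zero> \<prec> j" using zero_le[of j] by blast
    then have "s (k \<oplus> \<one>) \<zero> = {}" using j(1) ej by simp
    then show False using down[of "k \<oplus> \<one>" \<zero> j] zero_le[of j] j0 by blast
  qed
  \<comment> \<open>From some stage on, the first \<open>l\<close> slots do not change. This is an
    arithmetical statement about the sequence, hence open to induction on \<open>l\<close>.\<close>
  let ?P = "\<lambda>l. \<exists>K. \<forall>k. K \<preceq> k \<longrightarrow> (\<forall>i. i \<prec> l \<longrightarrow> s k i = s K i)"
  have P: "?P l" for l
  proof (rule ind[of ?P])
    show "ar (\<lambda>e. ?P (e 0))" by (intro ari ds_s)
    show "?P \<zero>" by simp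
    fix l assume "?P l"
    then obtain K where K: "\<And>k i. K \<preceq> k \<Longrightarrow> i \<prec> l \<Longrightarrow> s k i = s K i" by blast
    have st: "s (k \<oplus> \<one>) l = s k l \<or> sless r l (s (k \<oplus> \<one>) l) (s k l)" if k: "K \<preceq> k" for k
    proof -
      obtain j where j: "\<forall>i. i \<prec> j \<longrightarrow> s (k \<oplus> \<one>) i = s k i" "sless r j (s (k \<oplus> \<one>) j) (s k j)" using wl by blast
      have k1: "K \<preceq> k \<oplus> \<one>" using k by auto
      have "s (k \<oplus> \<one>) j = s k j" if "j \<prec> l" using K[OF k that] K[OF k1 that] by simp
      then have "\<not> j \<prec> l" using j(2) irr by metis
      then show ?thesis using j less_linear[of l j] by auto
    qed
    \<comment> \<open>Once the first \<open>l\<close> slots are constant, slot \<open>l\<close> can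
      only descend. A minimal letter among those that still occur there is kept forever; it could be
      deleted only at position \<open>\<zero>\<close>, which \<open>ne0\<close> excludes.\<close>
    let ?B = "{y. \<exists>k. K \<preceq> k \<and> y \<in> s k l}"
    have BS: "?B \<in> S" by (rule setI, intro ari ds_s)
    show "?P (l \<oplus> \<one>)"
    proof (cases "?B = {}")
      case True
      then have "s k l = {}" if "K \<preceq> k" for k using that by blast
      then have "s k i = s K i" if "K \<preceq> k" "i \<prec> l \<oplus> \<one>" for k i using K[OF that(1)] that by auto
      then show ?thesis by blast
    next
      case False
      then obtain y0 where y0: "y0 \<in> ?B" by blast
      have lX: "\<exists>x v. y = \<langle>x, v\<rangle> \<and> x \<in> X" if "y \<in> ?B" for y
        using that sl unfolding slt_def by force
      obtain y where y: "y \<in> ?B" "\<forall>z\<in>?B. \<not> lless r z y" using letter_min_ex[OF BS lX y0] by blast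
      then obtain k2 where k2: "K \<preceq> k2" "y \<in> s k2 l" by blast
      have sing: "s k l = {y}" if "y \<in> s k l" for k using sl[of k l] that by (auto simp: slt_def)
      have "s (k2 \<oplus> d) l = {y}" for d
      proof (rule ind[of "\<lambda>d. s (k2 \<oplus> d) l = {y}"])
        show "ar (\<lambda>e. s (k2 \<oplus> e 0) l = {y})" by (intro ari ds_s)
        show "s (k2 \<oplus> \<zero>) l = {y}" using sing[OF k2(2)] by simp
        fix d assume IH: "s (k2 \<oplus> d) l = {y}"
        have Kd: "K \<preceq> k2 \<oplus> d" by (rule le_trans[OF k2(1) le_add])
        have "\<not> sless r l (s (k2 \<oplus> d \<oplus> \<one>) l) {y}"
        proof
          assume "sless r l (s (k2 \<oplus> d \<oplus> \<one>) l) {y}"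
          then consider z where "z \<in> s (k2 \<oplus> d \<oplus> \<one>) l" "lless r z y" | "l = \<zero>" "s (k2 \<oplus> d \<oplus> \<one>) l = {}"
            by (auto simp: sless_def)
          then show False
          proof cases
            case 1
            moreover have "K \<preceq> k2 \<oplus> d \<oplus> \<one>" using Kd by auto
            ultimately show ?thesis using y(2) by blast
          qed (use ne0 in blast)
        qed
        then show "s (k2 \<oplus> (d \<oplus> \<one>)) l = {y}" using st[OF Kd] IH by (simp add: bas(4))
      qed
      then have sy: "s k l = {y}" if "k2 \<preceq> k" for k
        using that unfolding less_iff by (metis add_zero)
      have "s k i = s k2 i" if "k2 \<preceq> k" "i \<prec> l \<oplus> \<one>" for k i
        using K[OF le_trans[OF k2(1) that(1)]] K[OF k2(1)] sy[OF that(1)] sy[of k2] that(2) by auto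
      then show ?thesis by blast
    qed
  qed
  have ex1: "\<exists>y K. \<forall>k. K \<preceq> k \<longrightarrow> s k l = {y}" for l
  proof -
    obtain K where K: "\<And>k i. K \<preceq> k \<Longrightarrow> i \<prec> l \<oplus> \<one> \<Longrightarrow> s k i = s K i" using P[of "l \<oplus> \<one>"] by blast
    \<comment> \<open>If slot \<open>l\<close> were empty at stage \<open>K\<close>, then the next
      word would agree with this one in the first \<open>l\<close> slots and have none after them
      either, so it could not be smaller.\<close>
    have "s K l \<noteq> {}"
    proof
      assume e: "s K l = {}"
      obtain j where j: "sless r j (s (K \<oplus> \<one>) j) (s K j)" using wl by blast
      have KK: "K \<preceq> K \<oplus> \<one>" by simp
      have "s (K \<oplus> \<one>) j = s K j"
      proof (cases "j \<prec> l")
        case False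
        have "s (K \<oplus> \<one>) l = {}" using K[OF KK, of l] e by simp
        then show ?thesis using down[OF e, of j] down[of "K \<oplus> \<one>" l j] False not_less by simp
      qed (use K[OF KK, of j] in simp)
      then show False using j irr by metis
    qed
    then obtain y where y: "s K l = {y}" using sl[of K l] by (auto simp: slt_def)
    have "s k l = {y}" if "K \<preceq> k" for k using K[OF that, of l] y by simp
    then show ?thesis by blast
  qed
  define p where "p l = the0 (\<lambda>y. \<exists>K. \<forall>k. K \<preceq> k \<longrightarrow> s k l = {y})" for l
  have dp: "df (\<lambda>e. p (e 0))" unfolding p_def by (intro ari ds_s)
  have p: "\<exists>K. \<forall>k. K \<preceq> k \<longrightarrow> s k l = {p l}" for l
  proof -
    have "y = z" if "\<forall>k. K \<preceq> k \<longrightarrow> s k l = {y}" "\<forall>k. K' \<preceq> k \<longrightarrow> s k l = {z}" for y z K K'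
    proof -
      have "s (K \<oplus> K') l = {y}" "s (K \<oplus> K') l = {z}" using that le_add le_add2 by blast+
      then show ?thesis by simp
    qed
    then have "\<exists>!y. \<exists>K. \<forall>k. K \<preceq> k \<longrightarrow> s k l = {y}" using ex1[of l] by (intro ex_ex1I) blast+
    then show ?thesis unfolding p_def by (rule the0I)
  qed
  \<comment> \<open>Every finite part of the limit \<open>p\<close> occurs in one of the words and
    thereby inherits the conditions on words.\<close>
  have H: "\<exists>W. wordX W \<and> fin W \<and> (\<forall>i y. i \<prec> l \<oplus> \<one> \<longrightarrow> (\<langle>i, y\<rangle> \<in> W \<longleftrightarrow> y = p i))" for l
  proof -
    obtain K where K: "\<And>k i. K \<preceq> k \<Longrightarrow> i \<prec> l \<oplus> \<one> \<Longrightarrow> s k i = s K i" using P[of "l \<oplus> \<one>"] by blast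
    have "s K i = {p i}" if i: "i \<prec> l \<oplus> \<one>" for i
    proof -
      obtain K' where "\<forall>k. K' \<preceq> k \<longrightarrow> s k i = {p i}" using p by blast
      then have "s (K \<oplus> K') i = {p i}" using le_add2 by blast
      then show ?thesis using K[OF le_add i, of K'] by simp
    qed
    then have "\<forall>i y. i \<prec> l \<oplus> \<one> \<longrightarrow> (\<langle>i, y\<rangle> \<in> elts (w K) \<longleftrightarrow> y = p i)"
      unfolding s_def slot_def by blast
    then show ?thesis using w(2) fin_elts by blast
  qed
  define g where "g j = pi1 (p (j \<oplus> \<one>))" for j
  define t where "t j = pi2 (p (j \<oplus> \<one>))" for j
  have dg: "df (\<lambda>e. g (e 0))" and dt: "df (\<lambda>e. t (e 0))"
    unfolding g_def t_def by (intro ari df_comp1[OF dp])+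
  have pX: "\<exists>x v. p i = \<langle>x, v\<rangle> \<and> x \<in> X" for i
  proof -
    obtain W where W: "wordX W" "\<forall>j y. j \<prec> i \<oplus> \<one> \<longrightarrow> (\<langle>j, y\<rangle> \<in> W \<longleftrightarrow> y = p j)" using H[of i] by blast
    then have "\<langle>i, p i\<rangle> \<in> W" by simp
    then show ?thesis using trip_mem[OF wordD(1)[OF W(1)]] by blast
  qed
  have pj: "p (j \<oplus> \<one>) = \<langle>g j, t j\<rangle>" "g j \<in> X" for j
    using pX[of "j \<oplus> \<one>"] unfolding g_def t_def by auto
  obtain b n where b: "p \<zero> = \<langle>b, n\<rangle>" using pX by blast
  have W: "\<exists>W. wordX W \<and> fin W \<and> \<langle>\<zero>, \<langle>b, n\<rangle>\<rangle> \<in> W \<and> (\<forall>i y. i \<prec> l \<longrightarrow> (\<langle>i \<oplus> \<one>, y\<rangle> \<in> W \<longleftrightarrow> y = \<langle>g i, t i\<rangle>))" for l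
  proof -
    obtain W where W: "wordX W" "fin W" "\<forall>i y. i \<prec> l \<oplus> \<one> \<longrightarrow> (\<langle>i, y\<rangle> \<in> W \<longleftrightarrow> y = p i)" using H[of l] by blast
    have "\<langle>\<zero>, \<langle>b, n\<rangle>\<rangle> \<in> W" using mp[OF spec[OF spec[OF W(3), of \<zero>], of "\<langle>b, n\<rangle>"] zero_less_succ] b by simp
    moreover have "\<langle>i \<oplus> \<one>, y\<rangle> \<in> W \<longleftrightarrow> y = \<langle>g i, t i\<rangle>" if "i \<prec> l" for i y
      using spec[OF W(3), of "i \<oplus> \<one>"] that pj(1)[of i] unfolding succ_less by simp
    ultimately show ?thesis using W(1,2) by blast
  qed
  have "path n t" unfolding path_def
  proof (intro conjI allI dt)
    fix m
    obtain W where W: "wordX W" "fin W" "\<langle>\<zero>, \<langle>b, n\<rangle>\<rangle> \<in> W" "\<And>i y. i \<prec> m \<Longrightarrow> \<langle>i \<oplus> \<one>, y\<rangle> \<in> W \<longleftrightarrow> y = \<langle>g i, t i\<rangle>"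
      using W[of m] by blast
    have "Tr n (code (initial m (tree W)))"
      using Tr_initial[OF wordD(3)[OF W(1,3)], of m] elts_code[OF fin_tree[OF W(2)]] by simp
    moreover have "initial m (tree W) = (\<lambda>i. \<langle>i, t i\<rangle>) ` {i. i \<prec> m}"
    proof -
      have "\<langle>i, v\<rangle> \<in> tree W \<longleftrightarrow> v = t i" if "i \<prec> m" for i v
        unfolding tree_def using W(4)[OF that] by auto
      then show ?thesis unfolding initial_def by auto
    qed
    ultimately show "Tr n (gr m t)" unfolding gr_def by simp
  qed
  then have tr: "Tr n (gr m t)" for m unfolding path_def by blast
  have "n \<noteq> \<zero>"
  proof
    assume "n = \<zero>"
    then have "elts (gr (\<zero> \<oplus> \<one>) t) = {}" using tr[of "\<zero> \<oplus> \<one>"] Tr_0 by blast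
    then show False using zero_less_succ[of \<zero>] unfolding gr_simps(2)[OF dt] by auto
  qed
  \<comment> \<open>Since the formula is progressive, the path at
    \<open>n = k \<oplus> \<one>\<close> forces a path \<open>q\<close> through \<open>Tr k\<close>.
    Along its initial segments the ranks \<open>g\<close> descend in \<open>X\<close>.\<close>
  then obtain k where k: "n = k \<oplus> \<one>" using zero_or_succ by blast
  then obtain q where q: "df (\<lambda>e. q (e 0))" "\<And>m. Tr k (gr m q)"
    using prog[of k] \<open>path n t\<close> unfolding path_def by blast
  show False
  proof (rule wfD[of "\<lambda>m. g (gr m q)"])
    show "df (\<lambda>e. g (gr (e 0) q))" by (intro df_comp1[OF dg] ari df_comp1[OF q(1)])
    show "g (gr m q) \<in> X" for m by (rule pj(2))
    show "r (g (gr (m \<oplus> \<one>) q)) (g (gr m q))" for m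
    proof -
      let ?i = "gr m q" and ?j = "gr (m \<oplus> \<one>) q"
      \<comment> \<open>The part of the limit has to contain the positions \<open>?i\<close> and
        \<open>?j\<close>, which are codes of nodes.\<close>
      have l: "?i \<prec> ?i \<oplus> ?j \<oplus> \<one>" "?j \<prec> ?i \<oplus> ?j \<oplus> \<one>" using le_add[of ?i ?j] le_add2[of ?j ?i] by auto
      obtain W where W: "wordX W" "\<langle>\<zero>, \<langle>b, n\<rangle>\<rangle> \<in> W"
        "\<And>i y. i \<prec> ?i \<oplus> ?j \<oplus> \<one> \<Longrightarrow> \<langle>i \<oplus> \<one>, y\<rangle> \<in> W \<longleftrightarrow> y = \<langle>g i, t i\<rangle>" using W by blast
      have "elts ?i \<subset> elts ?j" by (rule gr_psubset[OF q(1)])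
      then show ?thesis
        using wordD(5)[OF W(1) W(2)[unfolded k] q(2) q(2)] W(3)[OF l(1)] W(3)[OF l(2)] by blast
    qed
  qed
qed

end

context trees
begin

lemma Tw_dilator:
  assumes prog: "\<And>n. (\<nexists>p. path n p) \<Longrightarrow> (\<nexists>p. path (n \<oplus> \<one>) p)"
  shows "coded_dilator M Tw"
  unfolding coded_dilator_def
proof (intro conjI ballI impI Tw_prae)
  fix X R assume XR: "X \<in> S" "R \<in> S" "well_order_set M X R"
  interpret wf_wtrees M Tr X R
    by unfold_locales (use XR in \<open>simp_all add: well_order_set_def linear_order_set_def\<close>)
  show "well_founded_on_class M (D_mem M Tw X) (D_less M Tw R)"
    unfolding well_founded_on_class_def
  proof
    assume "\<exists>F\<in>S. (\<forall>n. \<exists>!x. \<langle>n, x\<rangle> \<in> F) \<and> (\<forall>n x. \<langle>n, x\<rangle> \<in> F \<longrightarrow> D_mem M Tw X x) \<and>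
      (\<forall>n x y. \<langle>n, x\<rangle> \<in> F \<and> \<langle>n \<oplus> \<one>, y\<rangle> \<in> F \<longrightarrow> D_less M Tw R y x)"
    then obtain F where F: "F \<in> S" "\<And>n. \<exists>!x. \<langle>n, x\<rangle> \<in> F" "\<And>n x. \<langle>n, x\<rangle> \<in> F \<Longrightarrow> D_mem M Tw X x"
      "\<And>n x y. \<langle>n, x\<rangle> \<in> F \<Longrightarrow> \<langle>n \<oplus> \<one>, y\<rangle> \<in> F \<Longrightarrow> D_less M Tw R y x" by auto
    define f where "f n = the0 (\<lambda>x. \<langle>n, x\<rangle> \<in> F)" for n
    have df: "df (\<lambda>e. f (e 0))" unfolding f_def by (intro ari F)
    have f: "\<langle>n, f n\<rangle> \<in> F" for n unfolding f_def by (rule the0I[OF F(2)])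
    have fp: "f n = \<langle>pi1 (f n), pi2 (f n)\<rangle>" "D_pair M Tw (\<lambda>x. x \<in> X) (pi1 (f n)) (pi2 (f n))" for n
      using F(3)[OF f[of n]] unfolding D_mem_def by auto
    define w where "w n = code (un (pi1 (f n)) (pi2 (f n)))" for n
    have w: "elts (w n) = un (pi1 (f n)) (pi2 (f n))" for n
      unfolding w_def by (rule elts_code[OF un_word(2)[OF fp(2)]])
    show False
    proof (rule words_wf[of w, OF prog])
      show "df (\<lambda>e. w (e 0))" unfolding w_def by (intro ari df_comp1[OF df])
      show "wordX (elts (w k))" for k unfolding w by (rule un_word(1)[OF fp(2)])
      show "wless r (elts (w (k \<oplus> \<one>))) (elts (w k))" for k
      proof -
        have "D_less M Tw R (f (k \<oplus> \<one>)) (f k)" by (rule F(4)[OF f f])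
        then have "D_compare M Tw r (pi1 (f (k \<oplus> \<one>))) (pi2 (f (k \<oplus> \<one>))) (pi1 (f k)) (pi2 (f k))"
          by (subst (asm) fp(1), subst (asm) (3) fp(1)) (simp add: D_less_def)
        then show ?thesis unfolding w D_compare_un[OF fp(2) fp(2)] .
      qed
    qed
  qed
qed

end

section \<open>Ranking the trees in a fixed point\<close>

locale fp_wtrees = wf_wtrees +
  fixes \<xi>
  assumes \<xi>: "fixed_point M Tw X R \<xi>"
begin

lemma xi_props:
  "\<xi> \<in> S" "D_mem M Tw X d \<Longrightarrow> \<exists>!x. rel M \<xi> d x" "D_mem M Tw X d \<Longrightarrow> rel M \<xi> d x \<Longrightarrow> x \<in> X"
  "D_mem M Tw X d \<Longrightarrow> D_mem M Tw X d' \<Longrightarrow> rel M \<xi> d x \<Longrightarrow> rel M \<xi> d' x' \<Longrightarrow> D_less M Tw R d d' \<Longrightarrow> r x x'"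
proof -
  have f: "\<xi> \<in> S" "\<forall>d. D_mem M Tw X d \<longrightarrow> (\<exists>!x. rel M \<xi> d x)" "\<forall>d x. D_mem M Tw X d \<and> rel M \<xi> d x \<longrightarrow> x \<in> X"
    "\<forall>d d' x x'. D_mem M Tw X d \<and> D_mem M Tw X d' \<and> rel M \<xi> d x \<and> rel M \<xi> d' x' \<and> D_less M Tw R d d' \<longrightarrow> r x x'"
    using \<xi> unfolding fixed_point_def by simp_all
  show "\<xi> \<in> S" by (rule f)
  show "D_mem M Tw X d \<Longrightarrow> \<exists>!x. rel M \<xi> d x" using f(2) by simp
  show "D_mem M Tw X d \<Longrightarrow> rel M \<xi> d x \<Longrightarrow> x \<in> X" using f(3) by simp
  show "D_mem M Tw X d \<Longrightarrow> D_mem M Tw X d' \<Longrightarrow> rel M \<xi> d x \<Longrightarrow> rel M \<xi> d' x' \<Longrightarrow> D_less M Tw R d d' \<Longrightarrow> r x x'"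
    by (rule f(4)[THEN spec, THEN spec, THEN spec, THEN spec, THEN mp, of d d']) simp
qed

text \<open>The finite set is the support of the word, and each entry is replaced by its index
  there. So \<open>un\<close> reaches every coded word, and the fixed point acts on all of
  them.\<close>

lemma word_un_ex:
  assumes W: "wordX W" "fin W"
  shows "\<exists>a s. D_pair M Tw (\<lambda>x. x \<in> X) a s \<and> un a s = W"
proof -
  define a where "a = code (sp W)"
  have f: "fin (sp W)" by (rule fin_sp[OF W(2)])
  have spX: "x \<in> X" if "x \<in> sp W" for x using trip_sp[OF wordD(1)[OF W(1)] that] .
  have fa: "fs a" unfolding a_def by (rule fs_code[OF f spX])
  have ea: "elts a = sp W" unfolding a_def by (rule elts_code[OF f])
  define g where "g x = the0 (\<lambda>i. i \<prec> cd a \<and> en r a i = x)" for x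
  have dg: "df (\<lambda>e. g (e 0))" unfolding g_def by (intro ari)
  have g: "g x \<prec> cd a \<and> en r a (g x) = x" if "x \<in> sp W" for x
  proof -
    have "\<exists>i. i \<prec> cd a \<and> en r a i = x" by (rule enD(2)[OF fa]) (simp add: ea that)
    then obtain i where i: "i \<prec> cd a" "en r a i = x" by blast
    have "g x = i" unfolding g_def
    proof (rule the0_eq)
      show "j = i" if "j \<prec> cd a \<and> en r a j = x" for j using enD(4)[OF fa, of j i] that i by simp
    qed (use i in simp)
    then show ?thesis using i by simp
  qed
  have gi: "g (en r a i) = i" if "i \<prec> cd a" for i
    using g[of "en r a i"] enD(1)[OF fa that] enD(4)[OF fa _ that, of "g (en r a i)"] ea by simp
  define s where "s = code (rl g W)"
  have fr: "fin (rl g W)" by (rule fin_rl[OF W(2) dg])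
  have es: "elts s = rl g W" unfolding s_def by (rule elts_code[OF fr])
  have "word (\<lambda>x. x \<prec> cd a) (\<lambda>x y. x \<prec> y) (rl g W)"
  proof (rule word_rl[OF word_restrict[OF W(1)]])
    show "g x \<prec> g y" if "x \<in> sp W" "y \<in> sp W" "r x y" for x y
      using enD(5)[OF fa, of "g x" "g y"] g[OF that(1)] g[OF that(2)] that(3) by simp
  qed (use g in blast)
  then have m: "mem (cd a) s" using code_props(1)[OF fr] es by (simp add: Tw_simps s_def)
  have "ts (cd a) s (supp (cd a) s)" by (simp add: supp(1)[OF m])
  then have "elts (supp (cd a) s) = g ` sp W" by (simp add: Tw_simps es sp_rl)
  also have "\<dots> = {i. i \<prec> cd a}"
  proof
    show "g ` sp W \<subseteq> {i. i \<prec> cd a}" using g by blast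
    show "{i. i \<prec> cd a} \<subseteq> g ` sp W"
    proof
      fix i assume "i \<in> {i. i \<prec> cd a}"
      then have "i = g (en r a i)" "en r a i \<in> sp W" using gi enD(1)[OF fa] ea by auto
      then show "i \<in> g ` sp W" by (rule image_eqI)
    qed
  qed
  finally have "D_pair M Tw (\<lambda>x. x \<in> X) a s" using fa m by (simp add: D_pair_iff)
  moreover have "un a s = rl (\<lambda>x. x) W" unfolding un_def es rl_comp by (rule rl_cong) (use g in blast)
  ultimately show ?thesis using rl_id[OF wordD(1)[OF W(1)]] by auto
qed

definition xi where
  "xi c = the0 (\<lambda>x. \<exists>a s. D_mem M Tw X \<langle>a, s\<rangle> \<and> un a s = elts c \<and> rel M \<xi> \<langle>a, s\<rangle> x)"

lemma df_xi[ari]: assumes "df c" shows "df (\<lambda>e. xi (c e))"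
  unfolding xi_def by (intro ari XS xi_props(1) df_subst[OF assms])

text \<open>Two pairs with the same word are incomparable, hence equal by \<open>D_total\<close>.
  The value of \<open>xi\<close> therefore depends on the word alone.\<close>

lemma xi_eq:
  assumes "wordX (elts c)"
  obtains a s where "D_pair M Tw (\<lambda>x. x \<in> X) a s" "un a s = elts c" "rel M \<xi> \<langle>a, s\<rangle> (xi c)"
proof -
  obtain a s where a: "D_pair M Tw (\<lambda>x. x \<in> X) a s" "un a s = elts c" using word_un_ex[OF assms fin_elts] by blast
  then have d: "D_mem M Tw X \<langle>a, s\<rangle>" by (simp add: D_mem_def)
  obtain x where x: "rel M \<xi> \<langle>a, s\<rangle> x" using xi_props(2)[OF d] by (rule ex1E)
  have "xi c = x" unfolding xi_def
  proof (rule the0_eq)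
    show "\<exists>a s. D_mem M Tw X \<langle>a, s\<rangle> \<and> un a s = elts c \<and> rel M \<xi> \<langle>a, s\<rangle> x" using d a(2) x by blast
    fix y assume "\<exists>a s. D_mem M Tw X \<langle>a, s\<rangle> \<and> un a s = elts c \<and> rel M \<xi> \<langle>a, s\<rangle> y"
    then obtain b t where b: "D_mem M Tw X \<langle>b, t\<rangle>" "un b t = elts c" "rel M \<xi> \<langle>b, t\<rangle> y" by blast
    then have bp: "D_pair M Tw (\<lambda>x. x \<in> X) b t" by (simp add: D_mem_def)
    have "b = a \<and> t = s"
      using D_total[OF bp a(1)] wlessX_irrefl[OF assms] a(2) b(2)
      unfolding D_compare_un[OF bp a(1)] D_compare_un[OF a(1) bp] by simp
    then show "y = x" using b(3) x xi_props(2)[OF d] by blast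
  qed
  then show thesis using that a x by simp
qed

lemma xi_X: assumes "wordX (elts c)" shows "xi c \<in> X"
proof -
  obtain a s where a: "D_pair M Tw (\<lambda>x. x \<in> X) a s" "un a s = elts c" "rel M \<xi> \<langle>a, s\<rangle> (xi c)"
    using assms by (rule xi_eq)
  have "D_mem M Tw X \<langle>a, s\<rangle>" using a(1) by (simp add: D_mem_def)
  then show ?thesis by (rule xi_props(3)[OF _ a(3)])
qed

lemma xi_less: assumes "wordX (elts c)" "wordX (elts d)" "wless r (elts c) (elts d)" shows "r (xi c) (xi d)"
proof -
  obtain a s where a: "D_pair M Tw (\<lambda>x. x \<in> X) a s" "un a s = elts c" "rel M \<xi> \<langle>a, s\<rangle> (xi c)"
    using assms(1) by (rule xi_eq)
  obtain b t where b: "D_pair M Tw (\<lambda>x. x \<in> X) b t" "un b t = elts d" "rel M \<xi> \<langle>b, t\<rangle> (xi d)"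
    using assms(2) by (rule xi_eq)
  have "D_less M Tw R \<langle>a, s\<rangle> \<langle>b, t\<rangle>"
    using D_compare_un[OF a(1) b(1)] a(2) b(2) assms(3) by (simp add: D_less_def)
  then show ?thesis using xi_props(4)[OF _ _ a(3) b(3)] a(1) b(1) by (simp add: D_mem_def)
qed

definition hd_word where "hd_word b n = code {\<langle>\<zero>, \<langle>b, n\<rangle>\<rangle>}"

text \<open>The letter for \<open>j\<close> combines two separate data: the rank of the node with
  code \<open>j\<close> in one tree, and entry \<open>j\<close> of a node of the next tree.\<close>

definition nodes where "nodes h s = {p. \<exists>j v. \<langle>j, v\<rangle> \<in> elts s \<and> p = \<langle>j \<oplus> \<one>, \<langle>h j, v\<rangle>\<rangle>}"

definition nd_word where "nd_word b n h s = code (insert \<langle>\<zero>, \<langle>b, n\<rangle>\<rangle> (nodes h s))"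

lemma hd_word: "elts (hd_word b n) = {\<langle>\<zero>, \<langle>b, n\<rangle>\<rangle>}"
  unfolding hd_word_def by (rule elts_code[OF fin_single])

lemma fin_nodes: assumes "df (\<lambda>e. h (e 0))" shows "fin (nodes h s)"
proof (rule fin_subset)
  show "fin ((\<lambda>p. \<langle>pi1 p \<oplus> \<one>, \<langle>h (pi1 p), pi2 p\<rangle>\<rangle>) ` elts s)"
    by (intro fin_image fin_elts ari df_comp1[OF assms])
  show "nodes h s \<in> S" unfolding nodes_def by (rule setI, intro ari df_comp1[OF assms])
  show "nodes h s \<subseteq> (\<lambda>p. \<langle>pi1 p \<oplus> \<one>, \<langle>h (pi1 p), pi2 p\<rangle>\<rangle>) ` elts s" unfolding nodes_def by force
qed

lemma nd_word: "df (\<lambda>e. h (e 0)) \<Longrightarrow> elts (nd_word b n h s) = insert \<langle>\<zero>, \<langle>b, n\<rangle>\<rangle> (nodes h s)"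
  unfolding nd_word_def by (rule elts_code[OF fin_insert[OF fin_nodes]])

lemma nodes_iff: "\<langle>j \<oplus> \<one>, \<langle>x, v\<rangle>\<rangle> \<in> nodes h s \<longleftrightarrow> \<langle>j, v\<rangle> \<in> elts s \<and> x = h j"
  by (auto simp: nodes_def)

text \<open>The hypotheses on values of \<open>h\<close> concern all numbers, since positions in
  \<open>s\<close> need not be codes of nodes of \<open>Tr n\<close>. The ranking condition is
  confined to nodes.\<close>

lemma word_nd_word:
  assumes h: "df (\<lambda>e. h (e 0))" and b: "b \<in> X" "\<And>j. h j \<in> X" "\<And>j. r (h j) b"
    and T: "Tr (n \<oplus> \<one>) s" and rk: "\<And>i j. Tr n i \<Longrightarrow> Tr n j \<Longrightarrow> elts i \<subset> elts j \<Longrightarrow> r (h j) (h i)"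
  shows "wordX (elts (nd_word b (n \<oplus> \<one>) h s))"
  unfolding nd_word[OF h]
proof (rule wordI)
  let ?W = "insert \<langle>\<zero>, \<langle>b, n \<oplus> \<one>\<rangle>\<rangle> (nodes h s)"
  have s: "fcode s" "seq (elts s)" using Tr_seq[OF T] by simp_all
  have W: "\<langle>j \<oplus> \<one>, \<langle>x, v\<rangle>\<rangle> \<in> ?W \<longleftrightarrow> \<langle>j, v\<rangle> \<in> elts s \<and> x = h j" for j x v
    using nodes_iff by auto
  have W0: "\<langle>\<zero>, y\<rangle> \<in> ?W \<longleftrightarrow> y = \<langle>b, n \<oplus> \<one>\<rangle>" for y by (auto simp: nodes_def)
  have W1: "\<langle>j \<oplus> \<one>, y\<rangle> \<in> ?W \<longleftrightarrow> (\<exists>v. \<langle>j, v\<rangle> \<in> elts s \<and> y = \<langle>h j, v\<rangle>)" for j y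
    by (auto simp: nodes_def)
  show "trip (\<lambda>x. x \<in> X) ?W" using b by (auto simp: trip_def nodes_def)
  show "seq ?W" unfolding seq_def
  proof (intro conjI allI impI ballI)
    show "\<exists>j y. p = \<langle>j, y\<rangle>" if "p \<in> ?W" for p using that by (auto simp: nodes_def)
    show "y = y'" if y: "\<langle>j, y\<rangle> \<in> ?W \<and> \<langle>j, y'\<rangle> \<in> ?W" for j y y'
    proof (cases "j = \<zero>")
      case True
      then show ?thesis using y unfolding True W0 by simp
    next
      case False
      then obtain i where i: "j = i \<oplus> \<one>" using zero_or_succ by blast
      obtain v v' where v: "\<langle>i, v\<rangle> \<in> elts s" "y = \<langle>h i, v\<rangle>" "\<langle>i, v'\<rangle> \<in> elts s" "y' = \<langle>h i, v'\<rangle>"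
        using y unfolding i W1 by blast
      then have "v = v'" using s(2) unfolding seq_def by blast
      then show ?thesis using v by simp
    qed
    show "\<exists>y. \<langle>i, y\<rangle> \<in> ?W" if y: "\<langle>j, y\<rangle> \<in> ?W \<and> i \<prec> j" for j y i
    proof (cases "i = \<zero>")
      case True
      then show ?thesis using W0 by blast
    next
      case False
      then obtain i' where i': "i = i' \<oplus> \<one>" using zero_or_succ by blast
      have "j \<noteq> \<zero>" using y by auto
      then obtain j' where j': "j = j' \<oplus> \<one>" using zero_or_succ by blast
      have ij: "i' \<prec> j'" using y unfolding i' j' succ_less by blast
      obtain v where v: "\<langle>j', v\<rangle> \<in> elts s" using y unfolding j' W1 by blast
      then obtain v' where "\<langle>i', v'\<rangle> \<in> elts s" using s(2) ij unfolding seq_def by blast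
      then show ?thesis unfolding i' W1 by blast
    qed
  qed
  have "tree ?W = elts s"
  proof -
    have "p \<in> tree ?W \<longleftrightarrow> p \<in> elts s" for p
    proof
      show "p \<in> tree ?W \<Longrightarrow> p \<in> elts s" unfolding tree_def W by blast
      assume p: "p \<in> elts s"
      then obtain j v where "p = \<langle>j, v\<rangle>" using s(2) unfolding seq_def by blast
      then show "p \<in> tree ?W" unfolding tree_def W using p by blast
    qed
    then show ?thesis by blast
  qed
  then have t: "code (tree ?W) = s" using code_elts[OF s(1)] by simp
  show "Tr m (code (tree ?W))" if "\<langle>\<zero>, \<langle>c, m\<rangle>\<rangle> \<in> ?W" for c m
    using that T unfolding t W0 by simp
  show "r x c" if "\<langle>\<zero>, \<langle>c, m\<rangle>\<rangle> \<in> ?W" "\<langle>j \<oplus> \<one>, \<langle>x, v\<rangle>\<rangle> \<in> ?W" for c m j x v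
    using that b(3) unfolding W0 W by simp
  show "r y x" if a: "\<langle>\<zero>, \<langle>c, k \<oplus> \<one>\<rangle>\<rangle> \<in> ?W" "Tr k i" "Tr k j" "elts i \<subset> elts j"
      "\<langle>i \<oplus> \<one>, \<langle>x, u\<rangle>\<rangle> \<in> ?W" "\<langle>j \<oplus> \<one>, \<langle>y, v\<rangle>\<rangle> \<in> ?W" for c k i j x y u v
  proof -
    have "k = n" "x = h i" "y = h j" using a(1,5,6) unfolding W0 W by simp_all
    then show ?thesis using rk[OF _ _ a(4)] a(2,3) by simp
  qed
qed

lemma wordX_hd: "b \<in> X \<Longrightarrow> wordX (elts (hd_word b n))"
  unfolding hd_word by (rule word_header)

lemma slot_nd0:
  assumes "df (\<lambda>e. h (e 0))"
  shows "slot (elts (nd_word b n h s)) \<zero> = {\<langle>b, n\<rangle>}"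
    "slot (elts (nd_word b n h s)) (j \<oplus> \<one>) = {y. \<exists>v. \<langle>j, v\<rangle> \<in> elts s \<and> y = \<langle>h j, v\<rangle>}"
  unfolding nd_word[OF assms] slot_def nodes_def by auto

lemma slot_hd0: "slot (elts (hd_word b n)) \<zero> = {\<langle>b, n\<rangle>}"
  unfolding hd_word slot_def by auto

lemma wless_slot0: "sless r \<zero> (slot W \<zero>) (slot V \<zero>) \<Longrightarrow> wless r W V"
  unfolding wless_def by (rule exI[of _ \<zero>]) simp

text \<open>At the first position after the end of \<open>s\<close> the word of \<open>t\<close> has
  a letter and that of \<open>s\<close> has none, and after the header a missing letter is largest.
  So longer nodes get smaller words, as a ranking requires.\<close>

lemma nd_less_nd:
  assumes h: "df (\<lambda>e. h (e 0))" and s: "seq (elts s)" "seq (elts t)" "elts s \<subset> elts t"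
  shows "wless r (elts (nd_word b n h t)) (elts (nd_word b n h s))"
proof -
  obtain p where p: "p \<in> elts t" "p \<notin> elts s" using s(3) by blast
  then obtain j0 v0 where p0: "p = \<langle>j0, v0\<rangle>" using s(2) unfolding seq_def by blast
  have fn: "v = v'" if "\<langle>j, v\<rangle> \<in> elts t" "\<langle>j, v'\<rangle> \<in> elts t" for j v v' using s(2) that unfolding seq_def by blast
  have nj0: "\<not> (\<exists>v. \<langle>j0, v\<rangle> \<in> elts s)" using p s(3) fn unfolding p0 by blast
  have "ar (\<lambda>e. \<not> (\<exists>v. \<langle>e 0, v\<rangle> \<in> elts s))" by (intro ari)
  then obtain j where j: "\<not> (\<exists>v. \<langle>j, v\<rangle> \<in> elts s)" "\<And>i. i \<prec> j \<Longrightarrow> \<not> \<not> (\<exists>v. \<langle>i, v\<rangle> \<in> elts s)"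
    by (rule least[of "\<lambda>j. \<not> (\<exists>v. \<langle>j, v\<rangle> \<in> elts s)", OF _ nj0]) (rule that)
  have jt: "\<exists>v. \<langle>j, v\<rangle> \<in> elts t"
  proof (cases "j \<prec> j0")
    case True
    then show ?thesis using s(2) p(1) unfolding p0 seq_def by blast
  next
    case False
    have "\<not> j0 \<prec> j" using j(2) nj0 by blast
    then have "j = j0" using False less_linear by blast
    then show ?thesis using p(1) p0 by blast
  qed
  show ?thesis unfolding wless_def
  proof (rule exI[of _ "j \<oplus> \<one>"], intro conjI allI impI)
    show "sless r (j \<oplus> \<one>) (slot (elts (nd_word b n h t)) (j \<oplus> \<one>)) (slot (elts (nd_word b n h s)) (j \<oplus> \<one>))"
      unfolding slot_nd0[OF h] using j(1) jt by (auto simp: sless_def)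
    fix i assume i: "i \<prec> j \<oplus> \<one>"
    show "slot (elts (nd_word b n h t)) i = slot (elts (nd_word b n h s)) i"
    proof (cases "i = \<zero>")
      case False
      then obtain k where k: "i = k \<oplus> \<one>" using zero_or_succ by blast
      then have "k \<prec> j" using i by (simp only: succ_less)
      then obtain v where "\<langle>k, v\<rangle> \<in> elts s" using j(2) by blast
      then have "\<langle>k, v'\<rangle> \<in> elts t \<longleftrightarrow> \<langle>k, v'\<rangle> \<in> elts s" for v' using s(3) fn by blast
      then show ?thesis unfolding k slot_nd0[OF h] by simp
    qed (simp add: slot_nd0[OF h])
  qed
qed

lemma no_path: "\<not> path n p"
proof
  assume path: "path n p"
  \<comment> \<open>The image of the empty word lies below those of all other words. It ranks
    everything at level \<open>\<zero>\<close> and is the default for numbers that are not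
    nodes.\<close>
  define x0 where "x0 = xi (code {})"
  have e0: "elts (code {}) = {}" by (rule elts_code[OF fin_empty])
  have w0: "wordX (elts (code {}))" unfolding e0 by (rule word_empty)
  have x0: "x0 \<in> X" unfolding x0_def by (rule xi_X[OF w0])
  have x0_less: "r x0 (xi c)" if "wordX (elts c)" "slot (elts c) \<zero> \<noteq> {}" for c
    unfolding x0_def
  proof (rule xi_less[OF w0 that(1)])
    show "wless r (elts (code {})) (elts c)"
      by (rule wless_slot0) (use that(2) in \<open>auto simp: e0 sless_def slot_def\<close>)
  qed
  \<comment> \<open>The bound at level \<open>n \<oplus> \<one>\<close> comes from a header with
    entry \<open>b n\<close> and number \<open>n \<oplus> \<one> \<oplus> \<one>\<close>, one more
    than in the words that yield the ranks. So it exceeds all these ranks although the entry is the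
    same.\<close>
  have d1: "df (\<lambda>e. xi (hd_word (e (Suc (Suc 0))) (e (Suc 0) \<oplus> \<one> \<oplus> \<one>)))" unfolding hd_word_def by (intro ari)
  obtain b0 where b0: "df (\<lambda>e. b0 (e 0) (e (Suc 0)))" "\<And>K. b0 K \<zero> = xi (hd_word x0 \<zero>)"
    "\<And>K n. b0 K (n \<oplus> \<one>) = xi (hd_word (b0 K n) (n \<oplus> \<one> \<oplus> \<one>))"
    by (rule primrec_ex[of "\<lambda>K. xi (hd_word x0 \<zero>)" "\<lambda>K n y. xi (hd_word y (n \<oplus> \<one> \<oplus> \<one>))", OF df_const d1]) (rule that)
  define b where "b = b0 \<zero>"
  have db: "df (\<lambda>e. b (e 0))" unfolding b_def by (intro df_comp2[OF b0(1)] ari)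
  have b: "b \<zero> = xi (hd_word x0 \<zero>)" "b (n \<oplus> \<one>) = xi (hd_word (b n) (n \<oplus> \<one> \<oplus> \<one>))" for n
    unfolding b_def b0 by simp_all
  \<comment> \<open>Course-of-values recursion on \<open>\<langle>n, s\<rangle>\<close>. The rank of
    \<open>s\<close> at level \<open>n \<oplus> \<one>\<close> looks up ranks at level
    \<open>n\<close> for positions \<open>j\<close> in \<open>s\<close> only; as
    \<open>j \<prec> s\<close>, the pairs \<open>\<langle>n, j\<rangle>\<close> are smaller.\<close>
  define G where "G m g = (if pi1 m \<noteq> \<zero> \<and> Tr (pi1 m) (pi2 m)
    then xi (nd_word (b (pd (pi1 m))) (pi1 m) (\<lambda>j. app g \<langle>pd (pi1 m), j\<rangle>) (pi2 m)) else x0)" for m g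
  have dG: "df (\<lambda>e. G (e 0) (e (Suc 0)))"
    unfolding G_def nd_word_def nodes_def by (intro ari df_comp1[OF db])
  obtain H where H: "df (\<lambda>e. H (e 0))" "\<And>m. H m = G m (gr m H)" by (rule cov_rec_ex[OF dG]) (rule that)
  define f where "f n s = H \<langle>n, s\<rangle>" for n s
  have df: "df (\<lambda>e. f n (e 0))" for n unfolding f_def by (intro df_comp1[OF H(1)] ari)
  have f0: "f \<zero> s = x0" for s unfolding f_def H(2)[of "\<langle>\<zero>, s\<rangle>"] by (simp add: G_def)
  have f1: "f (n \<oplus> \<one>) s = (if Tr (n \<oplus> \<one>) s then xi (nd_word (b n) (n \<oplus> \<one>) (f n) s) else x0)" for n s
  proof -
    have "app (gr \<langle>n \<oplus> \<one>, s\<rangle> H) \<langle>n, j\<rangle> = f n j" if "\<langle>j, v\<rangle> \<in> elts s" for j v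
    proof -
      have "j \<prec> s" using le_lt_trans[OF pair_le1 fm_less] that in_elts by blast
      then have "\<langle>n, j\<rangle> \<prec> \<langle>n \<oplus> \<one>, s\<rangle>" by (intro pair_mono12) simp_all
      then show ?thesis unfolding f_def by (rule gr_simps(5)[OF H(1)])
    qed
    then have "nodes (\<lambda>j. app (gr \<langle>n \<oplus> \<one>, s\<rangle> H) \<langle>n, j\<rangle>) s = nodes (f n) s"
      unfolding nodes_def by auto
    then have "nd_word (b n) (n \<oplus> \<one>) (\<lambda>j. app (gr \<langle>n \<oplus> \<one>, s\<rangle> H) \<langle>n, j\<rangle>) s = nd_word (b n) (n \<oplus> \<one>) (f n) s"
      unfolding nd_word_def by simp
    then show ?thesis unfolding f_def[of "n \<oplus> \<one>"] H(2)[of "\<langle>n \<oplus> \<one>, s\<rangle>"] by (simp add: G_def)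
  qed
  \<comment> \<open>\<open>f n\<close> ranks \<open>Tr n\<close> below \<open>b n\<close>\<close>
  let ?I = "\<lambda>n. b n \<in> X \<and> (\<forall>s. f n s \<in> X \<and> r (f n s) (b n)) \<and>
    (\<forall>s t. Tr n s \<and> Tr n t \<and> elts s \<subset> elts t \<longrightarrow> r (f n t) (f n s))"
  have I: "?I n" for n
  proof (rule ind[of ?I])
    show "ar (\<lambda>e. ?I (e 0))" unfolding f_def psubset_eq by (intro ari df_comp1[OF db] df_comp1[OF H(1)] XS RS)
    have w: "wordX (elts (hd_word x0 \<zero>))" by (rule wordX_hd[OF x0])
    show "?I \<zero>"
      unfolding f0 b(1) using xi_X[OF w] x0 x0_less[OF w] slot_hd0 Tr_0 by auto
    fix n assume IH: "?I n"
    have nd: "wordX (elts (nd_word (b n) (n \<oplus> \<one>) (f n) s))" if "Tr (n \<oplus> \<one>) s" for s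
      by (rule word_nd_word[OF df _ _ _ that]) (use IH in blast)+
    have hd: "wordX (elts (hd_word (b n) (n \<oplus> \<one> \<oplus> \<one>)))" using IH by (intro wordX_hd) blast
    have "b (n \<oplus> \<one>) \<in> X" unfolding b(2) by (rule xi_X[OF hd])
    moreover have "f (n \<oplus> \<one>) s \<in> X" for s unfolding f1 using xi_X[OF nd] x0 by simp
    moreover have "r (f (n \<oplus> \<one>) s) (b (n \<oplus> \<one>))" for s
    proof (cases "Tr (n \<oplus> \<one>) s")
      case True
      have "wless r (elts (nd_word (b n) (n \<oplus> \<one>) (f n) s)) (elts (hd_word (b n) (n \<oplus> \<one> \<oplus> \<one>)))"
        by (rule wless_slot0) (simp add: slot_nd0(1)[OF df] slot_hd0 sless_def lless_def)
      then show ?thesis unfolding f1 b(2) using True xi_less[OF nd[OF True] hd] by simp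
    next
      case False
      then show ?thesis unfolding f1 b(2) using x0_less[OF hd] slot_hd0 by simp
    qed
    moreover have "r (f (n \<oplus> \<one>) t) (f (n \<oplus> \<one>) s)" if "Tr (n \<oplus> \<one>) s" "Tr (n \<oplus> \<one>) t" "elts s \<subset> elts t" for s t
      unfolding f1 using that xi_less[OF nd[OF that(2)] nd[OF that(1)] nd_less_nd[OF df _ _ that(3)]] Tr_seq by simp
    ultimately show "?I (n \<oplus> \<one>)" by blast
  qed
  have p: "df (\<lambda>e. p (e 0))" "\<And>m. Tr n (gr m p)" using path unfolding path_def by blast+
  show False
  proof (rule wfD[of "\<lambda>m. f n (gr m p)"])
    show "df (\<lambda>e. f n (gr (e 0) p))" by (intro df_comp1[OF df] ari df_comp1[OF p(1)])
    show "f n (gr m p) \<in> X" for m using I by blast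
    show "r (f n (gr (m \<oplus> \<one>) p)) (f n (gr m p))" for m
    proof -
      have "elts (gr m p) \<subset> elts (gr (m \<oplus> \<one>) p)" by (rule gr_psubset[OF p(1)])
      then show ?thesis using I p(2) by blast
    qed
  qed
qed

end

context aca
begin

lemma fixed_point_imp_tree_induction:
  assumes "every_normal_dilator_has_wf_fixed_point M" shows "tree_induction M"
  unfolding tree_induction_def
proof (intro allI impI)
  fix Tr n p assume t: "trees M Tr" and
    prog: "\<forall>n. (\<nexists>p. trees.path M Tr n p) \<longrightarrow> (\<nexists>p. trees.path M Tr (n \<oplus> \<one>) p)"
  interpret trees M Tr by (rule t)
  have "normal_dilator M Tw muw"
    unfolding normal_dilator_def using Tw_normal Tw_dilator prog by blast
  then obtain X R \<xi> where X: "fixed_point M Tw X R \<xi>" "well_founded_set M X R"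
    using assms unfolding every_normal_dilator_has_wf_fixed_point_def by blast
  then have l: "X \<in> S" "R \<in> S" "lin (\<lambda>x. x \<in> X) (rel M R)"
    unfolding fixed_point_def linear_order_set_def by simp_all
  interpret fp_wtrees M Tr X R \<xi> by unfold_locales (fact l X)+
  show "\<not> path n p" by (rule no_path)
qed

end

theorem theorem4p10:
  fixes M :: "'a l2_structure"
  assumes "ACA0 M"
  shows "(every_normal_dilator_has_wf_fixed_point M \<longleftrightarrow> Fix_of_every_normal_dilator_well_founded M) \<and>
         (Fix_of_every_normal_dilator_well_founded M \<longleftrightarrow> Pi11_induction M)"
proof -
  interpret aca M by unfold_locales (rule assms)
  show ?thesis
    using Fix_imp_fixed_point Pi11_imp_Fix fixed_point_imp_tree_induction tree_induction_imp_Pi11 by blast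
qed

end
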